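(* Let $N\ge3$ be a fixed integer. For every integer $k\ge2$ there is a unique $\rho_k\in(0,1)$ such that $$\min_{r\in(\rho,1)}\Lambda_1(r)>0\ \text{ for }\rho\in(\rho_k,1)\qquad\text{and}\qquad \min_{r\in(\rho,1)}\Lambda_1(r)<0\ \text{ for }\rho\in(0,\rho_k).$$ Moreover, $\rho_k$ is determined by the relation $$-\frac{\mathfrak C_{k,N}}{N-2}+\sum_{m=0}^{+\infty}\frac{1}{2m+N-2}\,\frac{2\rho_k^{\frac{2m+N-2}{2}}}{1+\rho_k^{\frac{2m+N-2}{2}}}\left(d_m+\sum_{j=1}^{k-1}Z_m\!\left(\tfrac{\xi_1}{|\xi_1|},\tfrac{\xi_{j+1}}{|\xi_{j+1}|}\right)\right)=0,$$ it satisfies the lower bound $$\rho_k>\frac{2\mathfrak a_{k,N}+1-\sqrt{4\mathfrak a_{k,N}+1}}{2\mathfrak a_{k,N}},\qquad \mathfrak a_{k,N}:=\left(\frac{\mathfrak C_{k,N}}{2k(N-2)^{N-3}}\right)^{\frac{2}{N-2}},$$ and $\rho_k\to1$ as $k\to+\infty$.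
   Context: For $0<\rho<1$ let $\Omega_\rho=\{x\in\mathbb R^N:\rho<|x|<1\}$. Let $G_\rho$ be the Green function of $-\Delta$ on $\Omega_\rho$ with Dirichlet boundary conditions ($-\Delta_xG_\rho(x,y)=\delta_y$ in $\Omega_\rho$, $G_\rho(\cdot,y)=0$ on $\partial\Omega_\rho$), let $H_\rho(x,y)=\frac{1}{\omega_{N-1}(N-2)}\frac{1}{|x-y|^{N-2}}-G_\rho(x,y)$ be its regular part, where $\omega_{N-1}$ is the surface measure of the unit sphere of $\mathbb R^N$, and let $\tau_\rho(x)=H_\rho(x,x)$ be the Robin function. For $r\in(\rho,1)$ and $j=1,\dots,k$ set $\xi_j=\xi_j(r)=\big(r\cos\tfrac{2\pi(j-1)}{k},\,r\sin\tfrac{2\pi(j-1)}{k},\,0,\dots,0\big)\in\mathbb R^N$, and $$\Lambda_1(r)=\tau_\rho(\xi_1(r))-\sum_{j=1}^{k-1}G_\rho(\xi_1(r),\xi_{j+1}(r)).$$ (The function $\Lambda_1$ depends on $\rho$, $k$ and $N$.) Further notation: $\mathfrak C_{k,N}=\sum_{j=1}^{k-1}\frac{1}{(2\sin(\pi j/k))^{N-2}}$; $d_m=\frac{N+2m-2}{N-2}\binom{N+m-3}{N-3}$ for $m\ge0$; $Z_m$ is the zonal harmonic of degree $m$, given for unit vectors $x',y'$ by $Z_m(x',y')=\frac{N+2m-2}{N-2}\,C_m^{\frac{N-2}{2}}(x'\cdot y')$, where $C_m^\lambda$ are the Gegenbauer polynomials, defined by $(1-2st+s^2)^{-\lambda}=\sum_{m\ge0}C_m^\lambda(t)s^m$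 for $0\le s<1$, $|t|\le1$, $\lambda>0$. Note that $\xi_j/|\xi_j|$ does not depend on $r$. *)

theory Defs
  imports "HOL-Analysis.Analysis"
begin

section \<open>Smooth test functions and the Laplacian on Euclidean space\<close>

definition partial_deriv :: "'n::finite \<Rightarrow> (real^'n \<Rightarrow> real) \<Rightarrow> real^'n \<Rightarrow> real" where
  "partial_deriv i f x = frechet_derivative f (at x) (axis i 1)"

primrec Ck :: "nat \<Rightarrow> (real^'n::finite \<Rightarrow> real) \<Rightarrow> bool" where
  "Ck 0 f = continuous_on UNIV f"
| "Ck (Suc m) f = ((\<forall>x. f differentiable (at x)) \<and> (\<forall>i. Ck m (partial_deriv i f)))"

definition smooth :: "(real^'n::finite \<Rightarrow> real) \<Rightarrow> bool" where
  "smooth f \<longleftrightarrow> (\<forall>m. Ck m f)"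

definition laplacian :: "(real^'n::finite \<Rightarrow> real) \<Rightarrow> real^'n \<Rightarrow> real" where
  "laplacian f x = (\<Sum>i\<in>UNIV. partial_deriv i (partial_deriv i f) x)"

definition test_function :: "(real^'n::finite) set \<Rightarrow> (real^'n \<Rightarrow> real) \<Rightarrow> bool" where
  "test_function \<Omega> \<phi> \<longleftrightarrow>
     smooth \<phi> \<and> compact (closure {x. \<phi> x \<noteq> 0}) \<and> closure {x. \<phi> x \<noteq> 0} \<subseteq> \<Omega>"

section \<open>Dirichlet Green function, regular part, Robin function\<close>

text \<open>
  The last conjunct is \<open>- \<Delta> g = \<delta>\<^sub>y\<close> in \<open>\<Omega>\<close> in the sense of distributions, for a locally
  integrable \<open>g\<close>; the first two say that \<open>g\<close> takes the boundary value \<open>0\<close> continuously.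
\<close>
definition is_green_with_pole :: "(real^'n::finite) set \<Rightarrow> real^'n \<Rightarrow> (real^'n \<Rightarrow> real) \<Rightarrow> bool" where
  "is_green_with_pole \<Omega> y g \<longleftrightarrow>
     continuous_on (closure \<Omega> - {y}) g \<and>
     (\<forall>x\<in>frontier \<Omega>. g x = 0) \<and>
     (\<forall>K. compact K \<and> K \<subseteq> \<Omega> \<longrightarrow> set_integrable lebesgue K g) \<and>
     (\<forall>\<phi>. test_function \<Omega> \<phi> \<longrightarrow> (LINT x:\<Omega>|lebesgue. g x * (- laplacian \<phi> x)) = \<phi> y)"

text \<open>
  For bounded open \<open>\<Omega>\<close> and \<open>y \<in> \<Omega>\<close> the predicate determines \<open>g\<close> on \<open>closure \<Omega> - {y}\<close>;
  the values chosen at \<open>y\<close> and outside \<open>closure \<Omega>\<close> are never used below.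
\<close>
definition green :: "(real^'n::finite) set \<Rightarrow> real^'n \<Rightarrow> real^'n \<Rightarrow> real" where
  "green \<Omega> x y = (SOME g. is_green_with_pole \<Omega> y g) x"

text \<open>
  The surface measure \<open>\<omega>\<^bsub>N-1\<^esub>\<close> of the unit sphere of \<open>\<real>\<^sup>N\<close>, as the derivative at \<open>r = 1\<close>
  of the volume \<open>r\<^sup>N vol(B)\<close> of the ball of radius \<open>r\<close>.
\<close>
definition sphere_area :: "'n::finite itself \<Rightarrow> real" where
  "sphere_area _ = real CARD('n) * measure lebesgue (ball (0::real^'n) 1)"

definition fund_sol :: "real^'n::finite \<Rightarrow> real^'n \<Rightarrow> real" where
  "fund_sol x y =
     1 / (sphere_area TYPE('n) * (real CARD('n) - 2)) * (1 / norm (x - y) ^ (CARD('n) - 2))"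

text \<open>
  On the diagonal the defining difference is singular and \<open>H(y,y)\<close> denotes the value of the
  continuous extension of \<open>H(\<cdot>,y)\<close>.
\<close>
definition regular_part :: "(real^'n::finite) set \<Rightarrow> real^'n \<Rightarrow> real^'n \<Rightarrow> real" where
  "regular_part \<Omega> x y =
     (if x = y then Lim (at y) (\<lambda>z. fund_sol z y - green \<Omega> z y)
      else fund_sol x y - green \<Omega> x y)"

definition robin :: "(real^'n::finite) set \<Rightarrow> real^'n \<Rightarrow> real" where
  "robin \<Omega> x = regular_part \<Omega> x x"

section \<open>The annulus, the polygon and the function \<open>\<Lambda>\<^sub>1\<close>\<close>

definition annulus :: "real \<Rightarrow> (real^'n::finite) set" where
  "annulus \<rho> = {x. \<rho> < norm x \<and> norm x < 1}"

text \<open>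
  A finite index type carries no order, so the indices \<open>p \<noteq> q\<close> play the role of the first and
  the second coordinate.
\<close>
definition xi :: "'n::finite \<Rightarrow> 'n \<Rightarrow> nat \<Rightarrow> real \<Rightarrow> nat \<Rightarrow> real^'n" where
  "xi p q k r j = (\<chi> i. if i = p then r * cos (2 * pi * (real j - 1) / real k)
                        else if i = q then r * sin (2 * pi * (real j - 1) / real k)
                        else 0)"

definition xi_dir :: "'n::finite \<Rightarrow> 'n \<Rightarrow> nat \<Rightarrow> nat \<Rightarrow> real^'n" where
  "xi_dir p q k j = (1 / norm (xi p q k 1 j)) *\<^sub>R xi p q k 1 j"

lemma xi_dir_eq:
  assumes "r > 0"
  shows "(1 / norm (xi p q k r j)) *\<^sub>R xi p q k r j = xi_dir p q k j"
proof -
  have "xi p q k r j = r *\<^sub>R xi p q k 1 j"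
    by (simp add: xi_def vec_eq_iff)
  with assms show ?thesis by (simp add: xi_dir_def)
qed

definition Lambda1 :: "'n::finite \<Rightarrow> 'n \<Rightarrow> nat \<Rightarrow> real \<Rightarrow> real \<Rightarrow> real" where
  "Lambda1 p q k \<rho> r =
     robin (annulus \<rho>) (xi p q k r 1)
     - (\<Sum>j=1..k-1. green (annulus \<rho>) (xi p q k r 1) (xi p q k r (j + 1)))"

definition is_min_on :: "real set \<Rightarrow> (real \<Rightarrow> real) \<Rightarrow> real \<Rightarrow> bool" where
  "is_min_on S f m \<longleftrightarrow> (\<exists>x\<in>S. f x = m) \<and> (\<forall>x\<in>S. m \<le> f x)"

definition is_threshold :: "'n::finite \<Rightarrow> 'n \<Rightarrow> nat \<Rightarrow> real \<Rightarrow> bool" where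
  "is_threshold p q k \<rho>k \<longleftrightarrow>
     \<rho>k \<in> {0<..<1} \<and>
     (\<forall>\<rho>\<in>{\<rho>k<..<1}. \<exists>m>0. is_min_on {\<rho><..<1} (Lambda1 p q k \<rho>) m) \<and>
     (\<forall>\<rho>\<in>{0<..<\<rho>k}. \<exists>m<0. is_min_on {\<rho><..<1} (Lambda1 p q k \<rho>) m)"

section \<open>Zonal harmonics and constants\<close>

definition gegenbauer :: "real \<Rightarrow> nat \<Rightarrow> real \<Rightarrow> real" where
  "gegenbauer lam m t =
     (THE c :: nat \<Rightarrow> real. \<forall>s\<in>{0..<1}.
        (\<lambda>i. c i * s ^ i) sums ((1 - 2 * s * t + s\<^sup>2) powr (- lam))) m"

definition zonal :: "nat \<Rightarrow> real^'n::finite \<Rightarrow> real^'n \<Rightarrow> real" where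
  "zonal m x y = (real CARD('n) + 2 * real m - 2) / (real CARD('n) - 2)
                 * gegenbauer ((real CARD('n) - 2) / 2) m (x \<bullet> y)"

definition d_coeff :: "nat \<Rightarrow> nat \<Rightarrow> real" where
  "d_coeff N m = (real N + 2 * real m - 2) / (real N - 2) * real ((N + m - 3) choose (N - 3))"

definition C_const :: "nat \<Rightarrow> nat \<Rightarrow> real" where
  "C_const k N = (\<Sum>j=1..k-1. 1 / (2 * sin (pi * real j / real k)) ^ (N - 2))"

definition a_const :: "nat \<Rightarrow> nat \<Rightarrow> real" where
  "a_const k N =
     (C_const k N / (2 * real k * (real N - 2) ^ (N - 3))) powr (2 / (real N - 2))"

definition relation_term :: "'n::finite \<Rightarrow> 'n \<Rightarrow> nat \<Rightarrow> real \<Rightarrow> nat \<Rightarrow> real" where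
  "relation_term p q k \<rho> m =
     1 / (2 * real m + real CARD('n) - 2)
     * (2 * \<rho> powr ((2 * real m + real CARD('n) - 2) / 2)
        / (1 + \<rho> powr ((2 * real m + real CARD('n) - 2) / 2)))
     * (d_coeff CARD('n) m + (\<Sum>j=1..k-1. zonal m (xi_dir p q k 1) (xi_dir p q k (j + 1))))"

definition threshold_relation :: "'n::finite \<Rightarrow> 'n \<Rightarrow> nat \<Rightarrow> real \<Rightarrow> bool" where
  "threshold_relation p q k \<rho> \<longleftrightarrow>
     summable (relation_term p q k \<rho>) \<and>
     - C_const k CARD('n) / (real CARD('n) - 2) + (\<Sum>m. relation_term p q k \<rho> m) = 0"

end

theory Submission
  imports Defs
begin

text \<open>
  Write \<open>n = N - 2\<close> and \<open>\<sigma> = 2 m + n\<close>.  Expanding in zonal harmonics turns \<open>\<Lambda>\<^sub>1\<close> into a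
  series of one-variable functions with nonnegative weights:
  \<open>\<Lambda>\<^sub>1(r) = c r\<^sup>-\<^sup>n (\<Sum>m. S\<^sub>m (r\<^sup>\<sigma> + (\<rho>/r)\<^sup>\<sigma> - 2 \<rho>\<^sup>\<sigma>) / (1 - \<rho>\<^sup>\<sigma>) - C)\<close>,
  where \<open>c > 0\<close>, \<open>C\<close> is the constant \<open>C_const k N\<close> and \<open>S\<^sub>m\<close> is the sum of the values at the
  angles \<open>2 \<pi> j / k\<close>, \<open>j < k\<close>, of the Gegenbauer polynomial of degree \<open>m\<close> (\<open>Lambda1_eq\<close>).  The weight
  \<open>S\<^sub>m\<close> is nonnegative because that polynomial is a combination of cosines with nonnegative
  coefficients, and sums of cosines over the \<open>k\<close>-th roots of unity are \<open>0\<close> or \<open>k\<close>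
  (\<open>polygon_coeff_nonneg\<close>).  By the inequality of arithmetic and geometric means every term of
  the series is least at \<open>r = \<surd>\<rho>\<close>, so the sign of \<open>min \<Lambda>\<^sub>1\<close> is the sign of \<open>g(\<surd>\<rho>) - C\<close> with
  \<open>g(t) = \<Sum>m. S\<^sub>m 2 t\<^sup>\<sigma> / (1 + t\<^sup>\<sigma>)\<close> (\<open>polygon_sum_ge_polygon_min\<close>, \<open>threshold_at_root\<close>).
  The function \<open>g\<close> increases from \<open>0\<close> to \<open>\<infinity>\<close> on \<open>(0,1)\<close>, hence there is one threshold, and
  the relation in the theorem is \<open>g(\<surd>\<rho>) = C\<close> divided by \<open>n\<close> (\<open>threshold_relation_iff\<close>).  The two
  estimates on the threshold come from \<open>g(t) < 2 k (t / (1 - t\<^sup>2))\<^sup>n\<close> (\<open>polygon_min_upper\<close>): the lower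
  bound solves the resulting quadratic inequality, and the limit follows since \<open>C / k\<close>
  dominates a multiple of the harmonic numbers (\<open>eventually_C_const_large\<close>).

  Most of the work is to identify the Green function, which is characterised only by its
  boundary values and its distributional Laplacian.  Existence uses the method of images: the
  geometric series in \<open>\<rho>\<^sup>\<sigma>\<close> that expands \<open>1 / (1 - \<rho>\<^sup>\<sigma>)\<close> shows that the regular part is a signed sum of
  Newtonian potentials of charges outside the annulus, so it is enough to know that
  the Laplacian of \<open>|x - y|\<^sup>-\<^sup>n\<close> is a multiple of the Dirac mass at \<open>y\<close>
  (\<open>riesz_laplacian\<close>); the boundary condition is a telescoping of images.  Uniqueness mollifies
  the difference of two candidates with a smooth bump and applies the maximum principle to the
  mollification, which only needs second differences (\<open>green_le\<close>).
\<close>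


section \<open>Smooth and radial functions\<close>

lemma partial_deriv_eq:
  assumes "(f has_derivative f') (at x)"
  shows "partial_deriv i f x = f' (axis i 1)"
  using frechet_derivative_at[OF assms] by (simp add: partial_deriv_def)

lemma Ck_Suc_D: "Ck (Suc m) f \<Longrightarrow> Ck m f"
proof (induction m arbitrary: f)
  case 0
  then show ?case
    by (auto intro!: differentiable_imp_continuous_on simp: differentiable_on_def)
next
  case (Suc m)
  then show ?case
    by (metis Ck.simps(2))
qed

lemma Ck_const: "Ck m (\<lambda>x::real^'n::finite. c)"
proof (induction m arbitrary: c)
  case (Suc m)
  have "partial_deriv i (\<lambda>x::real^'n. c) = (\<lambda>x. 0)" for i
    by (rule ext, subst partial_deriv_eq[OF has_derivative_const]) simp
  with Suc show ?case by simp
qed simp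

lemma partial_deriv_add:
  assumes "f differentiable (at x)" "g differentiable (at x)"
  shows "partial_deriv i (\<lambda>x. f x + g x) x = partial_deriv i f x + partial_deriv i g x"
proof -
  obtain f' g' where fg: "(f has_derivative f') (at x)" "(g has_derivative g') (at x)"
    using assms by (auto simp: differentiable_def)
  show ?thesis
    by (simp add: partial_deriv_eq[OF has_derivative_add[OF fg]] partial_deriv_eq[OF fg(1)]
        partial_deriv_eq[OF fg(2)])
qed

lemma partial_deriv_mult:
  assumes "f differentiable (at x)" "g differentiable (at x)"
  shows "partial_deriv i (\<lambda>x. f x * g x) x = f x * partial_deriv i g x + partial_deriv i f x * g x"
proof -
  obtain f' g' where fg: "(f has_derivative f') (at x)" "(g has_derivative g') (at x)"
    using assms by (auto simp: differentiable_def)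
  show ?thesis
    by (simp add: partial_deriv_eq[OF has_derivative_mult[OF fg]] partial_deriv_eq[OF fg(1)]
        partial_deriv_eq[OF fg(2)])
qed

lemma Ck_add: "Ck m f \<Longrightarrow> Ck m g \<Longrightarrow> Ck m (\<lambda>x. f x + g x)"
proof (induction m arbitrary: f g)
  case 0
  then show ?case by (auto intro: continuous_on_add)
next
  case (Suc m)
  have "partial_deriv i (\<lambda>x. f x + g x) = (\<lambda>x. partial_deriv i f x + partial_deriv i g x)" for i
    using Suc.prems by (intro ext partial_deriv_add) auto
  with Suc show ?case by auto
qed

lemma Ck_mult: "Ck m f \<Longrightarrow> Ck m g \<Longrightarrow> Ck m (\<lambda>x. f x * g x)"
proof (induction m arbitrary: f g)
  case 0
  then show ?case by (auto intro: continuous_on_mult)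
next
  case (Suc m)
  have "partial_deriv i (\<lambda>x. f x * g x)
      = (\<lambda>x. f x * partial_deriv i g x + partial_deriv i f x * g x)" for i
    using Suc.prems by (intro ext partial_deriv_mult) auto
  moreover have "Ck m f" "Ck m g"
    using Suc.prems Ck_Suc_D by blast+
  ultimately show ?case using Suc by (auto intro!: Ck_add)
qed

lemma Ck_coord: "Ck m (\<lambda>x::real^'n::finite. a * (x $ i - c $ i))"
proof (cases m)
  case 0
  then show ?thesis by (auto intro!: continuous_intros)
next
  case (Suc l)
  have d: "((\<lambda>x::real^'n. a * (x $ i - c $ i)) has_derivative (\<lambda>h. a * h $ i)) (at x)" for x
    by (auto intro!: derivative_eq_intros bounded_linear.has_derivative[OF bounded_linear_vec_nth])
  have "partial_deriv j (\<lambda>x::real^'n. a * (x $ i - c $ i)) = (\<lambda>x. a * axis j 1 $ i)" for j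
    by (rule ext) (rule partial_deriv_eq[OF d])
  with Suc d show ?thesis by (auto simp: Ck_const differentiable_def)
qed

lemma radial_has_derivative:
  fixes c x :: "real^'n::finite"
  assumes "(F has_real_derivative D) (at ((x - c) \<bullet> (x - c)))"
  shows "((\<lambda>x. F ((x - c) \<bullet> (x - c))) has_derivative (\<lambda>h. D * (2 * ((x - c) \<bullet> h)))) (at x)"
proof -
  have "((\<lambda>x. (x - c) \<bullet> (x - c)) has_derivative (\<lambda>h. 2 * ((x - c) \<bullet> h))) (at x)"
    by (auto intro!: derivative_eq_intros simp: inner_commute)
  from has_derivative_compose[OF this assms[unfolded has_field_derivative_def]]
  show ?thesis by simp
qed

lemma partial_deriv_radial:
  fixes c x :: "real^'n::finite"
  assumes "(F has_real_derivative D) (at ((x - c) \<bullet> (x - c)))"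
  shows "partial_deriv i (\<lambda>x. F ((x - c) \<bullet> (x - c))) x = 2 * (x $ i - c $ i) * D"
  by (simp add: partial_deriv_eq[OF radial_has_derivative[OF assms]] inner_axis)

text \<open>
  Differentiating once replaces \<open>F n\<close> by \<open>F (Suc n)\<close> times a coordinate, so a whole chain of
  derivatives has to be carried through the induction.  Only \<open>s \<ge> 0\<close> is assumed, since the
  regularised Newtonian kernel is differentiable there but not on the whole line.
\<close>
lemma Ck_radial:
  fixes c :: "real^'n::finite"
  assumes "\<And>n s. s \<ge> 0 \<Longrightarrow> (F n has_real_derivative F (Suc n) s) (at s)"
  shows "Ck m (\<lambda>x. F n ((x - c) \<bullet> (x - c)))"
proof (induction m arbitrary: n)
  case 0
  have "(\<lambda>x. F n ((x - c) \<bullet> (x - c))) differentiable (at x)" for x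
    using radial_has_derivative[OF assms[OF inner_ge_zero]] by (auto simp: differentiable_def)
  then show ?case
    by (auto intro!: differentiable_imp_continuous_on simp: differentiable_on_def)
next
  case (Suc m)
  have "partial_deriv i (\<lambda>x. F n ((x - c) \<bullet> (x - c)))
      = (\<lambda>x. 2 * (x $ i - c $ i) * F (Suc n) ((x - c) \<bullet> (x - c)))" for i
    by (intro ext partial_deriv_radial assms) simp
  moreover have "Ck m (\<lambda>x. 2 * (x $ i - c $ i) * F (Suc n) ((x - c) \<bullet> (x - c)))" for i
    by (intro Ck_mult Ck_coord Suc)
  moreover have "(\<lambda>x. F n ((x - c) \<bullet> (x - c))) differentiable (at x)" for x
    using radial_has_derivative[OF assms[OF inner_ge_zero]] by (auto simp: differentiable_def)
  ultimately show ?case by auto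
qed

lemma laplacian_radial:
  fixes c x :: "real^'n::finite"
  assumes F1: "\<And>s. s \<ge> 0 \<Longrightarrow> (F has_real_derivative F1 s) (at s)"
    and F2: "\<And>s. s \<ge> 0 \<Longrightarrow> (F1 has_real_derivative F2 s) (at s)"
  shows "laplacian (\<lambda>x. F ((x - c) \<bullet> (x - c))) x
    = 2 * real CARD('n) * F1 ((x - c) \<bullet> (x - c))
      + 4 * ((x - c) \<bullet> (x - c)) * F2 ((x - c) \<bullet> (x - c))"
proof -
  let ?s = "(x - c) \<bullet> (x - c)"
  have 1: "partial_deriv i (\<lambda>x. F ((x - c) \<bullet> (x - c)))
      = (\<lambda>x. (2 * (x $ i - c $ i)) * F1 ((x - c) \<bullet> (x - c)))" for i
    by (intro ext partial_deriv_radial F1) simp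
  have d1: "(\<lambda>x. 2 * (x $ i - c $ i)) differentiable (at x)" for i and x :: "real^'n"
    using Ck_coord[of 1 2 i c] by simp
  have d2: "(\<lambda>x. F1 ((x - c) \<bullet> (x - c))) differentiable (at x)" for x :: "real^'n"
    using radial_has_derivative[OF F2[OF inner_ge_zero]] by (auto simp: differentiable_def)
  have "((\<lambda>x::real^'n. 2 * (x $ i - c $ i)) has_derivative (\<lambda>h. 2 * h $ i)) (at x)" for i
    by (auto intro!: derivative_eq_intros bounded_linear.has_derivative[OF bounded_linear_vec_nth])
  then have p1: "partial_deriv i (\<lambda>x. 2 * (x $ i - c $ i)) x = 2" for i
    using partial_deriv_eq by (metis (lifting) axis_nth mult.right_neutral)
  have "laplacian (\<lambda>x. F ((x - c) \<bullet> (x - c))) x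
      = (\<Sum>i\<in>UNIV. 2 * (x $ i - c $ i) * (2 * (x $ i - c $ i) * F2 ?s) + 2 * F1 ?s)"
    unfolding laplacian_def 1 partial_deriv_mult[OF d1 d2] p1
    by (simp add: partial_deriv_radial[OF F2[OF inner_ge_zero]])
  also have "\<dots> = (\<Sum>i\<in>UNIV. 4 * F2 ?s * ((x $ i - c $ i) * (x $ i - c $ i)) + 2 * F1 ?s)"
    by (intro sum.cong refl) algebra
  also have "\<dots> = 4 * F2 ?s * (\<Sum>i\<in>UNIV. (x $ i - c $ i) * (x $ i - c $ i)) + real CARD('n) * (2 * F1 ?s)"
    unfolding sum.distrib sum_distrib_left by simp
  also have "(\<Sum>i\<in>UNIV. (x $ i - c $ i) * (x $ i - c $ i)) = ?s"
    by (simp add: inner_vec_def)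
  finally show ?thesis by simp
qed

lemma partial_deriv_eq_0:
  assumes "open S" "x \<in> S" "\<And>z. z \<in> S \<Longrightarrow> f z = 0"
  shows "partial_deriv i f x = 0"
proof -
  have "(f has_derivative (\<lambda>_. 0)) (at x)"
    by (rule has_derivative_transform_within_open[OF has_derivative_const[of 0] assms(1,2)])
      (simp add: assms(3))
  then show ?thesis by (simp add: partial_deriv_eq)
qed

lemma laplacian_eq_0:
  assumes "open S" "x \<in> S" "\<And>z. z \<in> S \<Longrightarrow> f z = 0"
  shows "laplacian f x = 0"
  unfolding laplacian_def
  by (intro sum.neutral ballI partial_deriv_eq_0[OF assms(1,2)] partial_deriv_eq_0[OF assms(1)] assms(3))

lemma laplacian_continuous: "Ck 2 f \<Longrightarrow> continuous_on UNIV (laplacian f)"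
  unfolding laplacian_def by (auto simp: numeral_2_eq_2 intro!: continuous_on_sum)


section \<open>Integration by parts on Euclidean space\<close>

lemma zero_outside_ball_cball:
  fixes f :: "'a::euclidean_space \<Rightarrow> real"
  assumes "\<And>x. R < norm x \<Longrightarrow> f x = 0"
  shows "(\<lambda>x. indicator (cball 0 R) x *\<^sub>R f x) = f"
  using assms by (fastforce simp: indicator_def fun_eq_iff dist_norm)

lemma integrable_compact_support:
  fixes f :: "'a::euclidean_space \<Rightarrow> real"
  assumes "continuous_on UNIV f" "\<And>x. R < norm x \<Longrightarrow> f x = 0"
  shows "integrable lborel f"
proof -
  have "integrable lborel (\<lambda>x. indicator (cball 0 R) x *\<^sub>R f x)"
    by (intro borel_integrable_compact) (auto intro: continuous_on_subset[OF assms(1)])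
  then show ?thesis
    using zero_outside_ball_cball[of R f] assms(2) by simp
qed

lemma bounded_compact_support:
  fixes f :: "'a::euclidean_space \<Rightarrow> real"
  assumes "continuous_on UNIV f" "\<And>x. R < norm x \<Longrightarrow> f x = 0"
  obtains B where "B \<ge> 0" "\<And>x. \<bar>f x\<bar> \<le> B"
proof -
  have "compact (f ` cball 0 R)"
    by (intro compact_continuous_image) (auto intro: continuous_on_subset[OF assms(1)])
  then obtain B where B: "\<And>x. x \<in> cball 0 R \<Longrightarrow> \<bar>f x\<bar> \<le> B"
    using compact_imp_bounded[of "f ` cball 0 R"] by (fastforce simp: bounded_iff)
  have "\<bar>f x\<bar> \<le> max B 0" for x
    using B[of x] assms(2)[of x] by (cases "norm x \<le> R") (auto simp: dist_norm)
  then show ?thesis by (intro that[of "max B 0"]) auto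
qed

lemma integral_translation:
  fixes f :: "'a::euclidean_space \<Rightarrow> real"
  assumes [measurable]: "f \<in> borel_measurable borel"
  shows "(LINT x|lborel. f (c + x)) = (LINT x|lborel. f x)"
  by (subst (2) lborel_distr_plus[of c, symmetric]) (simp add: integral_distr)

lemma has_real_derivative_line:
  fixes f :: "real^'n::finite \<Rightarrow> real"
  assumes "\<And>x. f differentiable (at x)"
  shows "((\<lambda>t. f (x + t *\<^sub>R axis i 1)) has_real_derivative partial_deriv i f (x + t *\<^sub>R axis i 1)) (at t)"
proof -
  let ?e = "axis i 1 :: real^'n"
  have 1: "((\<lambda>t. x + t *\<^sub>R ?e) has_derivative (\<lambda>h. h *\<^sub>R ?e)) (at t)"
    by (auto intro!: derivative_eq_intros)
  have 2: "(f has_derivative frechet_derivative f (at (x + t *\<^sub>R ?e))) (at (x + t *\<^sub>R ?e))"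
    using assms frechet_derivative_works by blast
  interpret bounded_linear "frechet_derivative f (at (x + t *\<^sub>R ?e))"
    using 2 by (rule has_derivative_bounded_linear)
  show ?thesis
    using has_derivative_compose[OF 1 2] unfolding has_field_derivative_def
    by (rule has_derivative_eq_rhs) (simp add: fun_eq_iff partial_deriv_def scaleR)
qed

text \<open>
  A difference quotient in direction \<open>i\<close> integrates to zero by translation invariance, and the
  mean value theorem gives the bound that lets its step tend to zero.
\<close>
lemma integral_partial_deriv_eq_0:
  fixes f :: "real^'n::finite \<Rightarrow> real"
  assumes diff: "\<And>x. f differentiable (at x)"
    and cont: "continuous_on UNIV (partial_deriv i f)"
    and supp: "\<And>x. R < norm x \<Longrightarrow> f x = 0"
  shows "(LINT x|lborel. partial_deriv i f x) = 0"
proof -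
  let ?e = "axis i 1 :: real^'n"
  let ?g = "partial_deriv i f"
  have cf: "continuous_on UNIV f"
    using diff by (auto intro!: differentiable_imp_continuous_on simp: differentiable_on_def)
  have [measurable]: "f \<in> borel_measurable borel" "?g \<in> borel_measurable borel"
    using cf cont by (auto intro: borel_measurable_continuous_onI)
  have int_f: "integrable lborel f"
    by (rule integrable_compact_support[OF cf supp])
  have supp_g: "?g x = 0" if "R < norm x" for x
    by (rule partial_deriv_eq_0[of "- cball 0 R"]) (use that supp in \<open>auto simp: dist_norm\<close>)
  obtain B where B: "B \<ge> 0" "\<And>x. \<bar>?g x\<bar> \<le> B"
    using bounded_compact_support[OF cont supp_g] by metis
  define t where "t n = 1 / real (Suc n)" for n
  have t: "0 < t n" "t n \<le> 1" for n
    by (auto simp: t_def)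
  have t_lim: "t \<longlonglongrightarrow> 0"
    unfolding t_def using LIMSEQ_Suc[OF lim_1_over_n[where 'a=real]] by simp
  define Q where "Q n x = (f (x + t n *\<^sub>R ?e) - f x) / t n" for n x
  have Q_int: "(LINT x|lborel. Q n x) = 0" for n
  proof -
    have "(LINT x|lborel. f (t n *\<^sub>R ?e + x)) = (LINT x|lborel. f x)"
      by (rule integral_translation) simp
    moreover have "integrable lborel (\<lambda>x. f (t n *\<^sub>R ?e + x))"
    proof -
      have "integrable (distr lborel borel ((+) (t n *\<^sub>R ?e))) f"
        using int_f by (simp add: lborel_distr_plus)
      then show ?thesis
        by (subst (asm) integrable_distr_eq) auto
    qed
    ultimately show ?thesis
      using int_f by (simp add: Q_def add.commute[of _ "t n *\<^sub>R ?e"])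
  qed
  have "(\<lambda>n. LINT x|lborel. Q n x) \<longlonglongrightarrow> (LINT x|lborel. ?g x)"
  proof (rule integral_dominated_convergence[where w="\<lambda>x. B * indicator (cball 0 (R + 1)) x"])
    show "integrable lborel (\<lambda>x. B * indicator (cball (0::real^'n) (R + 1)) x)"
      using emeasure_lborel_cball_finite[of "0::real^'n" "R+1"] by auto
    show "AE x in lborel. (\<lambda>n. Q n x) \<longlonglongrightarrow> ?g x"
    proof (intro always_eventually allI)
      fix x
      have "((\<lambda>s. (f (x + s *\<^sub>R ?e) - f x) / s) \<longlongrightarrow> ?g x) (at 0)"
        using has_real_derivative_line[OF diff, of x i 0] by (simp add: DERIV_def)
      moreover have "filterlim t (at 0) sequentially"
        using t_lim t(1) by (auto simp: filterlim_at intro!: always_eventually less_imp_neq[THEN not_sym])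
      ultimately show "(\<lambda>n. Q n x) \<longlonglongrightarrow> ?g x"
        unfolding Q_def by (rule filterlim_compose)
    qed
    show "AE x in lborel. norm (Q n x) \<le> B * indicator (cball 0 (R + 1)) x" for n
    proof (intro always_eventually allI)
      fix x
      obtain s where s: "0 < s" "s < t n"
        "f (x + t n *\<^sub>R ?e) - f (x + 0 *\<^sub>R ?e) = (t n - 0) * ?g (x + s *\<^sub>R ?e)"
        using MVT2[OF t(1)[of n], where f="\<lambda>s. f (x + s *\<^sub>R ?e)" and f'="\<lambda>s. ?g (x + s *\<^sub>R ?e)"]
          has_real_derivative_line[OF diff] by blast
      then have Q: "Q n x = ?g (x + s *\<^sub>R ?e)"
        using t(1)[of n] by (simp add: Q_def)
      show "norm (Q n x) \<le> B * indicator (cball 0 (R + 1)) x"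
      proof (cases "norm x \<le> R + 1")
        case True
        then show ?thesis using Q B by simp
      next
        case False
        have "norm x \<le> norm (x + s *\<^sub>R ?e) + norm (s *\<^sub>R ?e)"
          by (metis add_diff_cancel_right' norm_triangle_ineq4)
        with False s t(2)[of n] have "R < norm (x + s *\<^sub>R ?e)" by simp
        then show ?thesis using Q supp_g B by simp
      qed
    qed
    show "Q n \<in> borel_measurable lborel" for n
      unfolding Q_def by measurable
  qed simp
  then show ?thesis
    using Q_int LIMSEQ_unique[of "\<lambda>n. 0::real"] by auto
qed

lemma integral_by_parts_partial_deriv:
  fixes f g :: "real^'n::finite \<Rightarrow> real"
  assumes f: "Ck 1 f" and g: "Ck 1 g" and supp: "\<And>x. R < norm x \<Longrightarrow> g x = 0"
  shows "(LINT x|lborel. f x * partial_deriv i g x) = - (LINT x|lborel. partial_deriv i f x * g x)"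
proof -
  have supp': "partial_deriv i g x = 0" if "R < norm x" for x
    by (rule partial_deriv_eq_0[of "- cball 0 R"]) (use that supp in \<open>auto simp: dist_norm\<close>)
  have c: "continuous_on UNIV f" "continuous_on UNIV g"
    "continuous_on UNIV (partial_deriv i f)" "continuous_on UNIV (partial_deriv i g)"
    using f g Ck_Suc_D[of 0] by auto
  have d: "\<And>x. f differentiable (at x)" "\<And>x. g differentiable (at x)"
    using f g by auto
  have eq: "partial_deriv i (\<lambda>x. f x * g x) = (\<lambda>x. f x * partial_deriv i g x + partial_deriv i f x * g x)"
    by (intro ext partial_deriv_mult d)
  have "(LINT x|lborel. f x * partial_deriv i g x + partial_deriv i f x * g x) = 0"
    unfolding eq[symmetric, THEN fun_cong]
    by (rule integral_partial_deriv_eq_0[where R=R])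
       (use supp c d in \<open>auto simp: eq intro!: continuous_intros\<close>)
  moreover have "integrable lborel (\<lambda>x. f x * partial_deriv i g x)"
    by (rule integrable_compact_support[where R=R]) (use supp' c in \<open>auto intro!: continuous_intros\<close>)
  moreover have "integrable lborel (\<lambda>x. partial_deriv i f x * g x)"
    by (rule integrable_compact_support[where R=R]) (use supp c in \<open>auto intro!: continuous_intros\<close>)
  ultimately show ?thesis by simp
qed

lemma green_second_identity:
  fixes u \<phi> :: "real^'n::finite \<Rightarrow> real"
  assumes u: "Ck 2 u" and \<phi>: "Ck 2 \<phi>" and supp: "\<And>x. R < norm x \<Longrightarrow> \<phi> x = 0"
  shows "(LINT x|lborel. u x * laplacian \<phi> x) = (LINT x|lborel. laplacian u x * \<phi> x)"
proof -
  have supp1: "partial_deriv i \<phi> x = 0" if "R < norm x" for i x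
    by (rule partial_deriv_eq_0[of "- cball 0 R"]) (use that supp in \<open>auto simp: dist_norm\<close>)
  have supp2: "partial_deriv i (partial_deriv i \<phi>) x = 0" if "R < norm x" for i x
    by (rule partial_deriv_eq_0[of "- cball 0 R"]) (use that supp1 in \<open>auto simp: dist_norm\<close>)
  have u1: "Ck 1 u" "Ck 1 (partial_deriv i u)" and p1: "Ck 1 \<phi>" "Ck 1 (partial_deriv i \<phi>)" for i
    using u \<phi> Ck_Suc_D[of 1] by (auto simp: numeral_2_eq_2)
  have u0: "continuous_on UNIV u" "continuous_on UNIV (partial_deriv i (partial_deriv i u))"
    and p0: "continuous_on UNIV \<phi>" "continuous_on UNIV (partial_deriv i (partial_deriv i \<phi>))" for i
    using u1 p1 Ck_Suc_D[of 0 u] Ck_Suc_D[of 0 \<phi>] by auto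
  have "(LINT x|lborel. u x * laplacian \<phi> x)
      = (LINT x|lborel. (\<Sum>i\<in>UNIV. u x * partial_deriv i (partial_deriv i \<phi>) x))"
    by (simp add: laplacian_def sum_distrib_left)
  also have "\<dots> = (\<Sum>i\<in>UNIV. (LINT x|lborel. u x * partial_deriv i (partial_deriv i \<phi>) x))"
    by (intro Bochner_Integration.integral_sum integrable_compact_support[where R=R])
      (use u0 p0 supp2 in \<open>auto intro!: continuous_intros\<close>)
  also have "\<dots> = (\<Sum>i\<in>UNIV. (LINT x|lborel. partial_deriv i (partial_deriv i u) x * \<phi> x))"
  proof (rule sum.cong)
    fix i
    show "(LINT x|lborel. u x * partial_deriv i (partial_deriv i \<phi>) x)
      = (LINT x|lborel. partial_deriv i (partial_deriv i u) x * \<phi> x)"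
      using integral_by_parts_partial_deriv[OF u1(1) p1(2) supp1, where i=i]
        integral_by_parts_partial_deriv[OF u1(2) p1(1) supp, where i=i] by simp
  qed simp
  also have "\<dots> = (LINT x|lborel. (\<Sum>i\<in>UNIV. partial_deriv i (partial_deriv i u) x * \<phi> x))"
    by (intro Bochner_Integration.integral_sum[symmetric] integrable_compact_support[where R=R])
      (use u0 p0 supp in \<open>auto intro!: continuous_intros\<close>)
  finally show ?thesis
    by (simp add: laplacian_def sum_distrib_right)
qed


section \<open>Radial integrals and integrability of the Newtonian kernel\<close>

text \<open>
  Tonelli's theorem replaces polar coordinates: a radial function is written as
  \<open>\<integral> f s ds\<close> over \<open>s \<ge> |x|\<close>, and the points \<open>x\<close> that see a given \<open>s\<close> fill a ball of radius \<open>s\<close>.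
\<close>
lemma nn_integral_radial:
  fixes f :: "real \<Rightarrow> ennreal"
  assumes [measurable]: "f \<in> borel_measurable borel"
  shows "(\<integral>\<^sup>+x. (\<integral>\<^sup>+s. f s * indicator {norm x..} s \<partial>lborel) \<partial>(lborel :: 'a::euclidean_space measure))
    = (\<integral>\<^sup>+s. f s * ennreal (unit_ball_vol (DIM('a)) * s ^ DIM('a)) * indicator {0..} s \<partial>lborel)"
proof -
  have m: "(\<lambda>(x::'a, s). f s * indicator {z. norm (fst z) \<le> snd z} (x, s)) \<in> borel_measurable (lborel \<Otimes>\<^sub>M lborel)"
    by measurable
  have "(\<integral>\<^sup>+x. (\<integral>\<^sup>+s. f s * indicator {norm x..} s \<partial>lborel) \<partial>(lborel :: 'a measure))
    = (\<integral>\<^sup>+x. (\<integral>\<^sup>+s. f s * indicator {z. norm (fst z) \<le> snd z} (x, s) \<partial>lborel) \<partial>(lborel :: 'a measure))"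
    by (intro nn_integral_cong) (auto simp: indicator_def)
  also have "\<dots> = (\<integral>\<^sup>+s. (\<integral>\<^sup>+x. f s * indicator {z. norm (fst z) \<le> snd z} (x, s) \<partial>(lborel :: 'a measure)) \<partial>lborel)"
    using lborel_pair.Fubini'[OF m] by simp
  also have "\<dots> = (\<integral>\<^sup>+s. (\<integral>\<^sup>+x. f s * indicator (cball 0 s) x \<partial>(lborel :: 'a measure)) \<partial>lborel)"
    by (intro nn_integral_cong) (auto simp: indicator_def)
  also have "\<dots> = (\<integral>\<^sup>+s. f s * emeasure lborel (cball (0::'a) s) \<partial>lborel)"
    by (subst nn_integral_cmult_indicator) auto
  also have "\<dots> = (\<integral>\<^sup>+s. f s * ennreal (unit_ball_vol (DIM('a)) * s ^ DIM('a)) * indicator {0..} s \<partial>lborel)"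
    by (intro nn_integral_cong) (auto simp: indicator_def emeasure_cball not_le)
  finally show ?thesis .
qed

text \<open>
  This is the total mass of \<open>\<Delta>\<close> of the regularised kernel up to a factor.  After
  \<open>nn_integral_radial\<close> the integrand in \<open>s\<close> is the derivative of \<open>s\<^sup>N\<^sup>+\<^sup>2 (1 + s\<^sup>2) powr (- \<mu>)\<close>, which tends to \<open>1\<close>.
\<close>
lemma nn_integral_bubble:
  fixes \<mu> :: real
  assumes \<mu>: "\<mu> = (real DIM('a::euclidean_space) + 2) / 2"
  shows "(\<integral>\<^sup>+x. ennreal ((1 + x \<bullet> x) powr (-\<mu>)) \<partial>(lborel :: 'a measure)) = ennreal (unit_ball_vol (DIM('a)))"
proof -
  let ?N = "DIM('a)" and ?V = "unit_ball_vol (DIM('a))"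
  have \<mu>0: "\<mu> > 0" using \<mu> by simp
  have V0: "?V \<ge> 0" by (rule unit_ball_vol_nonneg) simp
  define f where "f s = 2 * \<mu> * s * (1 + s\<^sup>2) powr (-\<mu> - 1)" for s :: real
  have [measurable]: "f \<in> borel_measurable borel"
    unfolding f_def by measurable
  have pos: "1 + s\<^sup>2 > 0" for s :: real
    by (simp add: add_pos_nonneg)
  have at_top_s: "filterlim (\<lambda>s::real. 1 + s\<^sup>2) at_top at_top"
    by real_asymp
  have tail: "(\<integral>\<^sup>+s. ennreal (f s) * indicator {r..} s \<partial>lborel) = ennreal ((1 + r\<^sup>2) powr (-\<mu>))" if r: "r \<ge> 0" for r
  proof -
    have "(\<integral>\<^sup>+s. ennreal (f s) * indicator {r..} s \<partial>lborel) = 0 - (- ((1 + r\<^sup>2) powr (-\<mu>)))"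
    proof (rule nn_integral_FTC_atLeast)
      show "((\<lambda>s. - ((1 + s\<^sup>2) powr - \<mu>)) has_real_derivative f s) (at s)" if "r \<le> s" for s
        using pos[of s] by (auto intro!: derivative_eq_intros simp: f_def)
      show "f s \<ge> 0" if "r \<le> s" for s
        using r that \<mu>0 by (simp add: f_def)
      show "((\<lambda>s. - ((1 + s\<^sup>2) powr - \<mu>)) \<longlongrightarrow> 0) at_top"
        using tendsto_minus[OF tendsto_neg_powr[OF _ at_top_s, of "-\<mu>"]] \<mu>0 by simp
    qed simp
    then show ?thesis by simp
  qed
  have "(\<integral>\<^sup>+x. ennreal ((1 + x \<bullet> x) powr (-\<mu>)) \<partial>(lborel :: 'a measure))
     = (\<integral>\<^sup>+x. (\<integral>\<^sup>+s. ennreal (f s) * indicator {norm x..} s \<partial>lborel) \<partial>(lborel :: 'a measure))"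
    by (intro nn_integral_cong) (simp add: tail power2_norm_eq_inner)
  also have "\<dots> = (\<integral>\<^sup>+s. ennreal (f s) * ennreal (?V * s ^ ?N) * indicator {0..} s \<partial>lborel)"
    by (rule nn_integral_radial) measurable
  also have "\<dots> = (\<integral>\<^sup>+s. ennreal (f s * (?V * s ^ ?N)) * indicator {0..} s \<partial>lborel)"
    using \<mu>0 V0 by (intro nn_integral_cong) (auto simp: indicator_def ennreal_mult f_def)
  also have "\<dots> = ?V - ?V * 0 ^ (?N + 2) * (1 + 0\<^sup>2) powr (-\<mu>)"
  proof (rule nn_integral_FTC_atLeast)
    fix s :: real assume s: "0 \<le> s"
    have D: "((\<lambda>s. ?V * s ^ (?N + 2) * (1 + s\<^sup>2) powr (-\<mu>)) has_real_derivative
       ?V * (real (?N + 2) * s ^ (?N + 1)) * (1 + s\<^sup>2) powr (-\<mu>)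
       + ?V * s ^ (?N + 2) * ((-\<mu>) * (1 + s\<^sup>2) powr (-\<mu> - 1) * (2 * s))) (at s)"
      using pos[of s] by (auto intro!: derivative_eq_intros simp del: power_Suc)
    have e: "(1 + s\<^sup>2) powr (-\<mu>) = (1 + s\<^sup>2) * (1 + s\<^sup>2) powr (-\<mu> - 1)"
      using pos[of s] powr_add[of "1 + s\<^sup>2" 1 "-\<mu> - 1"] by simp
    have m: "real (?N + 2) = 2 * \<mu>" using \<mu> by simp
    have "?V * (real (?N + 2) * s ^ (?N + 1)) * (1 + s\<^sup>2) powr (-\<mu>)
       + ?V * s ^ (?N + 2) * ((-\<mu>) * (1 + s\<^sup>2) powr (-\<mu> - 1) * (2 * s)) = f s * (?V * s ^ ?N)"
      unfolding e m f_def by (simp add: power2_eq_square algebra_simps)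
    with D show "((\<lambda>s. ?V * s ^ (?N + 2) * (1 + s\<^sup>2) powr (-\<mu>)) has_real_derivative f s * (?V * s ^ ?N)) (at s)"
      by simp
    show "0 \<le> f s * (?V * s ^ ?N)"
      using s V0 \<mu>0 by (simp add: f_def)
  next
    have "((\<lambda>s::real. s\<^sup>2 / (1 + s\<^sup>2)) \<longlongrightarrow> 1) at_top" by real_asymp
    then have "((\<lambda>s::real. ?V * (s\<^sup>2 / (1 + s\<^sup>2)) powr \<mu>) \<longlongrightarrow> ?V * 1 powr \<mu>) at_top"
      by (intro tendsto_intros) auto
    moreover have "\<forall>\<^sub>F s in at_top. ?V * (s\<^sup>2 / (1 + s\<^sup>2)) powr \<mu> = ?V * s ^ (?N + 2) * (1 + s\<^sup>2) powr (-\<mu>)"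
      using eventually_gt_at_top[of "0::real"]
    proof eventually_elim
      case (elim s)
      have "(s\<^sup>2) powr \<mu> = s powr (2 * \<mu>)"
        using elim by (simp add: powr_powr flip: powr_numeral)
      also have "2 * \<mu> = real (?N + 2)" using \<mu> by simp
      finally have "(s\<^sup>2) powr \<mu> = s ^ (?N + 2)"
        using elim by (simp only: powr_realpow)
      moreover have "(s\<^sup>2 / (1 + s\<^sup>2)) powr \<mu> = (s\<^sup>2) powr \<mu> / (1 + s\<^sup>2) powr \<mu>"
        by (rule powr_divide)
      ultimately show ?case
        by (simp add: powr_minus_divide)
    qed
    ultimately show "((\<lambda>s. ?V * s ^ (?N + 2) * (1 + s\<^sup>2) powr (-\<mu>)) \<longlongrightarrow> ?V) at_top"
      using Lim_transform_eventually by fastforce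
  qed measurable
  finally show ?thesis by simp
qed

lemma pred_cball [measurable]: "Measurable.pred borel (\<lambda>x::'a::euclidean_space. x \<in> cball y R)"
  by (simp add: pred_def)

text \<open>
  Near the origin \<open>1 / r\<^sup>n - 1 / R\<^sup>n\<close> is the integral of \<open>n / s\<^sup>n\<^sup>+\<^sup>1\<close> over \<open>[r, R]\<close>; against the volume
  \<open>s\<^sup>n\<^sup>+\<^sup>2\<close> of a ball this leaves the bounded integrand \<open>n s\<close>.
\<close>
lemma integrable_riesz_kernel_0:
  assumes "DIM('a::euclidean_space) = n + 2" "n > 0" "R > 0"
  shows "integrable lborel (\<lambda>x::'a. indicator (cball 0 R) x / norm x ^ n)"
proof (rule integrableI_bounded)
  let ?V = "unit_ball_vol (DIM('a))"
  have V0: "?V \<ge> 0" by (rule unit_ball_vol_nonneg) simp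
  define f where "f s = (if 0 < s \<and> s \<le> R then real n / s ^ (n + 1) else 0)" for s :: real
  have [measurable]: "f \<in> borel_measurable borel"
    unfolding f_def by measurable
  have tail: "ennreal (1 / norm x ^ n) \<le> ennreal (1 / R ^ n) + (\<integral>\<^sup>+s. ennreal (f s) * indicator {norm x..} s \<partial>lborel)"
    if "x \<noteq> 0" "norm x \<le> R" for x :: 'a
  proof -
    have x: "0 < norm x" using that by simp
    have "(\<integral>\<^sup>+s. ennreal (f s) * indicator {norm x..} s \<partial>lborel)
      = (\<integral>\<^sup>+s. ennreal (real n / s ^ (n + 1)) * indicator {norm x..R} s \<partial>lborel)"
      using less_le_trans[OF x] by (intro nn_integral_cong) (auto simp: f_def indicator_def)
    also have "\<dots> = ennreal (- (1 / R ^ n) - (- (1 / norm x ^ n)))"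
    proof (rule nn_integral_FTC_Icc)
      fix s assume "s \<in> {norm x..R}"
      then have s: "s > 0" using less_le_trans[OF x] by simp
      have "((\<lambda>s. - (1 / s ^ n)) has_real_derivative (real n * s ^ (n - 1)) / (s ^ n * s ^ n)) (at s)"
        using s by (auto intro!: derivative_eq_intros)
      moreover have "(real n * s ^ (n - 1)) / (s ^ n * s ^ n) = real n / s ^ (n + 1)"
        using s assms(2) by (cases n) (auto simp: field_simps)
      ultimately show "((\<lambda>s. - (1 / s ^ n)) has_real_derivative real n / s ^ (n + 1)) (at s)"
        by simp
      show "0 \<le> real n / s ^ (n + 1)" using s by simp
    qed (use that in auto)
    finally show ?thesis
      using assms(3) by (simp add: ennreal_plus[symmetric] frac_le power_mono that x del: ennreal_plus)
  qed
  have meas: "(\<lambda>x::'a. \<integral>\<^sup>+s. ennreal (f s) * indicator {norm x..} s \<partial>lborel) \<in> borel_measurable borel"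
  proof -
    have "(\<lambda>x::'a. \<integral>\<^sup>+s. ennreal (f s) * indicator {norm x..} s \<partial>lborel)
      = (\<lambda>x. \<integral>\<^sup>+s. ennreal (f s) * indicator {z. norm (fst z) \<le> snd z} (x, s) \<partial>lborel)"
      by (intro ext nn_integral_cong) (auto simp: indicator_def)
    also have "\<dots> \<in> borel_measurable borel" by measurable
    finally show ?thesis .
  qed
  have meas': "(\<lambda>x::'a. ennreal (1 / R ^ n) * indicator (cball 0 R) x) \<in> borel_measurable borel"
    by measurable
  have "(\<integral>\<^sup>+x. ennreal (norm (indicator (cball 0 R) x / norm x ^ n)) \<partial>(lborel :: 'a measure))
    \<le> (\<integral>\<^sup>+x. ennreal (1 / R ^ n) * indicator (cball 0 R) x + (\<integral>\<^sup>+s. ennreal (f s) * indicator {norm x..} s \<partial>lborel) \<partial>(lborel :: 'a measure))"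
  proof (rule nn_integral_mono)
    fix x :: 'a
    show "ennreal (norm (indicator (cball 0 R) x / norm x ^ n))
      \<le> ennreal (1 / R ^ n) * indicator (cball 0 R) x + (\<integral>\<^sup>+s. ennreal (f s) * indicator {norm x..} s \<partial>lborel)"
      using tail[of x] assms(2) by (cases "x = 0") (auto simp: indicator_def zero_power)
  qed
  also have "\<dots> = ennreal (1 / R ^ n) * emeasure lborel (cball (0::'a) R)
      + (\<integral>\<^sup>+x. (\<integral>\<^sup>+s. ennreal (f s) * indicator {norm x..} s \<partial>lborel) \<partial>(lborel :: 'a measure))"
    using meas meas' by (subst nn_integral_add) (simp_all add: nn_integral_cmult_indicator)
  also have "(\<integral>\<^sup>+x. (\<integral>\<^sup>+s. ennreal (f s) * indicator {norm x..} s \<partial>lborel) \<partial>(lborel :: 'a measure))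
     = (\<integral>\<^sup>+s. ennreal (f s) * ennreal (?V * s ^ DIM('a)) * indicator {0..} s \<partial>lborel)"
    by (rule nn_integral_radial) measurable
  also have "\<dots> \<le> (\<integral>\<^sup>+s. ennreal (real n * ?V * R) * indicator {0..R} s \<partial>lborel)"
  proof (rule nn_integral_mono)
    fix s :: real
    show "ennreal (f s) * ennreal (?V * s ^ DIM('a)) * indicator {0..} s \<le> ennreal (real n * ?V * R) * indicator {0..R} s"
    proof (cases "0 < s \<and> s \<le> R")
      case True
      then have "f s * (?V * s ^ DIM('a)) = real n * ?V * s"
        by (simp add: f_def assms(1) field_simps)
      moreover have "real n * ?V * s \<le> real n * ?V * R"
        using True V0 by (intro mult_left_mono) auto
      ultimately have "ennreal (f s * (?V * s ^ DIM('a))) \<le> ennreal (real n * ?V * R)"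
        by (rule ennreal_leI[OF ord_eq_le_trans])
      moreover have "ennreal (f s) * ennreal (?V * s ^ DIM('a)) = ennreal (f s * (?V * s ^ DIM('a)))"
        using True V0 by (intro ennreal_mult[symmetric]) (auto simp: f_def)
      ultimately show ?thesis
        using True by simp
    next
      case False
      then show ?thesis by (auto simp: f_def)
    qed
  qed
  also have "\<dots> = ennreal (real n * ?V * R) * ennreal R"
    using assms(3) by (simp add: nn_integral_cmult_indicator)
  finally show "(\<integral>\<^sup>+x. ennreal (norm (indicator (cball 0 R) x / norm x ^ n)) \<partial>(lborel :: 'a measure)) < \<infinity>"
    using assms(3) emeasure_lborel_cball_finite[of "0::'a" R]
    by (auto simp: less_top[symmetric] ennreal_mult_eq_top_iff top_unique)
qed measurable

lemma integrable_riesz_kernel: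
  assumes "DIM('a::euclidean_space) = n + 2" "n > 0" "R > 0"
  shows "integrable lborel (\<lambda>x::'a. indicator (cball y R) x / norm (x - y) ^ n)"
proof -
  have m: "(\<lambda>x::'a. indicator (cball 0 R) x / norm x ^ n) \<in> borel_measurable borel"
    by measurable
  have "integrable (distr lborel borel ((+) (- y))) (\<lambda>x::'a. indicator (cball 0 R) x / norm x ^ n)"
    using integrable_riesz_kernel_0[OF assms] by (simp only: lborel_distr_plus)
  then have "integrable lborel (\<lambda>x::'a. indicator (cball 0 R) (- y + x) / norm (- y + x) ^ n)"
    by (subst (asm) integrable_distr_eq[OF _ m]) auto
  also have "(\<lambda>x::'a. indicator (cball 0 R) (- y + x) / norm (- y + x) ^ n)
    = (\<lambda>x. indicator (cball y R) x / norm (x - y) ^ n)"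
    by (auto simp: fun_eq_iff indicator_def dist_norm norm_minus_commute)
  finally show ?thesis .
qed

lemma integrable_riesz_kernel_mult:
  fixes g :: "'a::euclidean_space \<Rightarrow> real"
  assumes N: "DIM('a) = n + 2" "n > 0"
    and g: "continuous_on UNIV g" "\<And>x. R < norm x \<Longrightarrow> g x = 0"
  shows "integrable lborel (\<lambda>x. 1 / norm (x - y) ^ n * g x)"
proof -
  obtain B where B: "B \<ge> 0" "\<And>x. \<bar>g x\<bar> \<le> B"
    using bounded_compact_support[OF g] by metis
  have [measurable]: "g \<in> borel_measurable borel"
    using g by (auto intro: borel_measurable_continuous_onI)
  define R' where "R' = \<bar>R\<bar> + norm y + 1"
  have "integrable lborel (\<lambda>x. B * (indicator (cball y R') x / norm (x - y) ^ n))"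
    by (intro integrable_mult_right integrable_riesz_kernel[OF N]) (auto simp: R'_def add_nonneg_pos)
  then show ?thesis
  proof (rule Bochner_Integration.integrable_bound)
    show "AE x in lborel. norm (1 / norm (x - y) ^ n * g x) \<le> norm (B * (indicator (cball y R') x / norm (x - y) ^ n))"
    proof (intro always_eventually allI)
      fix x
      show "norm (1 / norm (x - y) ^ n * g x) \<le> norm (B * (indicator (cball y R') x / norm (x - y) ^ n))"
      proof (cases "R < norm x")
        case True
        then show ?thesis by (simp add: g)
      next
        case False
        then have "x \<in> cball y R'"
          using norm_triangle_ineq4[of x y] by (auto simp: R'_def dist_norm norm_minus_commute)
        then show ?thesis using B by (auto simp: divide_right_mono)
      qed
    qed
  qed measurable
qed


section \<open>The Laplacian of the Newtonian kernel\<close>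

lemma integral_affine:
  fixes f :: "'a::euclidean_space \<Rightarrow> real"
  assumes [measurable]: "f \<in> borel_measurable borel" and c: "c > 0"
  shows "(LINT x|lborel. f x) = c ^ DIM('a) * (LINT x|lborel. f (t + c *\<^sub>R x))"
proof -
  have "(LINT x|lborel. f x)
     = (LINT x|density (distr lborel borel (\<lambda>x. t + c *\<^sub>R x)) (\<lambda>_. \<bar>c\<bar> ^ DIM('a)). f x)"
    using lborel_affine[of c t] c by simp
  also have "\<dots> = c ^ DIM('a) * (LINT x|lborel. f (t + c *\<^sub>R x))"
    using c by (simp add: integral_density integral_distr ennreal_power)
  finally show ?thesis .
qed

context
  fixes y :: "real^'n::finite" and \<phi> :: "real^'n \<Rightarrow> real" and R :: real
  assumes N3: "CARD('n) \<ge> 3"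
    and \<phi>: "Ck 2 \<phi>" and supp: "\<And>x. R < norm x \<Longrightarrow> \<phi> x = 0"
begin

text \<open>
  The kernel \<open>|x - y|\<^sup>-\<^sup>n\<close> is replaced by \<open>(|x - y|\<^sup>2 + e\<^sup>2) powr (- n / 2)\<close>.  Its exponent makes the two
  terms of the radial Laplacian combine to a multiple of \<open>e\<^sup>2 (|x - y|\<^sup>2 + e\<^sup>2) powr (- n / 2 - 2)\<close>,
  an approximate identity, which the substitution \<open>x = y + e z\<close> brings to a fixed scale.
\<close>
lemma regularised_riesz_laplacian:
  fixes e :: real
  defines "lam \<equiv> (real CARD('n) - 2) / 2"
  assumes e: "e > 0"
  shows "(LINT x|lborel. ((x - y) \<bullet> (x - y) + e\<^sup>2) powr (-lam) * laplacian \<phi> x)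
    = - (real CARD('n) - 2) * real CARD('n) *
      (LINT z|lborel. (1 + z \<bullet> z) powr (-lam - 2) * \<phi> (y + e *\<^sub>R z))"
proof -
  define F where "F m s = (-1) ^ m * pochhammer lam m * (s + e\<^sup>2) powr (-lam - real m)" for m and s :: real
  have F: "(F m has_real_derivative F (Suc m) s) (at s)" if "s \<ge> 0" for m s
  proof -
    have "s + e\<^sup>2 > 0" using that e by (simp add: add_nonneg_pos)
    then have "((\<lambda>s. (s + e\<^sup>2) powr (-lam - real m)) has_real_derivative
        (-lam - real m) * (s + e\<^sup>2) powr (-lam - real m - 1)) (at s)"
      by (auto intro!: derivative_eq_intros)
    from DERIV_cmult[OF this, of "(-1) ^ m * pochhammer lam m"] show ?thesis
      unfolding F_def by (rule DERIV_cong) (simp add: pochhammer_Suc algebra_simps)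
  qed
  define u where "u x = F 0 ((x - y) \<bullet> (x - y))" for x
  have u: "Ck 2 u" unfolding u_def by (rule Ck_radial[where F=F]) (rule F)
  have lap: "laplacian u x = - (2 * lam * real CARD('n)) * (e\<^sup>2 * ((x - y) \<bullet> (x - y) + e\<^sup>2) powr (-lam - 2))" for x
  proof -
    let ?s = "(x - y) \<bullet> (x - y)"
    have pos: "?s + e\<^sup>2 > 0" using e by (simp add: add_nonneg_pos)
    have "(?s + e\<^sup>2) powr (1 + (-lam - 2)) = (?s + e\<^sup>2) * (?s + e\<^sup>2) powr (-lam - 2)"
      using pos by (intro powr_mult_base[symmetric]) simp
    moreover have "1 + (-lam - 2) = -lam - 1" by simp
    ultimately have "(?s + e\<^sup>2) powr (-lam - 1) = (?s + e\<^sup>2) * (?s + e\<^sup>2) powr (-lam - 2)"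
      by metis
    then have F1: "F 1 ?s = - lam * ((?s + e\<^sup>2) * (?s + e\<^sup>2) powr (-lam - 2))"
      by (simp add: F_def)
    have lap: "laplacian u x = 2 * real CARD('n) * F 1 ?s + 4 * ?s * F 2 ?s"
      unfolding u_def using laplacian_radial[of "F 0" "F 1" "F 2" y x] F[of _ 0] F[of _ 1]
      by (simp add: numeral_2_eq_2)
    have half: "lam + 1 = real CARD('n) / 2" by (simp add: lam_def field_simps)
    have "F 2 ?s = lam * (lam + 1) * (?s + e\<^sup>2) powr (-lam - 2)"
      by (simp add: F_def numeral_2_eq_2 pochhammer_Suc)
    then have F2: "F 2 ?s = lam * (real CARD('n) / 2) * (?s + e\<^sup>2) powr (-lam - 2)"
      unfolding half .
    have "2 * N * (- lam * ((s + E) * P)) + 4 * s * (lam * (N / 2) * P) = - (2 * lam * N) * (E * P)"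
      for N s E P :: real by (simp add: algebra_simps)
    then show ?thesis unfolding lap F1 F2 .
  qed
  have [measurable]: "\<phi> \<in> borel_measurable borel"
    using \<phi> Ck_Suc_D[of 0 \<phi>] Ck_Suc_D[of 1 \<phi>] by (auto simp: numeral_2_eq_2 intro!: borel_measurable_continuous_onI)
  have "(LINT x|lborel. ((x - y) \<bullet> (x - y) + e\<^sup>2) powr (-lam) * laplacian \<phi> x)
      = (LINT x|lborel. laplacian u x * \<phi> x)"
    using green_second_identity[OF u \<phi> supp] by (simp add: u_def F_def)
  also have "\<dots> = - (2 * lam * real CARD('n)) *
      (LINT x|lborel. e\<^sup>2 * ((x - y) \<bullet> (x - y) + e\<^sup>2) powr (-lam - 2) * \<phi> x)"
    unfolding lap by (subst integral_mult_right_zero[symmetric]) (simp only: mult.assoc)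
  also have "(LINT x|lborel. e\<^sup>2 * ((x - y) \<bullet> (x - y) + e\<^sup>2) powr (-lam - 2) * \<phi> x)
      = e ^ CARD('n) * (LINT z|lborel. e\<^sup>2 * ((e *\<^sub>R z) \<bullet> (e *\<^sub>R z) + e\<^sup>2) powr (-lam - 2) * \<phi> (y + e *\<^sub>R z))"
    by (subst integral_affine[where c=e and t=y]) (use e in \<open>simp_all\<close>)
  also have "\<dots> = (LINT z|lborel. (1 + z \<bullet> z) powr (-lam - 2) * \<phi> (y + e *\<^sub>R z))"
  proof -
    have "e ^ CARD('n) * (e\<^sup>2 * ((e *\<^sub>R z) \<bullet> (e *\<^sub>R z) + e\<^sup>2) powr (-lam - 2)) = (1 + z \<bullet> z) powr (-lam - 2)" for z :: "real^'n"
    proof -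
      have "(e *\<^sub>R z) \<bullet> (e *\<^sub>R z) + e\<^sup>2 = e powr 2 * (1 + z \<bullet> z)"
        using e by (simp add: power2_eq_square algebra_simps)
      then have "((e *\<^sub>R z) \<bullet> (e *\<^sub>R z) + e\<^sup>2) powr (-lam - 2) = e powr (2 * (-lam - 2)) * (1 + z \<bullet> z) powr (-lam - 2)"
        using e by (simp add: powr_mult powr_powr del: powr_numeral)
      moreover have "e ^ CARD('n) * e\<^sup>2 = e powr (real CARD('n) + 2)"
        using e by (simp add: powr_add powr_realpow)
      moreover have "e powr (real CARD('n) + 2) * e powr (2 * (-lam - 2)) = 1"
      proof -
        have "real CARD('n) + 2 + 2 * (-lam - 2) = 0" by (simp add: lam_def field_simps)
        then show ?thesis using e by (simp add: powr_add[symmetric])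
      qed
      ultimately show ?thesis by (simp add: mult.assoc[symmetric])
    qed
    then show ?thesis
      by (subst integral_mult_right_zero[symmetric]) (simp add: mult.assoc[symmetric])
  qed
  also have "2 * lam = real CARD('n) - 2" by (simp add: lam_def)
  finally show ?thesis by (simp only: mult_minus_left)
qed

text \<open>
  Passage to the limit \<open>e \<rightarrow> 0\<close> by dominated convergence on both sides of
  \<open>regularised_riesz_laplacian\<close>.  The constant is that of \<open>fund_sol\<close>, because \<open>sphere_area\<close> is \<open>N\<close> times
  the volume of the unit ball.
\<close>
lemma riesz_laplacian:
  "(LINT x|lborel. 1 / norm (x - y) ^ (CARD('n) - 2) * laplacian \<phi> x)
    = - (real CARD('n) - 2) * real CARD('n) * unit_ball_vol (real CARD('n)) * \<phi> y"
proof -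
  define lam where "lam = (real CARD('n) - 2) / 2"
  let ?n = "CARD('n) - 2" and ?V = "unit_ball_vol (real CARD('n))"
  have lam0: "lam > 0" and n: "real ?n = 2 * lam" using N3 by (auto simp: lam_def)
  have c\<phi>: "continuous_on UNIV \<phi>"
    using \<phi> Ck_Suc_D[of 0 \<phi>] Ck_Suc_D[of 1 \<phi>] by (auto simp: numeral_2_eq_2)
  have c\<Delta>: "continuous_on UNIV (laplacian \<phi>)" by (rule laplacian_continuous[OF \<phi>])
  have supp\<Delta>: "laplacian \<phi> x = 0" if "R < norm x" for x
    by (rule laplacian_eq_0[of "- cball 0 R"]) (use that supp in \<open>auto simp: dist_norm\<close>)
  have [measurable]: "\<phi> \<in> borel_measurable borel" "laplacian \<phi> \<in> borel_measurable borel"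
    using c\<phi> c\<Delta> by (auto intro: borel_measurable_continuous_onI)
  obtain B where B: "B \<ge> 0" "\<And>x. \<bar>\<phi> x\<bar> \<le> B"
    using bounded_compact_support[OF c\<phi> supp] by metis
  define e where "e k = 1 / real (Suc k)" for k
  have e: "e k > 0" for k by (simp add: e_def)
  have e_lim: "e \<longlonglongrightarrow> 0"
    unfolding e_def using LIMSEQ_Suc[OF lim_1_over_n[where 'a=real]] by simp
  have kern: "((x - y) \<bullet> (x - y)) powr (-lam) = 1 / norm (x - y) ^ ?n" if "x \<noteq> y" for x
  proof -
    have "((x - y) \<bullet> (x - y)) powr (-lam) = (norm (x - y) powr 2) powr (-lam)"
      using that by (simp add: power2_norm_eq_inner)
    also have "\<dots> = norm (x - y) powr (- real ?n)"
      by (simp add: powr_powr n del: powr_numeral)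
    finally show ?thesis using that by (simp add: powr_minus_divide powr_realpow)
  qed
  have lim1: "(\<lambda>k. LINT x|lborel. ((x - y) \<bullet> (x - y) + (e k)\<^sup>2) powr (-lam) * laplacian \<phi> x)
      \<longlonglongrightarrow> (LINT x|lborel. 1 / norm (x - y) ^ ?n * laplacian \<phi> x)"
  proof (rule integral_dominated_convergence[where w="\<lambda>x. norm (1 / norm (x - y) ^ ?n * laplacian \<phi> x)"])
    have "integrable lborel (\<lambda>x. 1 / norm (x - y) ^ ?n * laplacian \<phi> x)"
      by (rule integrable_riesz_kernel_mult[OF _ _ c\<Delta> supp\<Delta>]) (use N3 in auto)
    then show "integrable lborel (\<lambda>x. norm (1 / norm (x - y) ^ ?n * laplacian \<phi> x))"
      by (rule integrable_norm)
    show "AE x in lborel. (\<lambda>k. ((x - y) \<bullet> (x - y) + (e k)\<^sup>2) powr (-lam) * laplacian \<phi> x)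
         \<longlonglongrightarrow> 1 / norm (x - y) ^ ?n * laplacian \<phi> x"
      using AE_lborel_singleton[of y]
    proof eventually_elim
      case (elim x)
      have "(\<lambda>k. (x - y) \<bullet> (x - y) + (e k)\<^sup>2) \<longlonglongrightarrow> (x - y) \<bullet> (x - y) + 0\<^sup>2"
        by (intro tendsto_intros e_lim)
      then have "(\<lambda>k. ((x - y) \<bullet> (x - y) + (e k)\<^sup>2) powr (-lam)) \<longlonglongrightarrow> ((x - y) \<bullet> (x - y)) powr (-lam)"
        using elim by (intro tendsto_intros) auto
      then show ?case unfolding kern[OF elim] by (intro tendsto_intros)
    qed
    show "AE x in lborel. norm (((x - y) \<bullet> (x - y) + (e k)\<^sup>2) powr (-lam) * laplacian \<phi> x)
         \<le> norm (1 / norm (x - y) ^ ?n * laplacian \<phi> x)" for k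
      using AE_lborel_singleton[of y]
    proof eventually_elim
      case (elim x)
      have "((x - y) \<bullet> (x - y) + (e k)\<^sup>2) powr (-lam) \<le> ((x - y) \<bullet> (x - y)) powr (-lam)"
        using elim lam0 by (intro powr_mono2') auto
      from mult_right_mono[OF this, of "\<bar>laplacian \<phi> x\<bar>"] show ?case
        unfolding kern[OF elim] by (simp add: abs_mult)
    qed
  qed measurable
  let ?w = "\<lambda>z::real^'n. (1 + z \<bullet> z) powr (-lam - 2)"
  have w_nn: "(\<integral>\<^sup>+z. ennreal (?w z) \<partial>lborel) = ennreal ?V"
  proof -
    have "-lam - 2 = - ((real CARD('n) + 2) / 2)" by (simp add: lam_def field_simps)
    then show ?thesis using nn_integral_bubble[OF refl, where 'a="real^'n"] by simp
  qed
  have w: "integrable lborel ?w"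
    by (rule integrableI_nonneg) (use w_nn in \<open>auto simp: less_top\<close>)
  have w_int: "(LINT z|lborel. ?w z) = ?V"
    by (subst integral_eq_nn_integral) (use w_nn in \<open>auto simp: unit_ball_vol_nonneg\<close>)
  have lim2: "(\<lambda>k. LINT z|lborel. ?w z * \<phi> (y + e k *\<^sub>R z)) \<longlonglongrightarrow> (LINT z|lborel. ?w z * \<phi> y)"
  proof (rule integral_dominated_convergence[where w="\<lambda>z. ?w z * B"])
    show "integrable lborel (\<lambda>z. ?w z * B)" using w by simp
    show "AE z in lborel. (\<lambda>k. ?w z * \<phi> (y + e k *\<^sub>R z)) \<longlonglongrightarrow> ?w z * \<phi> y"
    proof (intro always_eventually allI tendsto_intros)
      fix z
      have "(\<lambda>k. y + e k *\<^sub>R z) \<longlonglongrightarrow> y + 0 *\<^sub>R z" by (intro tendsto_intros e_lim)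
      moreover have "isCont \<phi> y" using c\<phi> by (simp add: continuous_on_eq_continuous_at)
      ultimately show "(\<lambda>k. \<phi> (y + e k *\<^sub>R z)) \<longlonglongrightarrow> \<phi> y"
        using isCont_tendsto_compose by fastforce
    qed
    show "AE z in lborel. norm (?w z * \<phi> (y + e k *\<^sub>R z)) \<le> ?w z * B" for k
      by (intro always_eventually allI) (auto simp: abs_mult intro!: mult_left_mono B)
  qed measurable
  have "(LINT x|lborel. 1 / norm (x - y) ^ ?n * laplacian \<phi> x)
     = - (real CARD('n) - 2) * real CARD('n) * (LINT z|lborel. ?w z * \<phi> y)"
  proof (rule LIMSEQ_unique[OF lim1])
    show "(\<lambda>k. LINT x|lborel. ((x - y) \<bullet> (x - y) + (e k)\<^sup>2) powr (-lam) * laplacian \<phi> x)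
      \<longlonglongrightarrow> - (real CARD('n) - 2) * real CARD('n) * (LINT z|lborel. ?w z * \<phi> y)"
      using regularised_riesz_laplacian[OF e] tendsto_mult_left[OF lim2] by (simp add: lam_def)
  qed
  also have "\<dots> = - (real CARD('n) - 2) * real CARD('n) * ?V * \<phi> y"
    using w_int by simp
  finally show ?thesis .
qed

end


section \<open>A smooth radial mollifier\<close>

text \<open>
  The \<open>n\<close>-th derivative of \<open>exp (- 1 / s)\<close> is a polynomial in \<open>1 / s\<close> times \<open>exp (- 1 / s)\<close>; these are
  the polynomials.
\<close>
primrec flat_poly :: "nat \<Rightarrow> real poly" where
  "flat_poly 0 = 1"
| "flat_poly (Suc n) = [:0, 0, 1:] * (flat_poly n - pderiv (flat_poly n))"

definition flat_exp :: "nat \<Rightarrow> real \<Rightarrow> real" where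
  "flat_exp n s = (if s > 0 then poly (flat_poly n) (1 / s) * exp (- (1 / s)) else 0)"

lemma poly_mult_exp_minus_tendsto_0: "((\<lambda>u::real. poly p u * exp (- u)) \<longlongrightarrow> 0) at_top"
proof -
  have "((\<lambda>u. \<Sum>i\<le>degree p. coeff p i * (u ^ i / exp u)) \<longlongrightarrow> (\<Sum>i\<le>degree p. coeff p i * 0)) at_top"
    by (intro tendsto_sum tendsto_mult tendsto_const tendsto_power_div_exp_0)
  then show ?thesis
    by (simp add: poly_altdef exp_minus sum_distrib_right divide_inverse mult.assoc)
qed

lemma flat_exp_has_derivative: "(flat_exp n has_real_derivative flat_exp (Suc n) s) (at s)"
proof -
  consider "s > 0" | "s < 0" | "s = 0" by linarith
  then show ?thesis
  proof cases
    case 1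
    let ?p = "flat_poly n"
    have "((\<lambda>s. poly ?p (1 / s) * exp (- (1 / s))) has_real_derivative
        poly (pderiv ?p) (1 / s) * (- (1 / s\<^sup>2)) * exp (- (1 / s)) + poly ?p (1 / s) * (exp (- (1 / s)) * (1 / s\<^sup>2))) (at s)"
      using 1 by (auto intro!: derivative_eq_intros DERIV_chain'[OF _ poly_DERIV] simp: power2_eq_square)
    then have "((\<lambda>s. poly ?p (1 / s) * exp (- (1 / s))) has_real_derivative flat_exp (Suc n) s) (at s)"
      by (rule DERIV_cong) (use 1 in \<open>simp add: flat_exp_def power2_eq_square algebra_simps\<close>)
    then show ?thesis
      by (rule has_field_derivative_transform_within_open[of _ _ _ "{0<..}"])
        (use 1 in \<open>auto simp: flat_exp_def\<close>)
  next
    case 2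
    have "((\<lambda>_. 0) has_real_derivative flat_exp (Suc n) s) (at s)"
      using 2 by (simp add: flat_exp_def)
    then show ?thesis
      by (rule has_field_derivative_transform_within_open[of _ _ _ "{..<0}"])
        (use 2 in \<open>auto simp: flat_exp_def\<close>)
  next
    case 3
    have "((\<lambda>h. flat_exp n h / h) \<longlongrightarrow> 0) (at_right 0)"
    proof -
      have "((\<lambda>u. poly (pCons 0 (flat_poly n)) u * exp (- u)) \<longlongrightarrow> 0) at_top"
        by (rule poly_mult_exp_minus_tendsto_0)
      from filterlim_compose[OF this filterlim_inverse_at_top_right]
      show ?thesis
        by (rule Lim_transform_eventually)
          (auto simp: eventually_at_right_field flat_exp_def divide_inverse intro!: exI[of _ 1])
    qed
    moreover have "((\<lambda>h. flat_exp n h / h) \<longlongrightarrow> 0) (at_left 0)"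
      by (rule Lim_transform_eventually[OF tendsto_const])
        (auto simp: eventually_at_left_field flat_exp_def intro!: exI[of _ "-1"])
    ultimately have "((\<lambda>h. flat_exp n h / h) \<longlongrightarrow> 0) (at 0)"
      by (simp add: filterlim_split_at)
    then show ?thesis
      using 3 by (simp add: DERIV_def flat_exp_def)
  qed
qed

text \<open>
  The derivatives, in the variable \<open>s = |z|\<^sup>2\<close>, of the bump \<open>exp (- 1 / (\<delta>\<^sup>2 - s))\<close> that vanishes outside
  the ball of radius \<open>\<delta>\<close>.  It is not normalised: only ratios to \<open>moll_mass\<close> matter below.
\<close>
definition moll :: "real \<Rightarrow> nat \<Rightarrow> real \<Rightarrow> real" where
  "moll \<delta> n s = (-1) ^ n * flat_exp n (\<delta>\<^sup>2 - s)"

lemma moll_has_derivative: "(moll \<delta> n has_real_derivative moll \<delta> (Suc n) s) (at s)"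
proof -
  have "((\<lambda>s. flat_exp n (\<delta>\<^sup>2 - s)) has_real_derivative flat_exp (Suc n) (\<delta>\<^sup>2 - s) * (-1)) (at s)"
    by (rule DERIV_chain'[OF _ flat_exp_has_derivative]) (auto intro!: derivative_eq_intros)
  from DERIV_cmult[OF this, of "(-1) ^ n"] show ?thesis
    unfolding moll_def by simp
qed

lemma moll_eq_0: "s \<ge> \<delta>\<^sup>2 \<Longrightarrow> moll \<delta> n s = 0"
  by (simp add: moll_def flat_exp_def)

lemma moll_pos: "s < \<delta>\<^sup>2 \<Longrightarrow> moll \<delta> 0 s > 0"
  by (simp add: moll_def flat_exp_def)

lemma moll_nonneg: "moll \<delta> 0 s \<ge> 0"
  by (simp add: moll_def flat_exp_def)

lemma moll_continuous: "continuous_on S (moll \<delta> n)"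
  by (meson DERIV_isCont continuous_at_imp_continuous_on moll_has_derivative)

lemma moll_bounded:
  obtains B where "B \<ge> 0" "\<And>n s. n \<le> m \<Longrightarrow> s \<ge> 0 \<Longrightarrow> \<bar>moll \<delta> n s\<bar> \<le> B"
proof -
  have "\<exists>B\<ge>0. \<forall>s\<ge>0. \<bar>moll \<delta> n s\<bar> \<le> B" for n
  proof -
    have "compact (moll \<delta> n ` {0..\<delta>\<^sup>2})"
      by (intro compact_continuous_image moll_continuous) auto
    then obtain B where B: "\<forall>s\<in>{0..\<delta>\<^sup>2}. \<bar>moll \<delta> n s\<bar> \<le> B"
      using compact_imp_bounded[of "moll \<delta> n ` {0..\<delta>\<^sup>2}"] by (auto simp: bounded_iff)
    then have "\<bar>moll \<delta> n s\<bar> \<le> max B 0" if "s \<ge> 0" for s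
      using that moll_eq_0[of \<delta> s n] by (cases "s \<le> \<delta>\<^sup>2") force+
    then show ?thesis by (intro exI[of _ "max B 0"]) auto
  qed
  then obtain b where b: "\<And>n. b n \<ge> 0" "\<And>n s. s \<ge> 0 \<Longrightarrow> \<bar>moll \<delta> n s\<bar> \<le> b n"
    by metis
  have "\<bar>moll \<delta> n s\<bar> \<le> sum b {..m}" if "n \<le> m" "s \<ge> 0" for n s
    using b(2)[OF that(2), of n] member_le_sum[of n "{..m}" b] b(1) that(1) by force
  then show ?thesis using b(1) by (intro that[of "sum b {..m}"] sum_nonneg)
qed

lemma test_function_moll:
  fixes c :: "real^'n::finite"
  assumes "\<delta> > 0" "cball c \<delta> \<subseteq> \<Omega>"
  shows "test_function \<Omega> (\<lambda>z. moll \<delta> 0 ((z - c) \<bullet> (z - c)))"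
proof -
  let ?f = "\<lambda>z. moll \<delta> 0 ((z - c) \<bullet> (z - c))"
  have out: "?f z = 0" if "z \<notin> cball c \<delta>" for z
  proof (rule moll_eq_0)
    have "\<delta> \<le> norm (z - c)" using that by (simp add: dist_norm norm_minus_commute)
    from power_mono[OF this, of 2] assms(1) show "\<delta>\<^sup>2 \<le> (z - c) \<bullet> (z - c)"
      by (simp add: power2_norm_eq_inner)
  qed
  have "{z. ?f z \<noteq> 0} \<subseteq> cball c \<delta>"
  proof
    fix z assume "z \<in> {z. ?f z \<noteq> 0}"
    then have "?f z \<noteq> 0" by simp
    then show "z \<in> cball c \<delta>" using out[of z] by argo
  qed
  then have sub: "closure {z. ?f z \<noteq> 0} \<subseteq> cball c \<delta>"
    by (intro closure_minimal) auto
  then have "compact (closure {z. ?f z \<noteq> 0})"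
    unfolding compact_eq_bounded_closed
    by (intro conjI closed_closure bounded_subset[OF bounded_cball sub])
  moreover have "smooth ?f"
    unfolding smooth_def by (intro allI Ck_radial moll_has_derivative)
  ultimately show ?thesis
    unfolding test_function_def using subset_trans[OF sub assms(2)] by (intro conjI)
qed

lemma laplacian_moll:
  fixes c :: "real^'n::finite"
  shows "laplacian (\<lambda>z. moll \<delta> 0 ((z - c) \<bullet> (z - c))) z
    = (\<Sum>i\<in>UNIV. 2 * moll \<delta> 1 ((z - c) \<bullet> (z - c)) + 4 * ((z - c) $ i)\<^sup>2 * moll \<delta> 2 ((z - c) \<bullet> (z - c)))"
proof -
  have "(\<Sum>i\<in>UNIV. ((z - c) $ i)\<^sup>2) = (z - c) \<bullet> (z - c)"
    by (simp add: inner_vec_def power2_eq_square)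
  then have "(\<Sum>i\<in>UNIV. 2 * moll \<delta> 1 ((z - c) \<bullet> (z - c)) + 4 * ((z - c) $ i)\<^sup>2 * moll \<delta> 2 ((z - c) \<bullet> (z - c)))
    = real CARD('n) * (2 * moll \<delta> 1 ((z - c) \<bullet> (z - c))) + 4 * ((z - c) \<bullet> (z - c)) * moll \<delta> 2 ((z - c) \<bullet> (z - c))"
    unfolding sum.distrib by (simp only: sum_constant sum_distrib_left[symmetric] sum_distrib_right[symmetric])
  then show ?thesis
    using laplacian_radial[of "moll \<delta> 0" "moll \<delta> 1" "moll \<delta> 2" c z]
      moll_has_derivative[of \<delta> 0] moll_has_derivative[of \<delta> 1] by (simp add: numeral_2_eq_2)
qed

text \<open>
  Taylor's formula of order three along the line in direction \<open>i\<close>, symmetrised in \<open>t\<close>.  The bound is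
  uniform in \<open>w\<close>: the third derivative vanishes off the support of the bump, and inside it the
  inner derivative is at most \<open>2 \<delta>\<close>.
\<close>
lemma moll_second_difference:
  fixes w :: "real^'n::finite"
  assumes \<delta>: "\<delta> > 0" and B: "\<And>n s. n \<le> 3 \<Longrightarrow> s \<ge> 0 \<Longrightarrow> \<bar>moll \<delta> n s\<bar> \<le> B"
  shows "\<bar>moll \<delta> 0 ((w - t *\<^sub>R axis i 1) \<bullet> (w - t *\<^sub>R axis i 1)) + moll \<delta> 0 ((w + t *\<^sub>R axis i 1) \<bullet> (w + t *\<^sub>R axis i 1))
     - 2 * moll \<delta> 0 (w \<bullet> w) - t\<^sup>2 * (2 * moll \<delta> 1 (w \<bullet> w) + 4 * (w $ i)\<^sup>2 * moll \<delta> 2 (w \<bullet> w))\<bar>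
     \<le> (12 * \<delta> * B + 8 * \<delta> ^ 3 * B) * \<bar>t\<bar> ^ 3"
proof -
  \<comment> \<open>\<open>Q t\<close> is \<open>|w - t e\<^sub>i|\<^sup>2\<close>, \<open>v\<close> its derivative, and \<open>D m\<close> the \<open>m\<close>-th derivative of the bump along the line\<close>
  define Q where "Q t = w \<bullet> w - 2 * t * w $ i + t\<^sup>2" for t
  define v where "v t = 2 * (t - w $ i)" for t
  have Q: "Q t = (w - t *\<^sub>R axis i 1) \<bullet> (w - t *\<^sub>R axis i 1)" for t
    by (simp add: Q_def inner_diff inner_axis inner_axis' power2_eq_square algebra_simps)
  have Qm: "Q (-t) = (w + t *\<^sub>R axis i 1) \<bullet> (w + t *\<^sub>R axis i 1)" for t
    by (simp add: Q)
  have Q_ge: "(t - w $ i)\<^sup>2 \<le> Q t" for t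
  proof -
    have "(w $ i)\<^sup>2 \<le> w \<bullet> w"
      unfolding inner_vec_def power2_eq_square inner_real_def
      by (rule member_le_sum) auto
    then show ?thesis by (simp add: Q_def power2_eq_square algebra_simps)
  qed
  have Q0: "Q t \<ge> 0" for t using Q by simp
  have dQ: "(Q has_real_derivative v t) (at t)" for t
    unfolding Q_def v_def by (auto intro!: derivative_eq_intros)
  have dv: "(v has_real_derivative 2) (at t)" for t
    unfolding v_def by (auto intro!: derivative_eq_intros)
  have dm: "((\<lambda>t. moll \<delta> n (Q t)) has_real_derivative moll \<delta> (Suc n) (Q t) * v t) (at t)" for n t
    by (rule DERIV_chain'[OF dQ moll_has_derivative])
  define D where "D m t = (case m of 0 \<Rightarrow> moll \<delta> 0 (Q t)
     | Suc 0 \<Rightarrow> moll \<delta> 1 (Q t) * v t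
     | Suc (Suc 0) \<Rightarrow> moll \<delta> 2 (Q t) * (v t)\<^sup>2 + 2 * moll \<delta> 1 (Q t)
     | _ \<Rightarrow> moll \<delta> 3 (Q t) * (v t) ^ 3 + 6 * moll \<delta> 2 (Q t) * v t)" for m :: nat and t
  have d0: "(D 0 has_real_derivative D 1 t) (at t)" for t
    using dm[of 0] by (simp add: D_def[abs_def])
  have d1: "(D 1 has_real_derivative D 2 t) (at t)" for t
    unfolding D_def[abs_def] One_nat_def numeral_2_eq_2
    by simp (rule DERIV_cong[OF DERIV_mult[OF dm dv]], simp add: power2_eq_square)
  have d2: "(D 2 has_real_derivative D 3 t) (at t)" for t
  proof -
    have "((\<lambda>t. moll \<delta> 2 (Q t) * (v t)\<^sup>2 + 2 * moll \<delta> 1 (Q t)) has_real_derivative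
        (moll \<delta> 3 (Q t) * v t) * (v t)\<^sup>2 + (2 * v t * 2) * moll \<delta> 2 (Q t) + 2 * (moll \<delta> 2 (Q t) * v t)) (at t)"
      using dm[of 2 t] dm[of 1 t]
      by (auto intro!: derivative_eq_intros dv simp: eval_nat_numeral)
    then show ?thesis
      by (simp add: D_def[abs_def] eval_nat_numeral algebra_simps)
  qed
  have D3: "\<bar>D 3 t\<bar> \<le> 12 * \<delta> * B + 8 * \<delta> ^ 3 * B" for t
  proof (cases "Q t < \<delta>\<^sup>2")
    case False
    have "B \<ge> 0" using B[of 0 0] by simp
    then show ?thesis using False \<delta> by (simp add: D_def numeral_3_eq_3 moll_eq_0)
  next
    case True
    then have "(t - w $ i)\<^sup>2 < \<delta>\<^sup>2" using Q_ge[of t] by linarith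
    then have v: "\<bar>v t\<bar> \<le> 2 * \<delta>"
      using \<delta> abs_le_square_iff[of "t - w $ i" \<delta>] by (simp add: v_def abs_mult)
    have "D 3 t = moll \<delta> 3 (Q t) * (v t) ^ 3 + 6 * moll \<delta> 2 (Q t) * v t"
      by (simp add: D_def numeral_3_eq_3)
    also have "\<bar>\<dots>\<bar> \<le> \<bar>moll \<delta> 3 (Q t) * (v t) ^ 3\<bar> + \<bar>6 * moll \<delta> 2 (Q t) * v t\<bar>"
      by (rule abs_triangle_ineq)
    also have "\<dots> = \<bar>moll \<delta> 3 (Q t)\<bar> * \<bar>v t\<bar> ^ 3 + 6 * \<bar>moll \<delta> 2 (Q t)\<bar> * \<bar>v t\<bar>"
      by (simp add: abs_mult power_abs)
    also have "\<dots> \<le> B * (2 * \<delta>) ^ 3 + 6 * B * (2 * \<delta>)"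
      using B[of 3 "Q t"] B[of 2 "Q t"] Q0 v \<delta>
      by (intro add_mono mult_mono power_mono) auto
    finally show ?thesis by (simp add: power3_eq_cube algebra_simps)
  qed
  have taylor: "\<exists>a. D 0 t = D 0 0 + D 1 0 * t + D 2 0 / 2 * t\<^sup>2 + D 3 a / 6 * t ^ 3" for t
  proof -
    have "\<exists>a. \<bar>a\<bar> \<le> \<bar>t\<bar> \<and> D 0 t = (\<Sum>m<3. D m 0 / fact m * t ^ m) + D 3 a / fact 3 * t ^ 3"
      by (rule Maclaurin_bi_le[OF refl]) (use d0 d1 d2 in \<open>auto simp: eval_nat_numeral less_Suc_eq\<close>)
    then show ?thesis
      by (auto simp: eval_nat_numeral)
  qed
  obtain a b where a: "D 0 t = D 0 0 + D 1 0 * t + D 2 0 / 2 * t\<^sup>2 + D 3 a / 6 * t ^ 3"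
    and b: "D 0 (-t) = D 0 0 + D 1 0 * (-t) + D 2 0 / 2 * (-t)\<^sup>2 + D 3 b / 6 * (-t) ^ 3"
    using taylor by blast
  have "D 0 t + D 0 (-t) - 2 * D 0 0 - t\<^sup>2 * D 2 0 = (D 3 a - D 3 b) / 6 * t ^ 3"
    unfolding a b by (simp add: field_simps)
  also have "\<bar>\<dots>\<bar> \<le> (12 * \<delta> * B + 8 * \<delta> ^ 3 * B) * \<bar>t\<bar> ^ 3"
    unfolding abs_mult power_abs[symmetric]
    by (intro mult_right_mono) (use D3[of a] D3[of b] in auto)
  finally have "\<bar>D 0 t + D 0 (-t) - 2 * D 0 0 - t\<^sup>2 * D 2 0\<bar> \<le> (12 * \<delta> * B + 8 * \<delta> ^ 3 * B) * \<bar>t\<bar> ^ 3" .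
  moreover have "D 2 0 = 2 * moll \<delta> 1 (w \<bullet> w) + 4 * (w $ i)\<^sup>2 * moll \<delta> 2 (w \<bullet> w)"
    by (simp add: D_def numeral_2_eq_2 v_def Q_def power2_eq_square)
  moreover have "D 0 0 = moll \<delta> 0 (w \<bullet> w)" by (simp add: D_def Q_def)
  moreover have "D 0 t = moll \<delta> 0 ((w - t *\<^sub>R axis i 1) \<bullet> (w - t *\<^sub>R axis i 1))"
    by (simp add: D_def Q)
  moreover have "D 0 (-t) = moll \<delta> 0 ((w + t *\<^sub>R axis i 1) \<bullet> (w + t *\<^sub>R axis i 1))"
    unfolding D_def Qm by simp
  ultimately show ?thesis by simp
qed


section \<open>Uniqueness of the Green function\<close>

lemma integrable_mult_bounded:
  fixes h g :: "'a \<Rightarrow> real"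
  assumes "integrable M h" "g \<in> borel_measurable M" "\<And>z. \<bar>g z\<bar> \<le> B"
  shows "integrable M (\<lambda>z. h z * g z)"
proof (rule Bochner_Integration.integrable_bound)
  show "integrable M (\<lambda>z. B * h z)" using assms(1) by simp
  show "(\<lambda>z. h z * g z) \<in> borel_measurable M" using assms by measurable
  have "\<bar>g z\<bar> \<le> \<bar>B\<bar>" for z using assms(3)[of z] by linarith
  then show "AE z in M. norm (h z * g z) \<le> norm (B * h z)"
    by (auto simp: abs_mult mult.commute intro!: mult_right_mono)
qed

lemma borel_measurable_moll:
  "(\<lambda>z::real^'n::finite. moll \<delta> m ((z - x) \<bullet> (z - x))) \<in> borel_measurable lebesgue"
proof -
  have "continuous_on UNIV (\<lambda>z::real^'n. moll \<delta> m ((z - x) \<bullet> (z - x)))"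
    by (intro continuous_on_compose2[OF moll_continuous[of UNIV]] continuous_intros) auto
  then show ?thesis
    by (simp add: borel_measurable_continuous_onI measurable_completion)
qed

context
  fixes h :: "real^'n::finite \<Rightarrow> real" and \<delta> :: real
  assumes h: "integrable lebesgue h" and \<delta>: "\<delta> > 0"
begin

definition mollify :: "real^'n \<Rightarrow> real" where
  "mollify x = (LINT z|lebesgue. h z * moll \<delta> 0 ((z - x) \<bullet> (z - x)))"

lemma integrable_moll_mult: "integrable lebesgue (\<lambda>z. h z * moll \<delta> m ((z - x) \<bullet> (z - x)))"
proof -
  obtain B where "\<And>n s. n \<le> m \<Longrightarrow> s \<ge> 0 \<Longrightarrow> \<bar>moll \<delta> n s\<bar> \<le> B"
    using moll_bounded[of m \<delta>] by metis
  then show ?thesis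
    by (intro integrable_mult_bounded[where B=B] h borel_measurable_moll) auto
qed

lemma continuous_mollify: "continuous_on UNIV mollify"
proof -
  obtain B where B: "B \<ge> 0" "\<And>n s. n \<le> 0 \<Longrightarrow> s \<ge> 0 \<Longrightarrow> \<bar>moll \<delta> n s\<bar> \<le> B"
    using moll_bounded[of 0 \<delta>] by metis
  have "(\<lambda>n. mollify (X n)) \<longlonglongrightarrow> mollify x" if X: "X \<longlonglongrightarrow> x" for X x
    unfolding mollify_def
  proof (rule integral_dominated_convergence[where w="\<lambda>z. norm (B * h z)"])
    show "integrable lebesgue (\<lambda>z. norm (B * h z))" using h by simp
    show "AE z in lebesgue. (\<lambda>n. h z * moll \<delta> 0 ((z - X n) \<bullet> (z - X n)))
        \<longlonglongrightarrow> h z * moll \<delta> 0 ((z - x) \<bullet> (z - x))"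
      by (intro always_eventually allI tendsto_intros X
          isCont_tendsto_compose[OF DERIV_isCont[OF moll_has_derivative]])
    show "AE z in lebesgue. norm (h z * moll \<delta> 0 ((z - X n) \<bullet> (z - X n))) \<le> norm (B * h z)" for n
    proof (intro always_eventually allI)
      fix z
      have "\<bar>h z\<bar> * \<bar>moll \<delta> 0 ((z - X n) \<bullet> (z - X n))\<bar> \<le> \<bar>h z\<bar> * B"
        by (intro mult_left_mono B(2)) auto
      then show "norm (h z * moll \<delta> 0 ((z - X n) \<bullet> (z - X n))) \<le> norm (B * h z)"
        using B(1) by (simp add: abs_mult mult.commute)
    qed
    show "(\<lambda>z. h z * moll \<delta> 0 ((z - x) \<bullet> (z - x))) \<in> borel_measurable lebesgue" for x
      using integrable_moll_mult by (rule borel_measurable_integrable)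
    then show "(\<lambda>z. h z * moll \<delta> 0 ((z - X n) \<bullet> (z - X n))) \<in> borel_measurable lebesgue" for n .
  qed
  then show ?thesis
    by (simp add: continuous_on_sequentially o_def)
qed

text \<open>
  If \<open>h\<close> is weakly harmonic at scale \<open>\<delta>\<close> around \<open>x\<close>, the second differences of its mollification, summed
  over the coordinate directions, are \<open>O(t\<^sup>3)\<close>, because the \<open>t\<^sup>2\<close> part is the integral of \<open>h\<close> against the
  Laplacian of the bump.  The term \<open>\<kappa> |x|\<^sup>2\<close> contributes a positive multiple of \<open>t\<^sup>2\<close>, which is incompatible
  with a maximum.  This avoids differentiating under the integral sign.
\<close>
lemma mollify_no_interior_max:
  assumes harmonic: "(LINT z|lebesgue. h z * laplacian (\<lambda>z. moll \<delta> 0 ((z - x) \<bullet> (z - x))) z) = 0"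
    and \<kappa>: "\<kappa> > 0" and r: "r > 0"
    and max: "\<And>x'. x' \<in> ball x r \<Longrightarrow> mollify x' + \<kappa> * (x' \<bullet> x') \<le> mollify x + \<kappa> * (x \<bullet> x)"
  shows False
proof -
  let ?e = "\<lambda>i. axis i 1 :: real^'n" and ?N = "real CARD('n)"
  obtain B where B: "B \<ge> 0" "\<And>n s. n \<le> 3 \<Longrightarrow> s \<ge> 0 \<Longrightarrow> \<bar>moll \<delta> n s\<bar> \<le> B"
    using moll_bounded[of 3 \<delta>] by metis
  define M where "M = 12 * \<delta> * B + 8 * \<delta> ^ 3 * B"
  have M: "M \<ge> 0" using B \<delta> by (simp add: M_def)
  define H where "H = (LINT z|lebesgue. \<bar>h z\<bar>)"
  have H: "H \<ge> 0" unfolding H_def by simp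
  \<comment> \<open>small enough to stay in the ball and to make the cubic error \<open>M H t\<^sup>3\<close> smaller than \<open>\<kappa> t\<^sup>2\<close>\<close>
  define t where "t = min (r / 2) (\<kappa> / (M * H + 1))"
  have MH: "M * H \<ge> 0" using M H by simp
  then have t: "t > 0" "t < r" "t * (M * H) < \<kappa>"
  proof -
    show "t > 0" "t < r" using r \<kappa> MH by (auto simp: t_def)
    have "t * (M * H) \<le> \<kappa> / (M * H + 1) * (M * H)"
      using MH by (intro mult_right_mono) (auto simp: t_def)
    also have "\<dots> < \<kappa>" using MH \<kappa> by (simp add: field_simps)
    finally show "t * (M * H) < \<kappa>" .
  qed
  define m where "m x z = moll \<delta> 0 ((z - x) \<bullet> (z - x))" for x z :: "real^'n"
  define L where "L i z = 2 * moll \<delta> 1 ((z - x) \<bullet> (z - x)) + 4 * ((z - x) $ i)\<^sup>2 * moll \<delta> 2 ((z - x) \<bullet> (z - x))" for i z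
  define E where "E i z = m (x + t *\<^sub>R ?e i) z + m (x - t *\<^sub>R ?e i) z - 2 * m x z - t\<^sup>2 * L i z" for i z
  have E: "\<bar>E i z\<bar> \<le> M * t ^ 3" for i z
    using moll_second_difference[OF \<delta> B(2), where w="z - x" and t=t and i=i] t(1)
    by (simp add: E_def m_def L_def M_def algebra_simps)
  have int_m: "integrable lebesgue (\<lambda>z. h z * m x z)" for x
    unfolding m_def by (rule integrable_moll_mult)
  have E_meas: "E i \<in> borel_measurable lebesgue" for i
  proof -
    have c: "continuous_on UNIV (\<lambda>z::real^'n. moll \<delta> k ((z - a) \<bullet> (z - a)))" for k a
      by (intro continuous_on_compose2[OF moll_continuous[of UNIV]] continuous_intros) auto
    have "continuous_on UNIV (E i)"
      unfolding E_def m_def L_def by (intro continuous_intros c)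
    then show ?thesis
      by (simp add: borel_measurable_continuous_onI measurable_completion)
  qed
  have int_E: "integrable lebesgue (\<lambda>z. h z * E i z)" for i
    by (rule integrable_mult_bounded[OF h E_meas E])
  have bound_E: "- (H * (M * t ^ 3)) \<le> (LINT z|lebesgue. h z * E i z)" for i
  proof -
    have "- (H * (M * t ^ 3)) = (LINT z|lebesgue. - (\<bar>h z\<bar> * (M * t ^ 3)))"
      by (simp add: H_def)
    also have "\<dots> \<le> (LINT z|lebesgue. h z * E i z)"
    proof (rule integral_mono[OF _ int_E])
      show "integrable lebesgue (\<lambda>z. - (\<bar>h z\<bar> * (M * t ^ 3)))" using h by simp
      fix z
      have "\<bar>h z * E i z\<bar> \<le> \<bar>h z\<bar> * (M * t ^ 3)"
        unfolding abs_mult by (intro mult_left_mono E) simp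
      then show "- (\<bar>h z\<bar> * (M * t ^ 3)) \<le> h z * E i z" by linarith
    qed
    finally show ?thesis .
  qed
  have sd: "mollify (x + t *\<^sub>R ?e i) + mollify (x - t *\<^sub>R ?e i) - 2 * mollify x
      = (LINT z|lebesgue. h z * (E i z + t\<^sup>2 * L i z))" for i
  proof -
    have "(LINT z|lebesgue. h z * (E i z + t\<^sup>2 * L i z))
      = (LINT z|lebesgue. h z * m (x + t *\<^sub>R ?e i) z + h z * m (x - t *\<^sub>R ?e i) z - 2 * (h z * m x z))"
      by (simp add: E_def algebra_simps)
    also have "\<dots> = mollify (x + t *\<^sub>R ?e i) + mollify (x - t *\<^sub>R ?e i) - 2 * mollify x"
      using int_m by (simp add: mollify_def m_def[symmetric])
    finally show ?thesis by simp
  qed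
  have int_EL: "integrable lebesgue (\<lambda>z. h z * (E i z + t\<^sup>2 * L i z))" for i
  proof -
    have "integrable lebesgue (\<lambda>z. h z * m (x + t *\<^sub>R ?e i) z + h z * m (x - t *\<^sub>R ?e i) z - 2 * (h z * m x z))"
      using int_m by simp
    then show ?thesis by (simp add: E_def algebra_simps)
  qed
  have lap: "laplacian (\<lambda>z. moll \<delta> 0 ((z - x) \<bullet> (z - x))) z = (\<Sum>i\<in>UNIV. L i z)" for z
    unfolding laplacian_moll L_def ..
  have int_L: "integrable lebesgue (\<lambda>z. t\<^sup>2 * (h z * (\<Sum>i\<in>UNIV. L i z)))"
  proof -
    have "integrable lebesgue (\<lambda>z. (\<Sum>i\<in>UNIV. h z * (E i z + t\<^sup>2 * L i z)) - (\<Sum>i\<in>UNIV. h z * E i z))"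
      using int_EL int_E by simp
    also have "(\<lambda>z. (\<Sum>i\<in>UNIV. h z * (E i z + t\<^sup>2 * L i z)) - (\<Sum>i\<in>UNIV. h z * E i z))
      = (\<lambda>z. t\<^sup>2 * (h z * (\<Sum>i\<in>UNIV. L i z)))"
      by (simp add: fun_eq_iff sum_subtractf[symmetric] sum_distrib_left algebra_simps)
    finally show ?thesis .
  qed
  have "(\<Sum>i\<in>UNIV. mollify (x + t *\<^sub>R ?e i) + mollify (x - t *\<^sub>R ?e i) - 2 * mollify x)
     = (LINT z|lebesgue. (\<Sum>i\<in>UNIV. h z * (E i z + t\<^sup>2 * L i z)))"
    unfolding sd using int_EL by simp
  also have "\<dots> = (LINT z|lebesgue. (\<Sum>i\<in>UNIV. h z * E i z) + t\<^sup>2 * (h z * (\<Sum>i\<in>UNIV. L i z)))"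
    by (simp add: sum.distrib[symmetric] sum_distrib_left algebra_simps)
  also have "\<dots> = (LINT z|lebesgue. (\<Sum>i\<in>UNIV. h z * E i z)) + (LINT z|lebesgue. t\<^sup>2 * (h z * (\<Sum>i\<in>UNIV. L i z)))"
    using int_E int_L by (intro Bochner_Integration.integral_add) auto
  also have "\<dots> = (\<Sum>i\<in>UNIV. (LINT z|lebesgue. h z * E i z))"
    using harmonic int_E by (simp add: lap)
  also have "\<dots> \<ge> (\<Sum>i\<in>(UNIV::'n set). - (H * (M * t ^ 3)))"
    by (intro sum_mono bound_E)
  finally have lower: "- ?N * (H * (M * t ^ 3))
      \<le> (\<Sum>i\<in>UNIV. mollify (x + t *\<^sub>R ?e i) + mollify (x - t *\<^sub>R ?e i) - 2 * mollify x)"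
    by simp
  have "(\<Sum>i\<in>UNIV. mollify (x + t *\<^sub>R ?e i) + mollify (x - t *\<^sub>R ?e i) - 2 * mollify x)
      \<le> (\<Sum>i\<in>(UNIV :: 'n set). - 2 * \<kappa> * t\<^sup>2)"
  proof (rule sum_mono)
    fix i :: 'n
    have mem: "x + t *\<^sub>R ?e i \<in> ball x r" "x - t *\<^sub>R ?e i \<in> ball x r"
      using t by (auto simp: dist_norm)
    have "(x + t *\<^sub>R ?e i) \<bullet> (x + t *\<^sub>R ?e i) + (x - t *\<^sub>R ?e i) \<bullet> (x - t *\<^sub>R ?e i) = 2 * (x \<bullet> x) + 2 * t\<^sup>2"
      by (simp add: inner_add inner_diff inner_axis inner_axis' power2_eq_square algebra_simps)
    then have "\<kappa> * ((x + t *\<^sub>R ?e i) \<bullet> (x + t *\<^sub>R ?e i)) + \<kappa> * ((x - t *\<^sub>R ?e i) \<bullet> (x - t *\<^sub>R ?e i))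
       = 2 * (\<kappa> * (x \<bullet> x)) + 2 * \<kappa> * t\<^sup>2"
      by (simp only: distrib_left[symmetric]) (simp add: algebra_simps)
    with max[OF mem(1)] max[OF mem(2)]
    show "mollify (x + t *\<^sub>R ?e i) + mollify (x - t *\<^sub>R ?e i) - 2 * mollify x \<le> - 2 * \<kappa> * t\<^sup>2"
      by linarith
  qed
  from order.trans[OF lower this] have "?N * (2 * \<kappa> * t\<^sup>2) \<le> ?N * (H * (M * t ^ 3))" by simp
  then have "2 * \<kappa> * t\<^sup>2 \<le> H * (M * t ^ 3)"
    by (rule mult_left_le_imp_le) simp
  also have "\<dots> = (t * (M * H)) * t\<^sup>2" by (simp add: power2_eq_square power3_eq_cube)
  finally have "2 * \<kappa> \<le> t * (M * H)" using t(1) by simp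
  with t(3) \<kappa> show False by simp
qed

end

definition moll_mass :: "'n::finite itself \<Rightarrow> real \<Rightarrow> real" where
  "moll_mass _ \<delta> = (LINT z|lborel. moll \<delta> 0 ((z::real^'n) \<bullet> z))"

lemma borel_measurable_moll_lborel:
  "(\<lambda>z::real^'n::finite. moll \<delta> m ((z - x) \<bullet> (z - x))) \<in> borel_measurable borel"
  by (intro borel_measurable_continuous_onI continuous_on_compose2[OF moll_continuous[of UNIV]] continuous_intros) auto

lemma norm_less_power2_iff:
  fixes z :: "'a::real_inner"
  assumes "\<delta> > 0"
  shows "z \<bullet> z < \<delta>\<^sup>2 \<longleftrightarrow> norm z < \<delta>"
  using assms by (simp add: power2_norm_eq_inner[symmetric] not_le[symmetric] power_mono_iff)

lemma integrable_moll:
  assumes "\<delta> > 0"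
  shows "integrable lborel (\<lambda>z::real^'n::finite. moll \<delta> 0 (z \<bullet> z))"
proof (rule integrable_compact_support[where R=\<delta>])
  show "continuous_on UNIV (\<lambda>z::real^'n. moll \<delta> 0 (z \<bullet> z))"
    by (intro continuous_on_compose2[OF moll_continuous[of UNIV]] continuous_intros) auto
  fix z :: "real^'n" assume "\<delta> < norm z"
  then have "\<not> z \<bullet> z < \<delta>\<^sup>2" using norm_less_power2_iff[OF assms, of z] by simp
  then show "moll \<delta> 0 (z \<bullet> z) = 0" by (intro moll_eq_0) simp
qed

lemma moll_mass_pos:
  assumes \<delta>: "\<delta> > 0"
  shows "moll_mass TYPE('n::finite) \<delta> > 0"
proof -
  have nn: "moll_mass TYPE('n) \<delta> \<ge> 0"
    unfolding moll_mass_def by (intro integral_nonneg_AE always_eventually allI moll_nonneg)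
  have "moll_mass TYPE('n) \<delta> \<noteq> 0"
  proof
    assume "moll_mass TYPE('n) \<delta> = 0"
    then have "AE z in lborel. moll \<delta> 0 ((z::real^'n) \<bullet> z) = 0"
      unfolding moll_mass_def using integral_nonneg_eq_0_iff_AE[OF integrable_moll[OF \<delta>, where 'n='n]]
      by (simp add: moll_nonneg)
    then have "AE z in lborel. (z::real^'n) \<notin> ball 0 \<delta>"
    proof eventually_elim
      case (elim z)
      then have "\<not> z \<bullet> z < \<delta>\<^sup>2" using moll_pos[of "z \<bullet> z" \<delta>] by auto
      then show ?case using norm_less_power2_iff[OF \<delta>, of z] by (simp add: dist_norm)
    qed
    then have "ball (0::real^'n) \<delta> \<in> null_sets lborel"
      by (subst AE_iff_null_sets) auto
    then have "measure lborel (ball (0::real^'n) \<delta>) = 0"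
      by (simp add: measure_def null_setsD1)
    then show False using content_ball_pos[OF \<delta>, of "0::real^'n"] by simp
  qed
  with nn show ?thesis by simp
qed

lemma moll_has_integral:
  assumes "\<delta> > 0"
  shows "has_bochner_integral lebesgue (\<lambda>z::real^'n::finite. moll \<delta> 0 ((z - x) \<bullet> (z - x))) (moll_mass TYPE('n) \<delta>)"
proof -
  have m: "(\<lambda>z::real^'n. moll \<delta> 0 (z \<bullet> z)) \<in> borel_measurable borel"
    using borel_measurable_moll_lborel[of \<delta> 0 0] by simp
  have "integrable (distr lborel borel ((+) (- x))) (\<lambda>z::real^'n. moll \<delta> 0 (z \<bullet> z))"
    using integrable_moll[OF assms, where 'n='n] by (simp only: lborel_distr_plus)
  then have "integrable lborel (\<lambda>z. moll \<delta> 0 ((- x + z) \<bullet> (- x + z)))"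
    by (subst (asm) integrable_distr_eq[OF _ m]) auto
  moreover have "(LINT z|lborel. moll \<delta> 0 ((- x + z) \<bullet> (- x + z))) = moll_mass TYPE('n) \<delta>"
    unfolding moll_mass_def by (rule integral_translation[OF m])
  ultimately have "integrable lborel (\<lambda>z. moll \<delta> 0 ((z - x) \<bullet> (z - x)))"
    "(LINT z|lborel. moll \<delta> 0 ((z - x) \<bullet> (z - x))) = moll_mass TYPE('n) \<delta>"
    by simp_all
  then show ?thesis
    unfolding has_bochner_integral_iff
    using borel_measurable_moll_lborel[of \<delta> 0 x]
    by (simp add: integrable_completion integral_completion)
qed

lemma mollify_lower:
  fixes h :: "real^'n::finite \<Rightarrow> real"
  assumes h: "integrable lebesgue h" and \<delta>: "\<delta> > 0" and le: "\<And>z. z \<in> cball x \<delta> \<Longrightarrow> a \<le> h z"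
  shows "a * moll_mass TYPE('n) \<delta> \<le> mollify h \<delta> x"
proof -
  let ?m = "\<lambda>z::real^'n. moll \<delta> 0 ((z - x) \<bullet> (z - x))"
  have m: "integrable lebesgue ?m" "(LINT z|lebesgue. ?m z) = moll_mass TYPE('n) \<delta>"
    using moll_has_integral[OF \<delta>, of x] unfolding has_bochner_integral_iff by auto
  have "a * moll_mass TYPE('n) \<delta> = (LINT z|lebesgue. a * ?m z)"
    using m by simp
  also have "\<dots> \<le> (LINT z|lebesgue. h z * ?m z)"
  proof (rule integral_mono)
    show "integrable lebesgue (\<lambda>z. a * ?m z)" using m by simp
    show "integrable lebesgue (\<lambda>z. h z * ?m z)" by (rule integrable_moll_mult[OF h \<delta>])
    fix z
    show "a * ?m z \<le> h z * ?m z"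
    proof (cases "z \<in> cball x \<delta>")
      case True
      then show ?thesis by (intro mult_right_mono le moll_nonneg)
    next
      case False
      then have "\<not> (z - x) \<bullet> (z - x) < \<delta>\<^sup>2"
        using norm_less_power2_iff[OF \<delta>, of "z - x"] by (simp add: dist_norm norm_minus_commute)
      then have "?m z = 0" by (intro moll_eq_0) simp
      then show ?thesis by simp
    qed
  qed
  finally show ?thesis by (simp add: mollify_def[OF h \<delta>])
qed

lemma mollify_upper:
  fixes h :: "real^'n::finite \<Rightarrow> real"
  assumes h: "integrable lebesgue h" and \<delta>: "\<delta> > 0" and le: "\<And>z. z \<in> cball x \<delta> \<Longrightarrow> h z \<le> a"
  shows "mollify h \<delta> x \<le> a * moll_mass TYPE('n) \<delta>"
proof -
  have h': "integrable lebesgue (\<lambda>z. - h z)" using h by simp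
  have "- a * moll_mass TYPE('n) \<delta> \<le> mollify (\<lambda>z. - h z) \<delta> x"
    by (rule mollify_lower[OF h' \<delta>]) (use le in auto)
  also have "\<dots> = - mollify h \<delta> x"
    by (simp add: mollify_def[OF h \<delta>] mollify_def[OF h' \<delta>])
  finally show ?thesis by simp
qed

text \<open>
  Let \<open>h = g1 - g2\<close> and suppose \<open>h x = 3 c > 0\<close>.  Since \<open>h\<close> vanishes on the frontier and is continuous
  away from \<open>y\<close>, it is below \<open>c\<close> in a whole neighbourhood of the frontier.  Its mollification at a small
  scale \<open>\<delta>\<close> is at least \<open>2 c\<close> times the mass of the bump at \<open>x\<close> and at most \<open>c\<close> times that mass on the
  boundary of the set \<open>K\<close> of points at distance at least \<open>2 \<delta>\<close> from the complement, so with a small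
  multiple of \<open>|x|\<^sup>2\<close> added it has an interior maximum, against \<open>mollify_no_interior_max\<close>.  The pole causes no
  difficulty: the Dirac masses cancel in \<open>h\<close>, and \<open>h\<close> is integrable near \<open>y\<close>.
\<close>
lemma green_le:
  fixes \<Omega> :: "(real^'n::finite) set"
  assumes \<Omega>: "open \<Omega>" "bounded \<Omega>" and y: "y \<in> \<Omega>"
    and g1: "is_green_with_pole \<Omega> y g1" and g2: "is_green_with_pole \<Omega> y g2"
    and x: "x \<in> \<Omega>" "x \<noteq> y"
  shows "g1 x \<le> g2 x"
proof (rule ccontr)
  assume neg: "\<not> g1 x \<le> g2 x"
  define h where "h z = g1 z - g2 z" for z
  define c where "c = h x / 3"
  have c: "c > 0" using neg by (simp add: c_def h_def)
  define A where "A = - \<Omega>"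
  have A: "closed A" "A \<noteq> {}"
  proof -
    have "\<Omega> \<noteq> UNIV" using \<Omega>(2) not_bounded_UNIV by auto
    then show "closed A" "A \<noteq> {}" using \<Omega>(1) by (auto simp: A_def)
  qed
  have infdist_pos: "infdist z A > 0 \<Longrightarrow> z \<in> \<Omega>" for z
    using infdist_zero[of z A] by (cases "z \<in> \<Omega>") (auto simp: A_def)
  have cont: "continuous_on (closure \<Omega> - {y}) h"
    using g1 g2 unfolding is_green_with_pole_def h_def by (auto intro: continuous_intros)
  have "open ((\<Omega> - {y}) \<inter> h -` {2 * c<..})"
    by (intro continuous_open_preimage continuous_on_subset[OF cont] open_Diff \<Omega>)
      (use closure_subset in auto)
  moreover have "x \<in> (\<Omega> - {y}) \<inter> h -` {2 * c<..}" using x c by (simp add: c_def)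
  ultimately obtain r1 where r1: "r1 > 0" "ball x r1 \<subseteq> (\<Omega> - {y}) \<inter> h -` {2 * c<..}"
    using open_contains_ball by blast
  obtain r0 where r0: "r0 > 0" "cball y r0 \<subseteq> \<Omega>"
    using \<Omega> y open_contains_cball by blast
  define T where "T = (closure \<Omega> - ball y r0) \<inter> h -` {c..}"
  have "closed T" unfolding T_def
    by (intro continuous_closed_preimage continuous_on_subset[OF cont]) (use r0 in auto)
  moreover have "bounded T"
    using bounded_closure[OF \<Omega>(2)] by (rule bounded_subset) (auto simp: T_def)
  ultimately have cpt: "compact (T \<union> cball y r0 \<union> {x})"
    by (intro compact_Un) (auto simp: compact_eq_bounded_closed)
  have disj: "(T \<union> cball y r0 \<union> {x}) \<inter> A = {}"
  proof -
    have "z \<notin> A" if "z \<in> T" for z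
    proof
      assume "z \<in> A"
      with that have "z \<in> frontier \<Omega>"
        using \<Omega>(1) by (auto simp: T_def A_def frontier_def interior_open)
      then have "h z = 0" using g1 g2 by (simp add: h_def is_green_with_pole_def)
      with that c show False by (simp add: T_def)
    qed
    then show ?thesis using r0(2) x by (auto simp: A_def)
  qed
  obtain d where "d > 0" and d': "\<forall>z\<in>T \<union> cball y r0 \<union> {x}. \<forall>a\<in>A. d \<le> dist z a"
    using separate_compact_closed[OF cpt A(1) disj] by auto
  then have d: "d > 0" by simp
  have d_inf: "d \<le> infdist z A" if "z \<in> T \<union> cball y r0 \<union> {x}" for z
    unfolding infdist_notempty[OF A(2)] by (rule cINF_greatest[OF A(2)]) (rule d'[THEN bspec, THEN bspec, OF that])
  \<comment> \<open>points within \<open>\<delta>\<close> of the boundary of \<open>K\<close> are at distance at most \<open>3 \<delta> < d\<close> from the complement\<close>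
  define \<delta> where "\<delta> = min (d / 4) (r1 / 2)"
  have \<delta>: "\<delta> > 0" "\<delta> \<le> d / 4" "\<delta> < r1" using d r1 by (auto simp: \<delta>_def)
  define K' where "K' = {z. \<delta> \<le> infdist z A}"
  define K where "K = {z. 2 * \<delta> \<le> infdist z A}"
  have K'\<Omega>: "K' \<subseteq> \<Omega>" using \<delta> infdist_pos by (force simp: K'_def)
  have KK': "K \<subseteq> K'" using \<delta> by (auto simp: K_def K'_def)
  have compact_level: "compact {z. e \<le> infdist z A}" if "e > 0" for e
  proof -
    have "closed {z. e \<le> infdist z A}"
      by (intro closed_Collect_le continuous_intros)
    moreover have "{z. e \<le> infdist z A} \<subseteq> \<Omega>" using that infdist_pos by force
    ultimately show ?thesis
      using bounded_subset[OF \<Omega>(2)] by (simp add: compact_eq_bounded_closed)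
  qed
  have K'c: "compact K'" and Kc: "compact K"
    using compact_level \<delta> by (auto simp: K_def K'_def)
  have sub: "cball z \<delta> \<subseteq> K'" if "z \<in> K" for z
  proof
    fix w assume "w \<in> cball z \<delta>"
    with that infdist_triangle[of z A w] show "w \<in> K'" by (auto simp: K_def K'_def)
  qed
  have xK: "x \<in> K" using d_inf[of x] \<delta> d by (auto simp: K_def)
  define hh where "hh z = indicator K' z * h z" for z
  have int_g: "integrable lebesgue (\<lambda>z. indicator K' z * g1 z)" "integrable lebesgue (\<lambda>z. indicator K' z * g2 z)"
    using g1 g2 K'c K'\<Omega> by (auto simp: is_green_with_pole_def set_integrable_def)
  then have hh: "integrable lebesgue hh"
    unfolding hh_def h_def by (simp add: right_diff_distrib)
  let ?u = "mollify hh \<delta>" and ?I = "moll_mass TYPE('n) \<delta>"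
  have I: "?I > 0" by (rule moll_mass_pos[OF \<delta>(1)])
  have harmonic: "(LINT z|lebesgue. hh z * laplacian (\<lambda>z. moll \<delta> 0 ((z - a) \<bullet> (z - a))) z) = 0" if a: "a \<in> K" for a
  proof -
    let ?\<phi> = "\<lambda>z. moll \<delta> 0 ((z - a) \<bullet> (z - a))"
    have test: "test_function \<Omega> ?\<phi>"
      by (rule test_function_moll) (use \<delta> sub[OF a] K'\<Omega> in auto)
    have zero: "laplacian ?\<phi> z = 0" if "z \<notin> cball a \<delta>" for z
    proof (rule laplacian_eq_0[of "- cball a \<delta>"])
      show "z \<in> - cball a \<delta>" using that by simp
      fix w assume "w \<in> - cball a \<delta>"
      then have "\<not> (w - a) \<bullet> (w - a) < \<delta>\<^sup>2"
        using norm_less_power2_iff[OF \<delta>(1), of "w - a"] by (simp add: dist_norm norm_minus_commute)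
      then show "?\<phi> w = 0" by (intro moll_eq_0) simp
    qed auto
    have out: "laplacian ?\<phi> z = 0" if "z \<notin> K'" for z
      using that sub[OF a] by (intro zero) auto
    have cont\<Delta>: "continuous_on UNIV (laplacian ?\<phi>)"
      by (intro laplacian_continuous Ck_radial moll_has_derivative)
    have supp\<Delta>: "laplacian ?\<phi> z = 0" if "norm a + \<delta> < norm z" for z
    proof (rule zero)
      show "z \<notin> cball a \<delta>"
        using that norm_triangle_ineq2[of z a] by (auto simp: dist_norm norm_minus_commute)
    qed
    obtain B where B: "\<And>z. \<bar>laplacian ?\<phi> z\<bar> \<le> B"
      using bounded_compact_support[OF cont\<Delta> supp\<Delta>] by metis
    have meas\<Delta>: "laplacian ?\<phi> \<in> borel_measurable lebesgue"
      using cont\<Delta> by (simp add: borel_measurable_continuous_onI measurable_completion)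
    have int: "(LINT z|lebesgue. (indicator K' z * g z) * laplacian ?\<phi> z) = - ?\<phi> y"
      if "is_green_with_pole \<Omega> y g" for g
    proof -
      have 1: "(LINT z:\<Omega>|lebesgue. g z * (- laplacian ?\<phi> z)) = ?\<phi> y"
        using that test by (simp add: is_green_with_pole_def)
      have 2: "(\<lambda>z. indicator \<Omega> z *\<^sub>R (g z * (- laplacian ?\<phi> z)))
          = (\<lambda>z. - ((indicator K' z * g z) * laplacian ?\<phi> z))"
        using out K'\<Omega> by (fastforce simp: fun_eq_iff indicator_def)
      show ?thesis using 1 unfolding set_lebesgue_integral_def 2 by simp
    qed
    have "(LINT z|lebesgue. hh z * laplacian ?\<phi> z)
      = (LINT z|lebesgue. (indicator K' z * g1 z) * laplacian ?\<phi> z - (indicator K' z * g2 z) * laplacian ?\<phi> z)"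
      by (simp add: hh_def h_def algebra_simps)
    also have "\<dots> = 0"
      using integrable_mult_bounded[OF int_g(1) meas\<Delta> B] integrable_mult_bounded[OF int_g(2) meas\<Delta> B]
        int[OF g1] int[OF g2] by simp
    finally show ?thesis .
  qed
  obtain R where R: "\<And>z. z \<in> \<Omega> \<Longrightarrow> norm z \<le> R" using \<Omega>(2) by (auto simp: bounded_iff)
  \<comment> \<open>\<open>\<kappa> |x|\<^sup>2\<close> stays below the gap \<open>c ?I\<close> between the two bounds on the mollification\<close>
  define \<kappa> where "\<kappa> = c * ?I / (R\<^sup>2 + 1)"
  have "R\<^sup>2 + 1 > 0" by (simp add: add_nonneg_pos)
  then have \<kappa>: "\<kappa> > 0" "\<kappa> * R\<^sup>2 < c * ?I"
    using c I by (simp_all add: \<kappa>_def field_simps)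
  define v where "v z = ?u z + \<kappa> * (z \<bullet> z)" for z
  have "continuous_on K v"
    unfolding v_def
    by (intro continuous_intros continuous_on_subset[OF continuous_mollify[OF hh \<delta>(1)]]) auto
  then obtain x0 where x0: "x0 \<in> K" "\<And>z. z \<in> K \<Longrightarrow> v z \<le> v x0"
    using continuous_attains_sup[OF Kc] xK by blast
  show False
  proof (cases "infdist x0 A > 2 * \<delta>")
    case True
    show False
    proof (rule mollify_no_interior_max[OF hh \<delta>(1) harmonic[OF x0(1)] \<kappa>(1)])
      show "0 < infdist x0 A - 2 * \<delta>" using True by simp
      fix x' assume "x' \<in> ball x0 (infdist x0 A - 2 * \<delta>)"
      with infdist_triangle[of x0 A x'] have "x' \<in> K" by (auto simp: K_def)
      then show "?u x' + \<kappa> * (x' \<bullet> x') \<le> ?u x0 + \<kappa> * (x0 \<bullet> x0)"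
        using x0(2) by (simp add: v_def)
    qed
  next
    case False
    have "?u x0 \<le> c * ?I"
    proof (rule mollify_upper[OF hh \<delta>(1)])
      fix z assume z: "z \<in> cball x0 \<delta>"
      then have "z \<in> K'" using sub[OF x0(1)] by auto
      have "infdist z A \<le> 3 * \<delta>"
        using False z infdist_triangle[of z A x0] by (auto simp: dist_commute)
      then have "infdist z A < d" using \<delta> d by simp
      then have "z \<notin> T \<union> cball y r0 \<union> {x}" using d_inf[of z] by auto
      then have "h z < c"
        using \<open>z \<in> K'\<close> K'\<Omega> closure_subset[of \<Omega>] by (auto simp: T_def)
      then show "hh z \<le> c" using \<open>z \<in> K'\<close> by (simp add: hh_def)
    qed
    moreover have "x0 \<bullet> x0 \<le> R\<^sup>2"
      using R[of x0] x0(1) KK' K'\<Omega> by (auto simp: power2_norm_eq_inner[symmetric] intro!: power_mono)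
    then have "\<kappa> * (x0 \<bullet> x0) \<le> \<kappa> * R\<^sup>2" using \<kappa>(1) by simp
    ultimately have "v x0 < 2 * c * ?I" using \<kappa>(2) by (simp add: v_def)
    moreover have "2 * c * ?I \<le> ?u x"
    proof (rule mollify_lower[OF hh \<delta>(1)])
      fix z assume z: "z \<in> cball x \<delta>"
      then have "z \<in> K'" using sub[OF xK] by auto
      moreover have "z \<in> ball x r1" using z \<delta> by auto
      then have "2 * c < h z" using r1(2) by auto
      ultimately show "2 * c \<le> hh z" by (simp add: hh_def)
    qed
    moreover have "?u x \<le> v x" using \<kappa>(1) by (simp add: v_def)
    ultimately show False using x0(2)[OF xK] by simp
  qed
qed

lemma green_unique:
  fixes \<Omega> :: "(real^'n::finite) set"
  assumes "open \<Omega>" "bounded \<Omega>" "y \<in> \<Omega>" "is_green_with_pole \<Omega> y g" "x \<in> \<Omega>" "x \<noteq> y"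
  shows "green \<Omega> x y = g x"
proof -
  have "is_green_with_pole \<Omega> y (SOME g. is_green_with_pole \<Omega> y g)"
    by (rule someI[where P="is_green_with_pole \<Omega> y" and x=g]) (rule assms(4))
  then show ?thesis
    unfolding green_def using green_le assms by (intro antisym) blast+
qed


section \<open>The Green function of the annulus by images\<close>

text \<open>
  The potential at \<open>x\<close> of a charge at \<open>(b / a) y\<close>, rescaled so that the images at very large and at very
  small distance are treated alike.
\<close>
definition image_kernel :: "real \<Rightarrow> real \<Rightarrow> real \<Rightarrow> real^'n::finite \<Rightarrow> real^'n \<Rightarrow> real" where
  "image_kernel e a b y x = (e / norm (a *\<^sub>R x - b *\<^sub>R y)) ^ (CARD('n) - 2)"

text \<open>
  With \<open>r = |x|\<close> and \<open>R = |y|\<close>, the zonal expansion of the regular part has the coefficients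
  \<open>\<rho>\<^sup>l\<^sup>\<sigma> (r\<^sup>\<sigma> R\<^sup>\<sigma> - (\<rho> r)\<^sup>\<sigma> + \<rho>\<^sup>\<sigma> - (\<rho> R)\<^sup>\<sigma>) / (r R)\<^sup>n\<^sup>+\<^sup>m\<close> summed over \<open>l\<close>; each of the four geometric families
  resums by the generating function of the Gegenbauer polynomials to one Newtonian potential.
  The first two charges lie outside the unit ball, the last two inside the ball of radius \<open>\<rho>\<close>.
\<close>
definition image_term :: "real \<Rightarrow> real^'n::finite \<Rightarrow> nat \<Rightarrow> real^'n \<Rightarrow> real" where
  "image_term \<rho> y l x =
     image_kernel (\<rho> ^ l * norm y) (\<rho> ^ (2 * l) * (norm y)\<^sup>2) 1 y x
     - image_kernel (\<rho> ^ (l + 1)) (\<rho> ^ (2 * l + 2)) 1 y x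
     + image_kernel (\<rho> ^ (l + 1) * norm y) ((norm y)\<^sup>2) (\<rho> ^ (2 * l + 2)) y x
     - image_kernel (\<rho> ^ (l + 1)) 1 (\<rho> ^ (2 * l + 2)) y x"

definition image_sum :: "real \<Rightarrow> real^'n::finite \<Rightarrow> real^'n \<Rightarrow> real" where
  "image_sum \<rho> y x = (\<Sum>l. image_term \<rho> y l x)"

definition annulus_green :: "real \<Rightarrow> real^'n::finite \<Rightarrow> real^'n \<Rightarrow> real" where
  "annulus_green \<rho> y x = fund_sol x y
     - 1 / (sphere_area TYPE('n) * (real CARD('n) - 2)) * image_sum \<rho> y x"

lemma test_functionD:
  assumes "test_function \<Omega> \<phi>"
  shows "Ck 2 \<phi>" "\<exists>R. \<forall>x. R < norm x \<longrightarrow> \<phi> x = 0" "\<And>x. x \<notin> \<Omega> \<Longrightarrow> \<phi> x = 0"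
    "\<And>x. x \<notin> \<Omega> \<Longrightarrow> laplacian \<phi> x = 0"
proof -
  let ?S = "closure {x. \<phi> x \<noteq> 0}"
  have t: "smooth \<phi>" "compact ?S" "?S \<subseteq> \<Omega>"
    using assms by (auto simp: test_function_def)
  show "Ck 2 \<phi>" using t by (simp add: smooth_def)
  obtain R where "\<forall>x\<in>?S. norm x \<le> R" using compact_imp_bounded[OF t(2)] by (auto simp: bounded_iff)
  moreover have out: "\<phi> x = 0" if "x \<notin> ?S" for x
    using that closure_subset[of "{x. \<phi> x \<noteq> 0}"] by auto
  ultimately show "\<exists>R. \<forall>x. R < norm x \<longrightarrow> \<phi> x = 0" by (meson not_le)
  have off: "x \<notin> ?S" if "x \<notin> \<Omega>" for x
    using that subsetD[OF t(3)] by (rule contrapos_nn)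
  show "\<phi> x = 0" if "x \<notin> \<Omega>" for x
    by (rule out[OF off[OF that]])
  show "laplacian \<phi> x = 0" if "x \<notin> \<Omega>" for x
  proof (rule laplacian_eq_0[of "- ?S"])
    show "x \<in> - ?S" using off[OF that] unfolding Compl_iff .
  qed (auto intro!: out)
qed

lemma test_function_support:
  assumes "test_function \<Omega> \<phi>"
  shows "\<exists>R. (\<forall>x. R < norm x \<longrightarrow> \<phi> x = 0) \<and> (\<forall>x. R < norm x \<longrightarrow> laplacian \<phi> x = 0)"
    and "continuous_on UNIV (laplacian \<phi>)"
proof -
  obtain R where R: "\<And>x. R < norm x \<Longrightarrow> \<phi> x = 0"
    using test_functionD(2)[OF assms] by blast
  have "laplacian \<phi> x = 0" if "R < norm x" for x
    by (rule laplacian_eq_0[of "- cball 0 R"]) (use that R in \<open>auto simp: dist_norm\<close>)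
  with R show "\<exists>R. (\<forall>x. R < norm x \<longrightarrow> \<phi> x = 0) \<and> (\<forall>x. R < norm x \<longrightarrow> laplacian \<phi> x = 0)"
    by blast
  show "continuous_on UNIV (laplacian \<phi>)"
    by (rule laplacian_continuous[OF test_functionD(1)[OF assms]])
qed

lemma image_kernel_integrable:
  fixes y :: "real^'n::finite"
  assumes N3: "CARD('n) \<ge> 3" and a: "a > 0"
    and g: "continuous_on UNIV g" "\<And>x. R < norm x \<Longrightarrow> g x = 0"
  shows "integrable lborel (\<lambda>x. image_kernel e a b y x * g x)"
    and "(LINT x|lborel. image_kernel e a b y x * g x)
      = (e / a) ^ (CARD('n) - 2) * (LINT x|lborel. 1 / norm (x - (b / a) *\<^sub>R y) ^ (CARD('n) - 2) * g x)"
proof -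
  have "image_kernel e a b y x * g x = (e / a) ^ (CARD('n) - 2) * (1 / norm (x - (b / a) *\<^sub>R y) ^ (CARD('n) - 2) * g x)" for x
  proof -
    have "a *\<^sub>R x - b *\<^sub>R y = a *\<^sub>R (x - (b / a) *\<^sub>R y)"
      using a by (simp add: algebra_simps)
    then have "norm (a *\<^sub>R x - b *\<^sub>R y) = a * norm (x - (b / a) *\<^sub>R y)"
      using a by simp
    then show ?thesis by (simp add: image_kernel_def power_divide power_mult_distrib)
  qed
  then have eq: "(\<lambda>x. image_kernel e a b y x * g x)
      = (\<lambda>x. (e / a) ^ (CARD('n) - 2) * (1 / norm (x - (b / a) *\<^sub>R y) ^ (CARD('n) - 2) * g x))"
    by (rule ext)
  have "integrable lborel (\<lambda>x. 1 / norm (x - (b / a) *\<^sub>R y) ^ (CARD('n) - 2) * g x)"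
    by (rule integrable_riesz_kernel_mult[OF _ _ g]) (use N3 in auto)
  then show "integrable lborel (\<lambda>x. image_kernel e a b y x * g x)"
    unfolding eq by (rule integrable_mult_right)
  show "(LINT x|lborel. image_kernel e a b y x * g x)
      = (e / a) ^ (CARD('n) - 2) * (LINT x|lborel. 1 / norm (x - (b / a) *\<^sub>R y) ^ (CARD('n) - 2) * g x)"
    unfolding eq by (rule integral_mult_right_zero)
qed

lemma image_kernel_weakly_harmonic:
  fixes y :: "real^'n::finite"
  assumes N3: "CARD('n) \<ge> 3" and a: "a > 0" and \<phi>: "test_function \<Omega> \<phi>"
    and off: "\<And>x. x \<in> \<Omega> \<Longrightarrow> a *\<^sub>R x \<noteq> b *\<^sub>R y"
  shows "(LINT x|lborel. image_kernel e a b y x * laplacian \<phi> x) = 0"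
proof -
  obtain R where R: "\<And>x. R < norm x \<Longrightarrow> \<phi> x = 0"
    and supp\<Delta>: "\<And>x. R < norm x \<Longrightarrow> laplacian \<phi> x = 0"
    using test_function_support(1)[OF \<phi>] by blast
  note c\<Delta> = test_function_support(2)[OF \<phi>]
  have "(b / a) *\<^sub>R y \<notin> \<Omega>"
  proof
    assume "(b / a) *\<^sub>R y \<in> \<Omega>"
    from off[OF this] a show False by simp
  qed
  then have "\<phi> ((b / a) *\<^sub>R y) = 0" by (rule test_functionD(3)[OF \<phi>])
  then show ?thesis
    using image_kernel_integrable(2)[OF N3 a c\<Delta> supp\<Delta>]
      riesz_laplacian[OF N3 test_functionD(1)[OF \<phi>] R] by simp
qed

lemma norm_eq_mult_normI:
  fixes u v :: "'a::real_inner"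
  assumes "u \<bullet> u = c\<^sup>2 * (v \<bullet> v)" "c \<ge> 0"
  shows "norm u = c * norm v"
proof (rule power2_eq_imp_eq)
  show "(norm u)\<^sup>2 = (c * norm v)\<^sup>2"
    using assms(1) by (simp add: power2_norm_eq_inner power_mult_distrib)
qed (use assms(2) in auto)

lemma inner_combination:
  fixes x y :: "'a::real_inner"
  shows "(a *\<^sub>R x - b *\<^sub>R y) \<bullet> (a *\<^sub>R x - b *\<^sub>R y) = a\<^sup>2 * (norm x)\<^sup>2 - 2 * a * b * (x \<bullet> y) + b\<^sup>2 * (norm y)\<^sup>2"
  unfolding power2_norm_eq_inner by (simp add: inner_diff inner_commute power2_eq_square algebra_simps)

text \<open>
  The identities between images on the boundary spheres are all of this kind: the two
  squared distances are proportional as quadratic forms once \<open>|x|\<close> is fixed.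
\<close>
lemma image_kernel_cong:
  fixes x y :: "real^'n::finite"
  assumes "(a *\<^sub>R x - b *\<^sub>R y) \<bullet> (a *\<^sub>R x - b *\<^sub>R y) = c\<^sup>2 * ((a' *\<^sub>R x - b' *\<^sub>R y) \<bullet> (a' *\<^sub>R x - b' *\<^sub>R y))"
    and "c > 0" "e = c * e'"
  shows "image_kernel e a b y x = image_kernel e' a' b' y x"
  using norm_eq_mult_normI[OF assms(1)] assms(2,3) by (simp add: image_kernel_def)

context
  fixes \<rho> :: real and y :: "real^'n::finite"
  assumes N3: "CARD('n) \<ge> 3" and \<rho>: "0 < \<rho>" "\<rho> < 1" and y: "\<rho> < norm y" "norm y < 1"
begin

text \<open>
  A common lower bound for the distances, in the scaling of \<open>image_kernel\<close>, from the closed annulus to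
  all images.
\<close>
private definition sep where
  "sep = min (norm y - (norm y)\<^sup>2) (min (norm y - \<rho>\<^sup>2) (min (norm y * \<rho> * (norm y - \<rho>)) (\<rho> - \<rho>\<^sup>2)))"

private lemma y0: "norm y > 0" using \<rho> y by linarith

private lemma sep_pos: "sep > 0"
proof -
  have "norm y * norm y < norm y" "\<rho> * \<rho> < \<rho>" using y0 y \<rho> by simp_all
  moreover have "\<rho> * \<rho> < norm y" using \<open>\<rho> * \<rho> < \<rho>\<close> y by linarith
  ultimately show ?thesis using y0 \<rho> y by (simp add: sep_def power2_eq_square)
qed

private lemma sep_le:
  "sep \<le> norm y - (norm y)\<^sup>2" "sep \<le> norm y - \<rho>\<^sup>2" "sep \<le> norm y * \<rho> * (norm y - \<rho>)" "sep \<le> \<rho> - \<rho>\<^sup>2"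
  unfolding sep_def by simp_all

private lemma dist_bounds:
  assumes x: "\<rho> \<le> norm x" "norm x \<le> 1"
  shows "sep \<le> norm ((\<rho> ^ (2 * l) * (norm y)\<^sup>2) *\<^sub>R x - 1 *\<^sub>R y)"
    and "sep \<le> norm (\<rho> ^ (2 * l + 2) *\<^sub>R x - 1 *\<^sub>R y)"
    and "sep \<le> norm ((norm y)\<^sup>2 *\<^sub>R x - \<rho> ^ (2 * l + 2) *\<^sub>R y)"
    and "sep \<le> norm (1 *\<^sub>R x - \<rho> ^ (2 * l + 2) *\<^sub>R y)"
proof -
  have n1: "norm (1 *\<^sub>R y) = norm y" and n2: "norm (1 *\<^sub>R x) = norm x" by simp_all
  have p: "0 \<le> \<rho> ^ (2 * l)" "\<rho> ^ (2 * l) \<le> 1" using \<rho> by (auto simp: power_le_one)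
  have p2: "0 \<le> \<rho> ^ (2 * l + 2)" "\<rho> ^ (2 * l + 2) \<le> \<rho>\<^sup>2"
    using mult_right_mono[OF p(2), of "\<rho>\<^sup>2"] \<rho> unfolding power_add by simp_all
  have "norm ((\<rho> ^ (2 * l) * (norm y)\<^sup>2) *\<^sub>R x) \<le> (norm y)\<^sup>2"
  proof -
    have "\<rho> ^ (2 * l) * norm x \<le> 1 * 1" using p x by (intro mult_mono) auto
    from mult_right_mono[OF this, of "(norm y)\<^sup>2"] show ?thesis
      using p by (simp add: mult_ac)
  qed
  then show "sep \<le> norm ((\<rho> ^ (2 * l) * (norm y)\<^sup>2) *\<^sub>R x - 1 *\<^sub>R y)"
    using norm_triangle_ineq3[of "(\<rho> ^ (2 * l) * (norm y)\<^sup>2) *\<^sub>R x" "1 *\<^sub>R y"] sep_le(1) by auto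
  have "norm (\<rho> ^ (2 * l + 2) *\<^sub>R x) \<le> \<rho>\<^sup>2"
    using mult_mono[OF p2(2) x(2)] p2 \<rho> by simp
  then show "sep \<le> norm (\<rho> ^ (2 * l + 2) *\<^sub>R x - 1 *\<^sub>R y)"
    using norm_triangle_ineq3[of "\<rho> ^ (2 * l + 2) *\<^sub>R x" "1 *\<^sub>R y"] sep_le(2) n1 by linarith
  have p3: "norm (\<rho> ^ (2 * l + 2) *\<^sub>R y) \<le> \<rho>\<^sup>2 * norm y"
    using mult_right_mono[OF p2(2), of "norm y"] p2 by simp
  moreover have "norm y * \<rho> * norm y \<le> norm ((norm y)\<^sup>2 *\<^sub>R x)"
    using mult_right_mono[OF x(1), of "(norm y)\<^sup>2"] by (simp add: power2_eq_square mult_ac)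
  moreover have "norm y * \<rho> * (norm y - \<rho>) = norm y * \<rho> * norm y - \<rho>\<^sup>2 * norm y"
    by (simp add: power2_eq_square algebra_simps)
  ultimately show "sep \<le> norm ((norm y)\<^sup>2 *\<^sub>R x - \<rho> ^ (2 * l + 2) *\<^sub>R y)"
    using norm_triangle_ineq3[of "(norm y)\<^sup>2 *\<^sub>R x" "\<rho> ^ (2 * l + 2) *\<^sub>R y"] sep_le(3) by linarith
  have "\<rho>\<^sup>2 * norm y \<le> \<rho>\<^sup>2" using mult_left_mono[of "norm y" 1 "\<rho>\<^sup>2"] y by simp
  with p3 x(1) show "sep \<le> norm (1 *\<^sub>R x - \<rho> ^ (2 * l + 2) *\<^sub>R y)"
    using norm_triangle_ineq3[of "1 *\<^sub>R x" "\<rho> ^ (2 * l + 2) *\<^sub>R y"] sep_le(4) n2 by linarith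
qed

private lemma kernel_bound:
  assumes "sep \<le> norm (a *\<^sub>R x - b *\<^sub>R y)" "0 \<le> e" "e \<le> \<rho> ^ l"
  shows "\<bar>image_kernel e a b y x\<bar> \<le> (\<rho> ^ (CARD('n) - 2)) ^ l / sep ^ (CARD('n) - 2)"
proof -
  have "e / norm (a *\<^sub>R x - b *\<^sub>R y) \<le> \<rho> ^ l / sep"
    using assms sep_pos \<rho> by (intro frac_le) auto
  then have "(e / norm (a *\<^sub>R x - b *\<^sub>R y)) ^ (CARD('n) - 2) \<le> (\<rho> ^ l / sep) ^ (CARD('n) - 2)"
    using assms by (intro power_mono) auto
  then show ?thesis
    using assms unfolding image_kernel_def power_divide
    by (simp add: power_mult[symmetric] mult.commute)
qed

private lemma coeff_bounds: "\<rho> ^ l * norm y \<le> \<rho> ^ l" "\<rho> ^ (l + 1) \<le> \<rho> ^ l" "\<rho> ^ (l + 1) * norm y \<le> \<rho> ^ l"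
proof -
  show 1: "\<rho> ^ l * norm y \<le> \<rho> ^ l" for l using mult_left_mono[of "norm y" 1 "\<rho> ^ l"] y \<rho> by simp
  show 2: "\<rho> ^ (l + 1) \<le> \<rho> ^ l" using \<rho> by (intro power_decreasing) auto
  show "\<rho> ^ (l + 1) * norm y \<le> \<rho> ^ l" using 1[of "l + 1"] 2 by linarith
qed

private lemma image_term_bound:
  assumes x: "\<rho> \<le> norm x" "norm x \<le> 1"
  shows "\<bar>image_term \<rho> y l x\<bar> \<le> 4 / sep ^ (CARD('n) - 2) * (\<rho> ^ (CARD('n) - 2)) ^ l"
proof -
  have e: "0 \<le> \<rho> ^ l * norm y" "0 \<le> \<rho> ^ (l + 1)" "0 \<le> \<rho> ^ (l + 1) * norm y" for l
    using \<rho> by auto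
  note b = kernel_bound[OF dist_bounds(1)[OF x] e(1) coeff_bounds(1), of l l]
    kernel_bound[OF dist_bounds(2)[OF x] e(2) coeff_bounds(2), of l l]
    kernel_bound[OF dist_bounds(3)[OF x] e(3) coeff_bounds(3), of l l]
    kernel_bound[OF dist_bounds(4)[OF x] e(2) coeff_bounds(2), of l l]
  have "\<bar>image_term \<rho> y l x\<bar> \<le> 4 * ((\<rho> ^ (CARD('n) - 2)) ^ l / sep ^ (CARD('n) - 2))"
    unfolding image_term_def using b by linarith
  then show ?thesis by simp
qed

private lemma summable_bound: "summable (\<lambda>l. 4 / sep ^ (CARD('n) - 2) * (\<rho> ^ (CARD('n) - 2)) ^ l)"
  using \<rho> N3 by (intro summable_mult summable_geometric) (auto simp: power_less_one_iff)

lemma summable_image_term: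
  assumes x: "\<rho> \<le> norm x" "norm x \<le> 1"
  shows "summable (\<lambda>l. image_term \<rho> y l x)"
  by (rule summable_comparison_test'[OF summable_bound, of 0]) (use image_term_bound[OF x] in simp)

lemma continuous_on_image_term: "continuous_on {x. \<rho> \<le> norm x \<and> norm x \<le> 1} (image_term \<rho> y l)"
proof -
  have k: "continuous_on {x. \<rho> \<le> norm x \<and> norm x \<le> 1} (image_kernel e a b y)"
    if "\<And>x. \<rho> \<le> norm x \<Longrightarrow> norm x \<le> 1 \<Longrightarrow> sep \<le> norm (a *\<^sub>R x - b *\<^sub>R y)" for e a b
    unfolding image_kernel_def
    by (intro continuous_intros) (use that sep_pos in fastforce)
  show ?thesis
    unfolding image_term_def[abs_def] by (intro continuous_intros k dist_bounds)
qed

lemma continuous_on_image_sum: "continuous_on {x. \<rho> \<le> norm x \<and> norm x \<le> 1} (image_sum \<rho> y)"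
proof (rule uniform_limit_theorem)
  show "uniform_limit {x. \<rho> \<le> norm x \<and> norm x \<le> 1} (\<lambda>n x. \<Sum>l<n. image_term \<rho> y l x) (image_sum \<rho> y) sequentially"
    unfolding image_sum_def[abs_def]
    by (rule Weierstrass_m_test[OF _ summable_bound]) (use image_term_bound in auto)
  show "\<forall>\<^sub>F n in sequentially. continuous_on {x. \<rho> \<le> norm x \<and> norm x \<le> 1} (\<lambda>x. \<Sum>l<n. image_term \<rho> y l x)"
    by (intro always_eventually allI continuous_intros continuous_on_image_term)
qed simp

private lemma kernel_tendsto_0:
  assumes "\<And>l. sep \<le> norm (a l *\<^sub>R x - b l *\<^sub>R y)" "\<And>l. 0 \<le> e l" "\<And>l. e l \<le> \<rho> ^ l"
  shows "(\<lambda>l. image_kernel (e l) (a l) (b l) y x) \<longlonglongrightarrow> 0"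
proof (rule Lim_null_comparison)
  show "\<forall>\<^sub>F l in sequentially. norm (image_kernel (e l) (a l) (b l) y x) \<le> (\<rho> ^ (CARD('n) - 2)) ^ l / sep ^ (CARD('n) - 2)"
    using kernel_bound[OF assms] by simp
  have "(\<lambda>l. (\<rho> ^ (CARD('n) - 2)) ^ l / sep ^ (CARD('n) - 2)) \<longlonglongrightarrow> 0 / sep ^ (CARD('n) - 2)"
    using \<rho> N3 by (intro tendsto_divide tendsto_const LIMSEQ_power_zero) (use sep_pos in \<open>auto simp: power_less_one_iff\<close>)
  then show "(\<lambda>l. (\<rho> ^ (CARD('n) - 2)) ^ l / sep ^ (CARD('n) - 2)) \<longlonglongrightarrow> 0" by simp
qed

text \<open>
  On the unit sphere the second and third families cancel term by term, and the fourth family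
  is the first one shifted by one index.
\<close>
lemma image_sum_outer_boundary:
  assumes x: "norm x = 1"
  shows "image_sum \<rho> y x = 1 / norm (x - y) ^ (CARD('n) - 2)"
proof -
  have x': "\<rho> \<le> norm x" "norm x \<le> 1" using x \<rho> by auto
  define w where "w l = image_kernel (\<rho> ^ l) 1 (\<rho> ^ (2 * l)) y x" for l
  have t1: "image_kernel (\<rho> ^ l * norm y) (\<rho> ^ (2 * l) * (norm y)\<^sup>2) 1 y x = w l" for l
    unfolding w_def
    by (rule image_kernel_cong[where c="norm y"], unfold inner_combination x)
      (use y0 in \<open>auto simp: power2_eq_square algebra_simps\<close>)
  have t3: "image_kernel (\<rho> ^ (l + 1) * norm y) ((norm y)\<^sup>2) (\<rho> ^ (2 * l + 2)) y x
      = image_kernel (\<rho> ^ (l + 1)) (\<rho> ^ (2 * l + 2)) 1 y x" for l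
    by (rule image_kernel_cong[where c="norm y"], unfold inner_combination x)
      (use y0 in \<open>auto simp: power2_eq_square algebra_simps\<close>)
  have "image_term \<rho> y l x = w l - w (Suc l)" for l
    unfolding image_term_def t1 t3 by (simp add: w_def)
  moreover have "w \<longlonglongrightarrow> 0"
    unfolding t1[symmetric] using \<rho> by (intro kernel_tendsto_0 dist_bounds x' coeff_bounds) auto
  ultimately have "(\<lambda>l. image_term \<rho> y l x) sums (w 0 - 0)"
    using telescope_sums'[of w 0] by simp
  then show ?thesis
    by (simp add: image_sum_def sums_iff w_def image_kernel_def power_divide)
qed

text \<open>
  On the sphere of radius \<open>\<rho>\<close> it is the first and fourth families that cancel, and the second
  is the shift of the third.
\<close>
lemma image_sum_inner_boundary:
  assumes x: "norm x = \<rho>"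
  shows "image_sum \<rho> y x = 1 / norm (x - y) ^ (CARD('n) - 2)"
proof -
  have x': "\<rho> \<le> norm x" "norm x \<le> 1" using x \<rho> by auto
  define w where "w l = image_kernel (\<rho> ^ l) (\<rho> ^ (2 * l)) 1 y x" for l
  have t1: "image_kernel (\<rho> ^ l * norm y) (\<rho> ^ (2 * l) * (norm y)\<^sup>2) 1 y x
      = image_kernel (\<rho> ^ (l + 1)) 1 (\<rho> ^ (2 * l + 2)) y x" for l
    by (rule image_kernel_cong[where c="norm y / \<rho>"], unfold inner_combination x)
      (use y0 \<rho> in \<open>auto simp: power2_eq_square field_simps\<close>)
  have t3: "image_kernel (\<rho> ^ (l + 1) * norm y) ((norm y)\<^sup>2) (\<rho> ^ (2 * l + 2)) y x = w l" for l
    unfolding w_def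
    by (rule image_kernel_cong[where c="norm y * \<rho>"], unfold inner_combination x)
      (use y0 \<rho> in \<open>auto simp: power2_eq_square algebra_simps\<close>)
  have "image_term \<rho> y l x = w l - w (Suc l)" for l
    unfolding image_term_def t1 t3 by (simp add: w_def)
  moreover have "w \<longlonglongrightarrow> 0"
    unfolding t3[symmetric] using \<rho> by (intro kernel_tendsto_0 dist_bounds x' coeff_bounds) auto
  ultimately have "(\<lambda>l. image_term \<rho> y l x) sums (w 0 - 0)"
    using telescope_sums'[of w 0] by simp
  then show ?thesis
    by (simp add: image_sum_def sums_iff w_def image_kernel_def power_divide)
qed

lemma image_term_weakly_harmonic:
  assumes \<phi>: "test_function (annulus \<rho>) \<phi>"
  shows "integrable lborel (\<lambda>x. image_term \<rho> y l x * laplacian \<phi> x)"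
    and "(LINT x|lborel. image_term \<rho> y l x * laplacian \<phi> x) = 0"
proof -
  obtain R where R: "\<And>x. R < norm x \<Longrightarrow> \<phi> x = 0"
    and supp\<Delta>: "\<And>x. R < norm x \<Longrightarrow> laplacian \<phi> x = 0"
    using test_function_support(1)[OF \<phi>] by blast
  note c\<Delta> = test_function_support(2)[OF \<phi>]
  have int: "integrable lborel (\<lambda>x. image_kernel e a b y x * laplacian \<phi> x)" if "a > 0" for e a b
    by (rule image_kernel_integrable(1)[OF N3 that c\<Delta> supp\<Delta>])
  have zero: "(LINT x|lborel. image_kernel e a b y x * laplacian \<phi> x) = 0"
    if "a > 0" "\<And>x. \<rho> \<le> norm x \<Longrightarrow> norm x \<le> 1 \<Longrightarrow> sep \<le> norm (a *\<^sub>R x - b *\<^sub>R y)" for e a b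
  proof (rule image_kernel_weakly_harmonic[OF N3 that(1) \<phi>])
    fix x :: "real^'n" assume "x \<in> annulus \<rho>"
    then have "sep \<le> norm (a *\<^sub>R x - b *\<^sub>R y)" by (intro that(2)) (auto simp: annulus_def)
    then show "a *\<^sub>R x \<noteq> b *\<^sub>R y" using sep_pos by auto
  qed
  have pos: "\<rho> ^ (2 * l) * (norm y)\<^sup>2 > 0" "\<rho> ^ (2 * l + 2) > 0" "(norm y)\<^sup>2 > 0" "(1::real) > 0"
    using \<rho> y0 by auto
  note i = int[OF pos(1), of "\<rho> ^ l * norm y" 1] int[OF pos(2), of "\<rho> ^ (l + 1)" 1]
    int[OF pos(3), of "\<rho> ^ (l + 1) * norm y" "\<rho> ^ (2 * l + 2)"] int[OF pos(4), of "\<rho> ^ (l + 1)" "\<rho> ^ (2 * l + 2)"]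
  note z = zero[OF pos(1) dist_bounds(1), of "\<rho> ^ l * norm y"] zero[OF pos(2) dist_bounds(2), of "\<rho> ^ (l + 1)"]
    zero[OF pos(3) dist_bounds(3), of "\<rho> ^ (l + 1) * norm y"] zero[OF pos(4) dist_bounds(4), of "\<rho> ^ (l + 1)"]
  show "integrable lborel (\<lambda>x. image_term \<rho> y l x * laplacian \<phi> x)"
    unfolding image_term_def left_diff_distrib distrib_right
    by (intro Bochner_Integration.integrable_diff Bochner_Integration.integrable_add i)
  show "(LINT x|lborel. image_term \<rho> y l x * laplacian \<phi> x) = 0"
    unfolding image_term_def left_diff_distrib distrib_right
    using i z by (simp del: One_nat_def scaleR_one power_Suc add_2_eq_Suc add_2_eq_Suc')
qed

lemma image_sum_weakly_harmonic:
  assumes \<phi>: "test_function (annulus \<rho>) \<phi>"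
  shows "has_bochner_integral lborel (\<lambda>x. image_sum \<rho> y x * laplacian \<phi> x) 0"
proof -
  let ?n = "CARD('n) - 2"
  obtain R where R: "\<And>x. R < norm x \<Longrightarrow> \<phi> x = 0"
    and supp\<Delta>: "\<And>x. R < norm x \<Longrightarrow> laplacian \<phi> x = 0"
    using test_function_support(1)[OF \<phi>] by blast
  note c\<Delta> = test_function_support(2)[OF \<phi>]
  define C where "C = (\<Sum>l. 4 / sep ^ ?n * (\<rho> ^ ?n) ^ l)"
  let ?s = "\<lambda>k x. (\<Sum>l<k. image_term \<rho> y l x * laplacian \<phi> x)"
  have lim: "(\<lambda>k. ?s k x) \<longlonglongrightarrow> image_sum \<rho> y x * laplacian \<phi> x" for x
  proof (cases "x \<in> annulus \<rho>")
    case True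
    then have "(\<lambda>l. image_term \<rho> y l x) sums image_sum \<rho> y x"
      unfolding image_sum_def by (intro summable_sums summable_image_term) (auto simp: annulus_def)
    from sums_mult2[OF this] show ?thesis by (simp add: sums_def)
  next
    case False
    then show ?thesis by (simp add: test_functionD(4)[OF \<phi>])
  qed
  have s_int: "integrable lborel (?s k)" and s_0: "(LINT x|lborel. ?s k x) = 0" for k
    using image_term_weakly_harmonic[OF \<phi>] by simp_all
  have bound: "norm (?s k x) \<le> C * \<bar>laplacian \<phi> x\<bar>" for k x
  proof (cases "x \<in> annulus \<rho>")
    case True
    have "\<bar>\<Sum>l<k. image_term \<rho> y l x\<bar> \<le> (\<Sum>l<k. 4 / sep ^ ?n * (\<rho> ^ ?n) ^ l)"
      using True by (intro order.trans[OF sum_abs] sum_mono image_term_bound) (auto simp: annulus_def)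
    also have "\<dots> \<le> C"
      unfolding C_def using sep_pos \<rho> by (intro sum_le_suminf summable_bound) auto
    finally show ?thesis
      by (simp add: sum_distrib_right[symmetric] abs_mult mult_right_mono)
  next
    case False
    then show ?thesis by (simp add: test_functionD(4)[OF \<phi>])
  qed
  have w: "integrable lborel (\<lambda>x. C * \<bar>laplacian \<phi> x\<bar>)"
    using integrable_compact_support[OF c\<Delta> supp\<Delta>] by simp
  have meas: "?s k \<in> borel_measurable lborel" for k
    using s_int by (rule borel_measurable_integrable)
  have meas': "(\<lambda>x. image_sum \<rho> y x * laplacian \<phi> x) \<in> borel_measurable lborel"
    by (rule borel_measurable_LIMSEQ_real[OF _ meas]) (use lim in auto)
  have "integrable lborel (\<lambda>x. image_sum \<rho> y x * laplacian \<phi> x)"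
    by (rule integrable_dominated_convergence[where s="?s", OF meas' meas w]) (use lim bound in auto)
  moreover have "(\<lambda>k. LINT x|lborel. ?s k x) \<longlonglongrightarrow> (LINT x|lborel. image_sum \<rho> y x * laplacian \<phi> x)"
    by (rule integral_dominated_convergence[where s="?s", OF meas' meas w]) (use lim bound in auto)
  then have "(LINT x|lborel. image_sum \<rho> y x * laplacian \<phi> x) = 0"
    unfolding s_0 by (simp add: LIMSEQ_const_iff)
  ultimately show ?thesis by (simp add: has_bochner_integral_iff)
qed

end

lemma sphere_area_eq: "sphere_area TYPE('n::finite) = real CARD('n) * unit_ball_vol (real CARD('n))"
  by (simp add: sphere_area_def content_ball)

lemma annulus_bounds:
  "open (annulus \<rho> :: (real^'n::finite) set)" "bounded (annulus \<rho> :: (real^'n::finite) set)"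
  "closure (annulus \<rho> :: (real^'n::finite) set) \<subseteq> {x. \<rho> \<le> norm x \<and> norm x \<le> 1}"
  "frontier (annulus \<rho> :: (real^'n) set) \<subseteq> {x. norm x = \<rho> \<or> norm x = 1}"
proof -
  show o: "open (annulus \<rho> :: (real^'n) set)"
    unfolding annulus_def Collect_conj_eq
    by (intro open_Int open_Collect_less continuous_intros)
  show "bounded (annulus \<rho> :: (real^'n) set)"
    by (rule bounded_subset[of "ball 0 1"]) (auto simp: annulus_def)
  show c: "closure (annulus \<rho> :: (real^'n) set) \<subseteq> {x. \<rho> \<le> norm x \<and> norm x \<le> 1}"
  proof (rule closure_minimal)
    show "closed {x::real^'n. \<rho> \<le> norm x \<and> norm x \<le> 1}"
      unfolding Collect_conj_eq by (intro closed_Int closed_Collect_le continuous_intros)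
  qed (auto simp: annulus_def)
  show "frontier (annulus \<rho> :: (real^'n) set) \<subseteq> {x. norm x = \<rho> \<or> norm x = 1}"
    using c interior_open[OF o] by (fastforce simp: frontier_def annulus_def)
qed

lemma annulus_green_is_green:
  fixes y :: "real^'n::finite"
  assumes N3: "CARD('n) \<ge> 3" and \<rho>: "0 < \<rho>" "\<rho> < 1" and y: "y \<in> annulus \<rho>"
  shows "is_green_with_pole (annulus \<rho>) y (annulus_green \<rho> y)"
  unfolding is_green_with_pole_def
proof (intro conjI allI impI ballI)
  let ?\<Omega> = "annulus \<rho> :: (real^'n) set" and ?D = "{x::real^'n. \<rho> \<le> norm x \<and> norm x \<le> 1}"
  let ?n = "CARD('n) - 2"
  have yn: "\<rho> < norm y" "norm y < 1" using y by (auto simp: annulus_def)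
  define c0 where "c0 = 1 / (sphere_area TYPE('n) * (real CARD('n) - 2))"
  have G: "annulus_green \<rho> y x = c0 * (1 / norm (x - y) ^ ?n - image_sum \<rho> y x)" for x
    by (simp add: annulus_green_def fund_sol_def c0_def right_diff_distrib)
  note cont = continuous_on_image_sum[OF N3 \<rho> yn]
  show "continuous_on (closure ?\<Omega> - {y}) (annulus_green \<rho> y)"
    unfolding G[abs_def]
    by (intro continuous_intros continuous_on_subset[OF cont]) (use annulus_bounds(3) in auto)
  show "annulus_green \<rho> y x = 0" if "x \<in> frontier ?\<Omega>" for x
  proof -
    have "norm x = \<rho> \<or> norm x = 1" using that annulus_bounds(4) by blast
    then have "image_sum \<rho> y x = 1 / norm (x - y) ^ ?n"
      using image_sum_inner_boundary[OF N3 \<rho> yn] image_sum_outer_boundary[OF N3 \<rho> yn] by blast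
    then show ?thesis by (simp add: G)
  qed
  show "set_integrable lebesgue K (annulus_green \<rho> y)" if K: "compact K \<and> K \<subseteq> ?\<Omega>" for K
  proof -
    have sub: "K \<subseteq> ?D" "K \<subseteq> cball y 2"
    proof -
      show "K \<subseteq> ?D" using K by (auto simp: annulus_def)
      have "dist y x \<le> 2" if "x \<in> K" for x
        using that K yn norm_triangle_ineq4[of y x] by (force simp: dist_norm annulus_def)
      then show "K \<subseteq> cball y 2" by auto
    qed
    have [measurable]: "K \<in> sets borel" using K by (intro borel_closed compact_imp_closed) auto
    have "integrable lborel (\<lambda>x. indicator (cball y 2) x / norm (x - y) ^ ?n)"
      by (rule integrable_riesz_kernel) (use N3 in auto)
    then have "integrable lborel (\<lambda>x. indicator (cball y 2) x / norm (x - y) ^ ?n * indicator K x)"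
      by (rule integrable_real_mult_indicator[rotated]) simp
    also have "(\<lambda>x. indicator (cball y 2) x / norm (x - y) ^ ?n * indicator K x) = (\<lambda>x. indicator K x * (1 / norm (x - y) ^ ?n))"
      using sub by (auto simp: indicator_def fun_eq_iff)
    finally have 1: "integrable lborel (\<lambda>x. indicator K x * (1 / norm (x - y) ^ ?n))" .
    have "integrable lborel (\<lambda>x. indicator K x *\<^sub>R image_sum \<rho> y x)"
      by (intro borel_integrable_compact continuous_on_subset[OF cont] sub) (use K in auto)
    with 1 have "integrable lborel (\<lambda>x. c0 * (indicator K x * (1 / norm (x - y) ^ ?n) - indicator K x * image_sum \<rho> y x))"
      by simp
    also have "(\<lambda>x. c0 * (indicator K x * (1 / norm (x - y) ^ ?n) - indicator K x * image_sum \<rho> y x))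
      = (\<lambda>x. indicator K x *\<^sub>R annulus_green \<rho> y x)"
      by (simp add: G fun_eq_iff algebra_simps)
    finally have int: "integrable lborel (\<lambda>x. indicator K x *\<^sub>R annulus_green \<rho> y x)" .
    show ?thesis
      unfolding set_integrable_def using integrable_completion[OF borel_measurable_integrable[OF int]] int by blast
  qed
  show "(LINT x:?\<Omega>|lebesgue. annulus_green \<rho> y x * (- laplacian \<phi> x)) = \<phi> y"
    if \<phi>: "test_function ?\<Omega> \<phi>" for \<phi>
  proof -
    obtain R where R: "\<And>x. R < norm x \<Longrightarrow> \<phi> x = 0"
      and supp\<Delta>: "\<And>x. R < norm x \<Longrightarrow> laplacian \<phi> x = 0"
      using test_function_support(1)[OF \<phi>] by blast
    note c\<Delta> = test_function_support(2)[OF \<phi>]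
    have i1: "integrable lborel (\<lambda>x. 1 / norm (x - y) ^ ?n * laplacian \<phi> x)"
      by (rule integrable_riesz_kernel_mult[OF _ _ c\<Delta> supp\<Delta>]) (use N3 in auto)
    have v1: "(LINT x|lborel. 1 / norm (x - y) ^ ?n * laplacian \<phi> x)
        = - (real CARD('n) - 2) * real CARD('n) * unit_ball_vol (real CARD('n)) * \<phi> y"
      by (rule riesz_laplacian[OF N3 test_functionD(1)[OF \<phi>] R])
    have i2: "integrable lborel (\<lambda>x. image_sum \<rho> y x * laplacian \<phi> x)"
      and v2: "(LINT x|lborel. image_sum \<rho> y x * laplacian \<phi> x) = 0"
      using image_sum_weakly_harmonic[OF N3 \<rho> yn \<phi>] by (auto simp: has_bochner_integral_iff)
    let ?f = "\<lambda>x. - c0 * (1 / norm (x - y) ^ ?n * laplacian \<phi> x) + c0 * (image_sum \<rho> y x * laplacian \<phi> x)"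
    have if': "integrable lborel ?f"
      by (intro Bochner_Integration.integrable_add integrable_mult_right i1 i2)
    have f: "(\<lambda>x. indicator ?\<Omega> x *\<^sub>R (annulus_green \<rho> y x * (- laplacian \<phi> x))) = ?f"
    proof
      fix x
      show "indicator ?\<Omega> x *\<^sub>R (annulus_green \<rho> y x * (- laplacian \<phi> x)) = ?f x"
        using test_functionD(4)[OF \<phi>, of x] by (cases "x \<in> ?\<Omega>") (simp_all add: G algebra_simps)
    qed
    have "(LINT x:?\<Omega>|lebesgue. annulus_green \<rho> y x * (- laplacian \<phi> x)) = (LINT x|lborel. ?f x)"
      unfolding set_lebesgue_integral_def f
      by (rule integral_completion) (rule borel_measurable_integrable[OF if'])
    also have "\<dots> = (LINT x|lborel. - c0 * (1 / norm (x - y) ^ ?n * laplacian \<phi> x))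
        + (LINT x|lborel. c0 * (image_sum \<rho> y x * laplacian \<phi> x))"
      by (intro Bochner_Integration.integral_add integrable_mult_right i1 i2)
    also have "\<dots> = - c0 * (- (real CARD('n) - 2) * real CARD('n) * unit_ball_vol (real CARD('n)) * \<phi> y)"
      unfolding integral_mult_right_zero v1 v2 by simp
    also have "\<dots> = \<phi> y"
    proof -
      have "unit_ball_vol (real CARD('n)) > 0" by (rule unit_ball_vol_pos) simp
      moreover have "real CARD('n) - 2 > 0" "real CARD('n) > 0" using N3 by auto
      moreover have "- (1 / (N * V * M)) * (- M * N * V * t) = t" if "V > 0" "M > 0" "N > 0" for N V M t :: real
        using that by simp
      ultimately show ?thesis unfolding c0_def sphere_area_eq by blast
    qed
    finally show ?thesis .
  qed
qed

lemma green_annulus: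
  fixes x y :: "real^'n::finite"
  assumes N3: "CARD('n) \<ge> 3" and \<rho>: "0 < \<rho>" "\<rho> < 1" and "x \<in> annulus \<rho>" "y \<in> annulus \<rho>" "x \<noteq> y"
  shows "green (annulus \<rho>) x y = annulus_green \<rho> y x"
  by (rule green_unique[OF annulus_bounds(1,2)]) (use assms annulus_green_is_green in auto)

text \<open>
  The limit that defines the regular part on the diagonal is the value of the image sum there,
  because \<open>image_sum\<close> is continuous at \<open>y\<close>.
\<close>
lemma robin_annulus:
  fixes y :: "real^'n::finite"
  assumes N3: "CARD('n) \<ge> 3" and \<rho>: "0 < \<rho>" "\<rho> < 1" and y: "y \<in> annulus \<rho>"
  shows "robin (annulus \<rho>) y = 1 / (sphere_area TYPE('n) * (real CARD('n) - 2)) * image_sum \<rho> y y"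
proof -
  let ?c = "1 / (sphere_area TYPE('n) * (real CARD('n) - 2))"
  have yn: "\<rho> < norm y" "norm y < 1" using y by (auto simp: annulus_def)
  have "continuous_on (annulus \<rho>) (image_sum \<rho> y)"
    by (rule continuous_on_subset[OF continuous_on_image_sum[OF N3 \<rho> yn]]) (auto simp: annulus_def)
  then have "isCont (image_sum \<rho> y) y"
    using y annulus_bounds(1) continuous_on_eq_continuous_at by blast
  then have "((\<lambda>z. ?c * image_sum \<rho> y z) \<longlongrightarrow> ?c * image_sum \<rho> y y) (at y)"
    by (intro tendsto_intros) (simp add: isCont_def)
  moreover have "\<forall>\<^sub>F z in at y. ?c * image_sum \<rho> y z = fund_sol z y - green (annulus \<rho>) z y"
    using eventually_at_in_open'[OF annulus_bounds(1) y] eventually_neq_at_within[of y y]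
    by eventually_elim (simp add: green_annulus[OF N3 \<rho> _ y] annulus_green_def)
  ultimately have "((\<lambda>z. fund_sol z y - green (annulus \<rho>) z y) \<longlongrightarrow> ?c * image_sum \<rho> y y) (at y)"
    by (rule Lim_transform_eventually)
  then show ?thesis
    by (simp add: robin_def regular_part_def tendsto_Lim)
qed


section \<open>Gegenbauer polynomials and their sums over a regular polygon\<close>

text \<open>
  Agreement on \<open>(0,1)\<close> suffices: the lowest differing coefficient is the limit at \<open>0\<close> of a series that
  vanishes for small positive arguments.
\<close>
lemma powser_coeff_unique:
  fixes a b :: "nat \<Rightarrow> real"
  assumes a: "\<And>s. 0 < s \<Longrightarrow> s < 1 \<Longrightarrow> (\<lambda>m. a m * s ^ m) sums f s"
    and b: "\<And>s. 0 < s \<Longrightarrow> s < 1 \<Longrightarrow> (\<lambda>m. b m * s ^ m) sums f s"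
  shows "a = b"
proof
  fix m
  show "a m = b m"
  proof (induction m rule: less_induct)
    case (less m)
    define e where "e n = a (n + m) - b (n + m)" for n
    have e0: "(\<lambda>n. e n * s ^ n) sums 0" if s: "0 < s" "s < 1" for s
    proof -
      have "(\<lambda>n. (a n - b n) * s ^ n) sums 0"
        using sums_diff[OF a[OF s] b[OF s]] by (simp add: algebra_simps)
      then have "(\<lambda>n. (a (n + m) - b (n + m)) * s ^ (n + m)) sums (0 - (\<Sum>i<m. (a i - b i) * s ^ i))"
        by (rule sums_split_initial_segment)
      then have "(\<lambda>n. s ^ m * (e n * s ^ n)) sums (s ^ m * 0)"
        using less by (simp add: e_def power_add mult_ac)
      then show ?thesis using s by (subst (asm) sums_mult_iff) auto
    qed
    have "(\<lambda>n. e n * x ^ n) sums (\<Sum>n. e n * x ^ n)" if "norm x < 1" for x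
    proof -
      obtain s where s: "norm x < s" "s < 1" using \<open>norm x < 1\<close> dense by blast
      then have "0 < s" using norm_ge_zero[of x] by linarith
      then have "summable (\<lambda>n. e n * x ^ n)"
        using powser_inside[OF sums_summable[OF e0[OF _ s(2)]], of x] s(1) by simp
      then show ?thesis by (rule summable_sums)
    qed
    then have "((\<lambda>x. \<Sum>n. e n * x ^ n) \<longlongrightarrow> e 0) (at_right 0)"
      by (intro tendsto_mono[OF at_le powser_limit_0[of 1]]) auto
    moreover have "\<forall>\<^sub>F x in at_right 0. (\<Sum>n. e n * x ^ n) = 0"
      using sums_unique[OF e0] by (fastforce simp: eventually_at_right_field intro!: exI[of _ 1])
    ultimately have "((\<lambda>_. 0) \<longlongrightarrow> e 0) (at_right (0::real))"
      by (rule Lim_transform_eventually)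
    then have "e 0 = 0"
      using tendsto_unique[OF _ _ tendsto_const] by (metis trivial_limit_at_right_real)
    then show ?case by (simp add: e_def)
  qed
qed

text \<open>
  The coefficients of \<open>(1 - z) powr (- lam)\<close>.
\<close>
definition binom_coeff :: "real \<Rightarrow> nat \<Rightarrow> real" where
  "binom_coeff lam i = pochhammer lam i / fact i"

text \<open>
  The Gegenbauer polynomial of degree \<open>m\<close> at \<open>cos \<theta>\<close>, see \<open>gegenbauer_cos\<close>.  In this form it is visible
  that the Fourier coefficients are nonnegative.
\<close>
definition gegenbauer_trig :: "real \<Rightarrow> nat \<Rightarrow> real \<Rightarrow> real" where
  "gegenbauer_trig lam m \<theta> = (\<Sum>i\<le>m. binom_coeff lam i * binom_coeff lam (m - i) * cos ((real i - real (m - i)) * \<theta>))"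

lemma binom_coeff_nonneg: "lam > 0 \<Longrightarrow> binom_coeff lam i \<ge> 0"
  by (simp add: binom_coeff_def pochhammer_nonneg)

lemma abs_gegenbauer_trig_le: "lam > 0 \<Longrightarrow> \<bar>gegenbauer_trig lam m \<theta>\<bar> \<le> gegenbauer_trig lam m 0"
  unfolding gegenbauer_trig_def
  by (rule order.trans[OF sum_abs], rule sum_mono)
    (auto simp: abs_mult binom_coeff_nonneg intro!: mult_left_le)

lemma gegenbauer_trig_degree_0: "gegenbauer_trig lam 0 \<theta> = 1"
  by (simp add: gegenbauer_trig_def binom_coeff_def)

lemma binom_coeff_sums:
  fixes z :: complex
  assumes "norm z < 1"
  shows "(\<lambda>i. of_real (binom_coeff lam i) * z ^ i) sums (1 - z) powr (of_real (- lam))"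
proof -
  have "(\<lambda>i. ((of_real (- lam) :: complex) gchoose i) * (- z) ^ i) sums (1 + - z) powr (of_real (- lam))"
    by (rule gen_binomial_complex) (use assms in simp)
  moreover have "((of_real (- lam) :: complex) gchoose i) * (- z) ^ i = of_real (binom_coeff lam i) * z ^ i" for i
  proof -
    have "(- 1) ^ i * (- z) ^ i = z ^ i" by (simp flip: power_mult_distrib)
    then show ?thesis
      by (simp add: gbinomial_pochhammer binom_coeff_def pochhammer_of_real mult_ac)
  qed
  ultimately show ?thesis by simp
qed

lemma binom_coeff_summable:
  assumes "0 \<le> s" "s < 1" "lam > 0"
  shows "summable (\<lambda>i. binom_coeff lam i * s ^ i)"
proof -
  have "summable (\<lambda>i. of_real (binom_coeff lam i) * (of_real s :: complex) ^ i)"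
    using binom_coeff_sums[of "of_real s" lam] assms by (auto simp: sums_iff)
  from summable_Re[OF this] show ?thesis by (simp flip: of_real_power of_real_mult)
qed

text \<open>
  With \<open>z = s cis \<theta>\<close> the generating function is \<open>|1 - z| powr (- 2 lam)\<close>, the product of
  \<open>(1 - z) powr (- lam)\<close> and its conjugate; the Cauchy product of the two binomial series gives the
  cosines.
\<close>
lemma gegenbauer_trig_sums:
  assumes s: "0 \<le> s" "s < 1" and lam: "lam > 0"
  shows "(\<lambda>m. gegenbauer_trig lam m \<theta> * s ^ m) sums ((1 - 2 * s * cos \<theta> + s\<^sup>2) powr (- lam))"
proof -
  define z where "z = of_real s * cis \<theta>"
  have nz: "norm z = s" using s by (simp add: z_def norm_mult)
  define A where "A = (1 - z) powr (of_real (- lam))"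
  let ?a = "\<lambda>i. of_real (binom_coeff lam i) * z ^ i" and ?c = "\<lambda>i. of_real (binom_coeff lam i) * cnj z ^ i"
  have A: "?a sums A" unfolding A_def by (rule binom_coeff_sums) (use nz s in simp)
  have "(\<lambda>i. cnj (?a i)) sums cnj A" using A by (rule sums_cnj[THEN iffD2])
  then have cA: "?c sums cnj A" by simp
  have n: "summable (\<lambda>i. norm (?a i))" "summable (\<lambda>i. norm (?c i))"
    using binom_coeff_summable[OF s lam] binom_coeff_nonneg[OF lam] nz s
    by (simp_all add: norm_mult norm_power)
  have "(\<lambda>m. \<Sum>i\<le>m. ?a i * ?c (m - i)) sums (A * cnj A)"
    using Cauchy_product_sums[OF n] A cA by (simp add: sums_iff)
  then have "(\<lambda>m. Re (\<Sum>i\<le>m. ?a i * ?c (m - i))) sums Re (A * cnj A)"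
    by (rule sums_Re)
  moreover have "Re (\<Sum>i\<le>m. ?a i * ?c (m - i)) = gegenbauer_trig lam m \<theta> * s ^ m" for m
  proof -
    have "Re (?a i * ?c (m - i)) = binom_coeff lam i * binom_coeff lam (m - i) * cos ((real i - real (m - i)) * \<theta>) * s ^ m"
      if "i \<le> m" for i
    proof -
      have "z ^ i * cnj z ^ (m - i) = of_real (s ^ i * s ^ (m - i)) * (cis (real i * \<theta>) * cis (- (real (m - i) * \<theta>)))"
        by (simp only: z_def power_mult_distrib complex_cnj_mult cis_cnj Complex.DeMoivre
            complex_cnj_complex_of_real of_real_mult of_real_power mult_minus_right mult_minus_left mult_ac)
      also have "s ^ i * s ^ (m - i) = s ^ m" using that by (simp flip: power_add)
      also have "cis (real i * \<theta>) * cis (- (real (m - i) * \<theta>)) = cis ((real i - real (m - i)) * \<theta>)"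
        by (simp add: cis_mult left_diff_distrib)
      finally have E: "?a i * ?c (m - i) = of_real (binom_coeff lam i * binom_coeff lam (m - i) * s ^ m) * cis ((real i - real (m - i)) * \<theta>)"
        by (simp add: mult_ac)
      show ?thesis unfolding E by (simp add: mult_ac)
    qed
    then show ?thesis unfolding gegenbauer_trig_def Re_sum sum_distrib_right by (intro sum.cong) auto
  qed
  moreover have "Re (A * cnj A) = (1 - 2 * s * cos \<theta> + s\<^sup>2) powr (- lam)"
  proof -
    have "Re (A * cnj A) = (norm A)\<^sup>2"
      by (metis Re_complex_of_real complex_norm_square)
    also have "norm A = norm (1 - z) powr (- lam)"
      unfolding A_def by (subst norm_powr_real_powr') auto
    also have "(norm (1 - z) powr (- lam))\<^sup>2 = ((norm (1 - z))\<^sup>2) powr (- lam)"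
      by (simp add: power2_eq_square powr_mult)
    also have "(norm (1 - z))\<^sup>2 = 1 - 2 * s * cos \<theta> + s\<^sup>2"
    proof -
      have "(norm (1 - z))\<^sup>2 = (1 - s * cos \<theta>)\<^sup>2 + (s * sin \<theta>)\<^sup>2"
        by (simp add: cmod_power2 z_def)
      also have "\<dots> = 1 - 2 * s * cos \<theta> + s\<^sup>2"
        using sin_cos_squared_add[of \<theta>] by algebra
      finally show ?thesis .
    qed
    finally show ?thesis .
  qed
  ultimately show ?thesis by simp
qed

lemma gegenbauer_cos:
  assumes "lam > 0"
  shows "gegenbauer lam m (cos \<theta>) = gegenbauer_trig lam m \<theta>"
proof -
  let ?P = "\<lambda>c :: nat \<Rightarrow> real. \<forall>s\<in>{0..<1}. (\<lambda>i. c i * s ^ i) sums ((1 - 2 * s * cos \<theta> + s\<^sup>2) powr (- lam))"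
  have "(THE c. ?P c) = (\<lambda>m. gegenbauer_trig lam m \<theta>)"
  proof (rule the_equality)
    show "?P (\<lambda>m. gegenbauer_trig lam m \<theta>)" using gegenbauer_trig_sums[OF _ _ assms] by auto
    fix c assume c: "?P c"
    show "c = (\<lambda>m. gegenbauer_trig lam m \<theta>)"
      by (rule powser_coeff_unique[where f="\<lambda>s. (1 - 2 * s * cos \<theta> + s\<^sup>2) powr (- lam)"])
        (use c gegenbauer_trig_sums[OF _ _ assms] in auto)
  qed
  then show ?thesis by (simp add: gegenbauer_def)
qed

lemma powr_half_nat:
  assumes "x > 0"
  shows "(x\<^sup>2) powr (- (real n / 2)) = 1 / x ^ n"
proof -
  have "(x\<^sup>2) powr (- (real n / 2)) = (x powr 2) powr (- (real n / 2))" using assms by simp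
  also have "\<dots> = x powr (- real n)" by (simp add: powr_powr del: powr_numeral)
  finally show ?thesis using assms by (simp add: powr_minus_divide powr_realpow)
qed

text \<open>
  Both sides are the coefficients of \<open>1 / (1 - s)\<^sup>n\<close>.
\<close>
lemma gegenbauer_trig_at_0:
  assumes n: "n \<ge> 1"
  shows "gegenbauer_trig (real n / 2) m 0 = real ((n + m - 1) choose (n - 1))"
proof -
  have "(\<lambda>m. gegenbauer_trig (real n / 2) m 0) = (\<lambda>m. binom_coeff (real n) m)"
  proof (rule powser_coeff_unique[where f="\<lambda>s. 1 / (1 - s) ^ n"])
    fix s :: real assume s: "0 < s" "s < 1"
    have "1 - 2 * s * cos 0 + s\<^sup>2 = (1 - s)\<^sup>2" by (simp add: power2_eq_square algebra_simps)
    then show "(\<lambda>m. gegenbauer_trig (real n / 2) m 0 * s ^ m) sums (1 / (1 - s) ^ n)"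
      using gegenbauer_trig_sums[of s "real n / 2" 0] powr_half_nat[of "1 - s" n] s n by simp
    have "(\<lambda>m. ((- real n) gchoose m) * (- s) ^ m) sums (1 + - s) powr (- real n)"
      by (rule gen_binomial_real) (use s in auto)
    moreover have "(- real n gchoose m) * (- s) ^ m = binom_coeff (real n) m * s ^ m" for m
    proof -
      have "(- 1) ^ m * (- s) ^ m = s ^ m" by (simp flip: power_mult_distrib)
      then show ?thesis by (simp add: gbinomial_pochhammer binom_coeff_def mult_ac)
    qed
    ultimately show "(\<lambda>m. binom_coeff (real n) m * s ^ m) sums (1 / (1 - s) ^ n)"
      using s by (simp add: powr_minus_divide powr_realpow)
  qed
  then have "gegenbauer_trig (real n / 2) m 0 = binom_coeff (real n) m" by meson
  also have "pochhammer (real n) m * fact (n - 1) = fact (n + m - 1)"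
  proof (induction m)
    case (Suc m)
    have "fact (n + Suc m - 1) = real (n + m) * fact (n + m - 1)"
      using n by (cases n) simp_all
    then show ?case using Suc by (simp add: pochhammer_Suc mult_ac)
  qed (use n in simp)
  then have "binom_coeff (real n) m = real ((n + m - 1) choose (n - 1))"
    using n by (simp add: binom_coeff_def binomial_fact field_simps)
  finally show ?thesis .
qed

lemma sum_cos_roots_nonneg:
  assumes k: "k \<ge> 1"
  shows "(\<Sum>j<k. cos (real_of_int l * (2 * pi * real j / real k))) \<ge> 0"
proof -
  define w where "w = cis (real_of_int l * (2 * pi / real k))"
  have "Re (w ^ j) = cos (real_of_int l * (2 * pi * real j / real k))" for j
    unfolding w_def Complex.DeMoivre by (simp add: mult_ac)
  then have eq: "(\<Sum>j<k. cos (real_of_int l * (2 * pi * real j / real k))) = Re (\<Sum>j<k. w ^ j)"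
    by simp
  show ?thesis
  proof (cases "w = 1")
    case True
    then show ?thesis unfolding eq by simp
  next
    case False
    have "w ^ k = cis (2 * pi * real_of_int l)" using k unfolding w_def Complex.DeMoivre by (simp add: mult_ac)
    also have "\<dots> = 1" by (rule cis_multiple_2pi) simp
    finally have "(\<Sum>j<k. w ^ j) = 0"
      using False by (simp add: geometric_sum)
    then show ?thesis unfolding eq by simp
  qed
qed

definition polygon_coeff :: "nat \<Rightarrow> nat \<Rightarrow> nat \<Rightarrow> real" where
  "polygon_coeff n k m = (\<Sum>j<k. gegenbauer_trig (real n / 2) m (2 * pi * real j / real k))"

text \<open>
  The positivity on which the minimisation rests: averaging over the polygon keeps exactly the Fourier
  modes divisible by \<open>k\<close>, whose coefficients are nonnegative.
\<close>
lemma polygon_coeff_nonneg: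
  assumes "n \<ge> 1" "k \<ge> 1"
  shows "polygon_coeff n k m \<ge> 0"
proof -
  let ?b = "binom_coeff (real n / 2)"
  have "polygon_coeff n k m = (\<Sum>i\<le>m. \<Sum>j<k. ?b i * ?b (m - i) * cos (real_of_int (int i - int (m - i)) * (2 * pi * real j / real k)))"
    unfolding polygon_coeff_def gegenbauer_trig_def by (subst sum.swap) simp
  also have "\<dots> = (\<Sum>i\<le>m. ?b i * ?b (m - i) * (\<Sum>j<k. cos (real_of_int (int i - int (m - i)) * (2 * pi * real j / real k))))"
    by (simp add: sum_distrib_left)
  also have "\<dots> \<ge> 0"
    using assms by (intro sum_nonneg mult_nonneg_nonneg binom_coeff_nonneg sum_cos_roots_nonneg) auto
  finally show ?thesis .
qed

lemma polygon_coeff_le: "n \<ge> 1 \<Longrightarrow> polygon_coeff n k m \<le> real k * gegenbauer_trig (real n / 2) m 0"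
  unfolding polygon_coeff_def
  using sum_mono[of "{..<k}" "\<lambda>j. gegenbauer_trig (real n / 2) m (2 * pi * real j / real k)" "\<lambda>_. gegenbauer_trig (real n / 2) m 0"]
    abs_gegenbauer_trig_le[of "real n / 2" m] by (force simp: abs_le_iff)

lemma polygon_coeff_0: "polygon_coeff n k 0 = real k"
  by (simp add: polygon_coeff_def gegenbauer_trig_degree_0)

lemma gegenbauer_trig_at_0_sums:
  assumes "n \<ge> 1" "0 \<le> a" "a < 1"
  shows "(\<lambda>m. gegenbauer_trig (real n / 2) m 0 * a ^ m) sums (1 / (1 - a) ^ n)"
proof -
  have "1 - 2 * a * cos 0 + a\<^sup>2 = (1 - a)\<^sup>2" by (simp add: power2_eq_square algebra_simps)
  then show ?thesis
    using gegenbauer_trig_sums[of a "real n / 2" 0] powr_half_nat[of "1 - a" n] assms by simp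
qed

text \<open>
  The two bounds compare the sum over the polygon with its term \<open>j = 0\<close>, which has the value
  \<open>1 / (1 - a)\<^sup>n\<close> and is the largest of them.
\<close>
lemma polygon_coeff_summable:
  assumes "n \<ge> 1" "k \<ge> 1" "0 \<le> a" "a < 1"
  shows "summable (\<lambda>m. polygon_coeff n k m * a ^ m)"
    and "(\<Sum>m. polygon_coeff n k m * a ^ m) \<le> real k / (1 - a) ^ n"
    and "1 / (1 - a) ^ n \<le> (\<Sum>m. polygon_coeff n k m * a ^ m)"
proof -
  let ?D = "\<lambda>j. (1 - 2 * a * cos (2 * pi * real j / real k) + a\<^sup>2) powr (- (real n / 2))"
  have s: "(\<lambda>m. polygon_coeff n k m * a ^ m) sums (\<Sum>j<k. ?D j)"
    unfolding polygon_coeff_def sum_distrib_right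
    by (intro sums_sum gegenbauer_trig_sums) (use assms in auto)
  then show sm: "summable (\<lambda>m. polygon_coeff n k m * a ^ m)" by (rule sums_summable)
  have "?D 0 \<le> (\<Sum>j<k. ?D j)"
    using assms by (intro member_le_sum) auto
  moreover have "?D 0 = 1 / (1 - a) ^ n"
    using sums_unique2[OF gegenbauer_trig_sums[of a "real n / 2" 0] gegenbauer_trig_at_0_sums[of n a]] assms by simp
  ultimately show "1 / (1 - a) ^ n \<le> (\<Sum>m. polygon_coeff n k m * a ^ m)"
    using sums_unique[OF s] by simp
  have S: "(\<lambda>m. real k * (gegenbauer_trig (real n / 2) m 0 * a ^ m)) sums (real k * (1 / (1 - a) ^ n))"
    by (intro sums_mult gegenbauer_trig_at_0_sums assms)
  have "polygon_coeff n k m * a ^ m \<le> real k * (gegenbauer_trig (real n / 2) m 0 * a ^ m)" for m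
    using mult_right_mono[OF polygon_coeff_le[OF assms(1), of k m], of "a ^ m"] assms by (simp add: mult.assoc)
  from sums_le[OF this summable_sums[OF sm] S]
  show "(\<Sum>m. polygon_coeff n k m * a ^ m) \<le> real k / (1 - a) ^ n" by simp
qed


section \<open>Expansion of the function \<open>\<Lambda>\<^sub>1\<close>\<close>

text \<open>
  The generating function of the Gegenbauer polynomials, for two points on one sphere.  The charge at
  \<open>(b / a) y\<close> must be the nearer one to the origin; \<open>image_kernel_swap\<close> reduces the other case to this one.
\<close>
lemma image_kernel_sums:
  fixes x y :: "real^'n::finite"
  assumes N3: "CARD('n) \<ge> 3" and r: "r > 0" "norm x = r" "norm y = r" "x \<bullet> y = r\<^sup>2 * cos \<theta>"
    and ab: "0 \<le> b" "b < a"
  shows "(\<lambda>m. gegenbauer_trig (real (CARD('n) - 2) / 2) m \<theta> * ((e / (r * a)) ^ (CARD('n) - 2) * (b / a) ^ m))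
    sums image_kernel e a b y x"
proof -
  let ?n = "CARD('n) - 2"
  define s where "s = b / a"
  define q where "q = 1 - 2 * s * cos \<theta> + s\<^sup>2"
  have a: "a > 0" using ab by simp
  have s: "0 \<le> s" "s < 1" using ab a by (auto simp: s_def)
  have q: "q > 0"
  proof -
    have "s * cos \<theta> \<le> s * 1" using s by (intro mult_left_mono) auto
    then have "(1 - s)\<^sup>2 \<le> q" by (simp add: q_def power2_eq_square algebra_simps)
    moreover have "(1 - s)\<^sup>2 > 0" using s by simp
    ultimately show ?thesis by linarith
  qed
  have b: "b = s * a" using a by (simp add: s_def)
  have "norm (a *\<^sub>R x - b *\<^sub>R y) = (r * a) * sqrt q"
  proof (rule power2_eq_imp_eq)
    have "(norm (a *\<^sub>R x - b *\<^sub>R y))\<^sup>2 = (r * a)\<^sup>2 * q"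
      unfolding power2_norm_eq_inner inner_combination r(2-4) q_def b
      by (simp add: power2_eq_square algebra_simps)
    then show "(norm (a *\<^sub>R x - b *\<^sub>R y))\<^sup>2 = (r * a * sqrt q)\<^sup>2"
      using q by (simp add: power_mult_distrib)
  qed (use r a q in auto)
  then have k: "image_kernel e a b y x = (e / (r * a)) ^ ?n * q powr (- (real ?n / 2))"
    using powr_half_nat[of "sqrt q" ?n] q by (simp add: image_kernel_def power_divide power_mult_distrib)
  have "(\<lambda>m. (e / (r * a)) ^ ?n * (gegenbauer_trig (real ?n / 2) m \<theta> * s ^ m)) sums ((e / (r * a)) ^ ?n * q powr (- (real ?n / 2)))"
    unfolding q_def by (intro sums_mult gegenbauer_trig_sums s) (use N3 in auto)
  then show ?thesis unfolding k s_def by (simp add: mult_ac)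
qed

lemma image_kernel_swap: "image_kernel e a b y x = image_kernel e b a x y"
  by (simp add: image_kernel_def norm_minus_commute)

text \<open>
  The radial factor of the mode of degree \<open>m\<close> in one image term, on the sphere of radius \<open>r\<close>.
\<close>
definition mode_gap :: "nat \<Rightarrow> real \<Rightarrow> real \<Rightarrow> nat \<Rightarrow> real" where
  "mode_gap n \<rho> r m = r ^ (2 * m + n) - 2 * \<rho> ^ (2 * m + n) + (\<rho> / r) ^ (2 * m + n)"

definition mode_weight :: "nat \<Rightarrow> real \<Rightarrow> real \<Rightarrow> nat \<Rightarrow> real" where
  "mode_weight n \<rho> r m = mode_gap n \<rho> r m / (1 - \<rho> ^ (2 * m + n))"

lemma image_term_sums:
  fixes x y :: "real^'n::finite"
  assumes N3: "CARD('n) \<ge> 3" and r: "0 < \<rho>" "\<rho> < r" "r < 1" "norm x = r" "norm y = r" "x \<bullet> y = r\<^sup>2 * cos \<theta>"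
  defines "n \<equiv> CARD('n) - 2"
  shows "(\<lambda>m. gegenbauer_trig (real n / 2) m \<theta> * ((\<rho> ^ (2 * m + n)) ^ l * mode_gap n \<rho> r m / r ^ n))
    sums image_term \<rho> y l x"
proof -
  have r0: "r > 0" using r by simp
  have yx: "y \<bullet> x = r\<^sup>2 * cos \<theta>" using r by (simp add: inner_commute)
  have p1: "\<rho> ^ (2 * l) \<le> 1" "0 < \<rho> ^ (2 * l)" using r by (auto simp: power_le_one)
  have p2: "\<rho> ^ (2 * l + 2) < 1" using r by (subst power_less_one_iff) auto
  have p3: "\<rho> ^ (2 * l + 2) < r\<^sup>2"
  proof -
    have "\<rho> ^ (2 * l + 2) \<le> \<rho>\<^sup>2" using mult_right_mono[OF p1(1), of "\<rho>\<^sup>2"] unfolding power_add by simp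
    also have "\<dots> < r\<^sup>2" using r by (intro power_strict_mono) auto
    finally show ?thesis .
  qed
  have p4: "\<rho> ^ (2 * l) * r\<^sup>2 < 1"
  proof -
    have "\<rho> ^ (2 * l) * r\<^sup>2 \<le> 1 * r\<^sup>2" using p1 by (intro mult_right_mono) auto
    also have "\<dots> < 1" using r r0 by (simp add: power_less_one_iff)
    finally show ?thesis .
  qed
  let ?g = "\<lambda>m. gegenbauer_trig (real n / 2) m \<theta>"
  note S = image_kernel_sums[OF N3 r0, folded n_def]
  have t1: "(\<lambda>m. ?g m * ((\<rho> ^ l * r / (r * 1)) ^ n * (\<rho> ^ (2 * l) * r\<^sup>2 / 1) ^ m))
      sums image_kernel (\<rho> ^ l * norm y) (\<rho> ^ (2 * l) * (norm y)\<^sup>2) 1 y x"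
    unfolding r(5) by (subst image_kernel_swap) (rule S[OF r(5,4) yx], use p1 p4 r0 in auto)
  have t2: "(\<lambda>m. ?g m * ((\<rho> ^ (l + 1) / (r * 1)) ^ n * (\<rho> ^ (2 * l + 2) / 1) ^ m))
      sums image_kernel (\<rho> ^ (l + 1)) (\<rho> ^ (2 * l + 2)) 1 y x"
    by (subst image_kernel_swap) (rule S[OF r(5,4) yx], use p2 r in auto)
  have t3: "(\<lambda>m. ?g m * ((\<rho> ^ (l + 1) * r / (r * r\<^sup>2)) ^ n * (\<rho> ^ (2 * l + 2) / r\<^sup>2) ^ m))
      sums image_kernel (\<rho> ^ (l + 1) * norm y) ((norm y)\<^sup>2) (\<rho> ^ (2 * l + 2)) y x"
    unfolding r(5) by (rule S[OF r(4,5,6)], use p3 r in auto)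
  have t4: "(\<lambda>m. ?g m * ((\<rho> ^ (l + 1) / (r * 1)) ^ n * (\<rho> ^ (2 * l + 2) / 1) ^ m))
      sums image_kernel (\<rho> ^ (l + 1)) 1 (\<rho> ^ (2 * l + 2)) y x"
    by (rule S[OF r(4,5,6)], use p2 r in auto)
  \<comment> \<open>each family contributes one power of \<open>\<rho>\<^sup>l\<^sup>\<sigma>\<close> times one summand of \<open>mode_gap\<close>; the second and fourth coincide on the sphere \<open>|x| = |y|\<close>\<close>
  have e1: "(\<rho> ^ l * r / (r * 1)) ^ n * (\<rho> ^ (2 * l) * r\<^sup>2 / 1) ^ m = (\<rho> ^ (2 * m + n)) ^ l * r ^ (2 * m + n) / r ^ n" for m
    using r0 by (simp add: power_mult_distrib power_add power_mult[symmetric] mult_ac)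
  have e2: "(\<rho> ^ (l + 1) / (r * 1)) ^ n * (\<rho> ^ (2 * l + 2) / 1) ^ m = (\<rho> ^ (2 * m + n)) ^ l * \<rho> ^ (2 * m + n) / r ^ n" for m
  proof -
    have "(\<rho> ^ (l + 1)) ^ n * (\<rho> ^ (2 * l + 2)) ^ m = \<rho> ^ ((l + 1) * n + (2 * l + 2) * m)"
      by (simp only: power_mult power_add)
    also have "(l + 1) * n + (2 * l + 2) * m = (2 * m + n) * l + (2 * m + n)" by (simp add: algebra_simps)
    finally show ?thesis by (simp add: power_divide power_mult power_add)
  qed
  have e3: "(\<rho> ^ (l + 1) * r / (r * r\<^sup>2)) ^ n * (\<rho> ^ (2 * l + 2) / r\<^sup>2) ^ m = (\<rho> ^ (2 * m + n)) ^ l * (\<rho> / r) ^ (2 * m + n) / r ^ n" for m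
  proof -
    have "(\<rho> ^ (l + 1)) ^ n * (\<rho> ^ (2 * l + 2)) ^ m = (\<rho> ^ (2 * m + n)) ^ l * \<rho> ^ (2 * m + n)"
      using e2[of m] r0 by (simp add: power_divide)
    moreover have "(\<rho> ^ (l + 1) * r / (r * r\<^sup>2)) ^ n * (\<rho> ^ (2 * l + 2) / r\<^sup>2) ^ m
        = ((\<rho> ^ (l + 1)) ^ n * (\<rho> ^ (2 * l + 2)) ^ m) / ((r\<^sup>2) ^ n * (r\<^sup>2) ^ m)"
      using r0 by (simp add: power_divide)
    moreover have "(r\<^sup>2) ^ n * (r\<^sup>2) ^ m = r ^ (2 * m + n) * r ^ n"
      by (simp add: power_add power_mult[symmetric] mult_ac) (simp add: power_mult power2_eq_square power_mult_distrib)
    ultimately show ?thesis by (simp add: power_divide)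
  qed
  have "(\<lambda>m. ?g m * ((\<rho> ^ (2 * m + n)) ^ l * r ^ (2 * m + n) / r ^ n)
      - ?g m * ((\<rho> ^ (2 * m + n)) ^ l * \<rho> ^ (2 * m + n) / r ^ n)
      + ?g m * ((\<rho> ^ (2 * m + n)) ^ l * (\<rho> / r) ^ (2 * m + n) / r ^ n)
      - ?g m * ((\<rho> ^ (2 * m + n)) ^ l * \<rho> ^ (2 * m + n) / r ^ n)) sums image_term \<rho> y l x"
    unfolding image_term_def
    by (intro sums_add sums_diff t1[unfolded e1] t2[unfolded e2] t3[unfolded e3] t4[unfolded e2])
  moreover have "?g m * ((\<rho> ^ (2 * m + n)) ^ l * r ^ (2 * m + n) / r ^ n)
      - ?g m * ((\<rho> ^ (2 * m + n)) ^ l * \<rho> ^ (2 * m + n) / r ^ n)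
      + ?g m * ((\<rho> ^ (2 * m + n)) ^ l * (\<rho> / r) ^ (2 * m + n) / r ^ n)
      - ?g m * ((\<rho> ^ (2 * m + n)) ^ l * \<rho> ^ (2 * m + n) / r ^ n)
      = ?g m * ((\<rho> ^ (2 * m + n)) ^ l * mode_gap n \<rho> r m / r ^ n)" for m
  proof -
    have "G * (P * R / D) - G * (P * Q / D) + G * (P * U / D) - G * (P * Q / D) = G * (P * (R - 2 * Q + U) / D)"
      for G P R Q U D :: real by (simp add: algebra_simps add_divide_distrib diff_divide_distrib)
    then show ?thesis unfolding mode_gap_def .
  qed
  ultimately show ?thesis by simp
qed

lemma mode_gap_bounds:
  assumes "0 < \<rho>" "\<rho> < r" "r < 1"
  shows "0 \<le> mode_gap n \<rho> r m" "mode_gap n \<rho> r m \<le> r ^ (2 * m + n) + (\<rho> / r) ^ (2 * m + n)"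
proof -
  have "\<rho> \<le> \<rho> / r" using assms by (simp add: pos_le_divide_eq)
  then have "\<rho> ^ (2 * m + n) \<le> (\<rho> / r) ^ (2 * m + n)" "\<rho> ^ (2 * m + n) \<le> r ^ (2 * m + n)"
    using assms by (auto intro!: power_mono)
  then show "0 \<le> mode_gap n \<rho> r m" by (simp add: mode_gap_def)
  show "mode_gap n \<rho> r m \<le> r ^ (2 * m + n) + (\<rho> / r) ^ (2 * m + n)"
    using assms by (simp add: mode_gap_def)
qed

lemma one_minus_power_ge:
  fixes \<rho> :: real
  assumes "0 \<le> \<rho>" "\<rho> \<le> 1" "n \<ge> 1"
  shows "1 - \<rho> \<le> 1 - \<rho> ^ (2 * m + n)"
  using power_decreasing[of 1 "2 * m + n" \<rho>] assms by simp

lemma mode_weight_bounds: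
  assumes "0 < \<rho>" "\<rho> < r" "r < 1" "n \<ge> 1"
  shows "0 \<le> mode_weight n \<rho> r m" "mode_weight n \<rho> r m \<le> (r ^ (2 * m + n) + (\<rho> / r) ^ (2 * m + n)) / (1 - \<rho>)"
proof -
  have d: "1 - \<rho> \<le> 1 - \<rho> ^ (2 * m + n)" "1 - \<rho> > 0" using one_minus_power_ge[of \<rho> n m] assms by auto
  show "0 \<le> mode_weight n \<rho> r m"
    unfolding mode_weight_def using d mode_gap_bounds[OF assms(1-3)] by (intro divide_nonneg_nonneg) auto
  show "mode_weight n \<rho> r m \<le> (r ^ (2 * m + n) + (\<rho> / r) ^ (2 * m + n)) / (1 - \<rho>)"
    unfolding mode_weight_def using d mode_gap_bounds[OF assms(1-3), of n m] by (intro frac_le) linarith+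
qed

lemma summable_power_shift:
  fixes S :: "nat \<Rightarrow> real"
  assumes "\<And>a. 0 \<le> a \<Longrightarrow> a < 1 \<Longrightarrow> summable (\<lambda>m. S m * a ^ m)" "0 \<le> r" "r < 1"
  shows "summable (\<lambda>m. S m * r ^ (2 * m + n))"
    and "(\<Sum>m. S m * r ^ (2 * m + n)) = r ^ n * (\<Sum>m. S m * (r\<^sup>2) ^ m)"
proof -
  have e: "(\<lambda>m. S m * r ^ (2 * m + n)) = (\<lambda>m. r ^ n * (S m * (r\<^sup>2) ^ m))"
  proof
    fix m
    have "r ^ (2 * m + n) = r ^ n * (r\<^sup>2) ^ m" by (simp add: power_add power_mult)
    then show "S m * r ^ (2 * m + n) = r ^ n * (S m * (r\<^sup>2) ^ m)" by simp
  qed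
  have s: "summable (\<lambda>m. S m * (r\<^sup>2) ^ m)"
    by (rule assms(1)) (use assms(2,3) in \<open>auto simp: power_less_one_iff\<close>)
  show "summable (\<lambda>m. S m * r ^ (2 * m + n))" unfolding e by (rule summable_mult[OF s])
  show "(\<Sum>m. S m * r ^ (2 * m + n)) = r ^ n * (\<Sum>m. S m * (r\<^sup>2) ^ m)" unfolding e by (rule suminf_mult[OF s])
qed

lemma summable_mode_weight:
  fixes S :: "nat \<Rightarrow> real"
  assumes S: "\<And>m. S m \<ge> 0" "\<And>a. 0 \<le> a \<Longrightarrow> a < 1 \<Longrightarrow> summable (\<lambda>m. S m * a ^ m)"
    and r: "0 < \<rho>" "\<rho> < r" "r < 1" "n \<ge> 1"
  shows "summable (\<lambda>m. S m * mode_weight n \<rho> r m)"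
proof (rule summable_comparison_test'[where N=0])
  have "summable (\<lambda>m. (S m * r ^ (2 * m + n) + S m * (\<rho> / r) ^ (2 * m + n)) / (1 - \<rho>))"
    by (intro summable_divide summable_add summable_power_shift(1)[OF S(2)]) (use r in auto)
  then show "summable (\<lambda>m. S m * ((r ^ (2 * m + n) + (\<rho> / r) ^ (2 * m + n)) / (1 - \<rho>)))"
    by (simp add: distrib_left)
  show "norm (S m * mode_weight n \<rho> r m) \<le> S m * ((r ^ (2 * m + n) + (\<rho> / r) ^ (2 * m + n)) / (1 - \<rho>))" for m
    using mult_left_mono[OF mode_weight_bounds(2)[OF r, of m] S(1)[of m]]
      mode_weight_bounds(1)[OF r, of m] S(1)[of m] by (simp add: abs_mult)
qed

lemma gegenbauer_trig_summable: "n \<ge> 1 \<Longrightarrow> 0 \<le> a \<Longrightarrow> a < 1 \<Longrightarrow> summable (\<lambda>m. gegenbauer_trig (real n / 2) m 0 * a ^ m)"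
  using gegenbauer_trig_at_0_sums sums_summable by blast

lemma summable_gegenbauer_trig_mode_weight:
  assumes r: "0 < \<rho>" "\<rho> < r" "r < 1" and n: "n \<ge> 1"
  shows "summable (\<lambda>m. \<bar>gegenbauer_trig (real n / 2) m \<theta> * mode_weight n \<rho> r m\<bar>)"
proof (rule summable_comparison_test'[where N=0])
  have g: "\<bar>gegenbauer_trig (real n / 2) m \<theta>\<bar> \<le> gegenbauer_trig (real n / 2) m 0" for m \<theta>
    using n by (intro abs_gegenbauer_trig_le) auto
  then have "gegenbauer_trig (real n / 2) m 0 \<ge> 0" for m using order.trans[OF abs_ge_zero, of _ "gegenbauer_trig (real n / 2) m 0"] by blast
  then show "summable (\<lambda>m. gegenbauer_trig (real n / 2) m 0 * mode_weight n \<rho> r m)"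
    using gegenbauer_trig_summable[OF n] by (intro summable_mode_weight r n)
  show "norm \<bar>gegenbauer_trig (real n / 2) m \<theta> * mode_weight n \<rho> r m\<bar> \<le> gegenbauer_trig (real n / 2) m 0 * mode_weight n \<rho> r m" for m
    using mode_weight_bounds[OF r n, of m] g[of m \<theta>] by (simp add: abs_mult mult_right_mono)
qed

text \<open>
  The partial sums over the images are finite geometric sums in \<open>\<rho>\<^sup>\<sigma>\<close>, so the order of the two
  summations need not be exchanged for infinite sums: the remainder is at most \<open>\<rho>\<^sup>L\<close> times an absolutely
  convergent series.
\<close>
lemma image_sum_eq:
  fixes x y :: "real^'n::finite"
  assumes N3: "CARD('n) \<ge> 3" and r: "0 < \<rho>" "\<rho> < r" "r < 1" "norm x = r" "norm y = r" "x \<bullet> y = r\<^sup>2 * cos \<theta>"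
  defines "n \<equiv> CARD('n) - 2"
  shows "image_sum \<rho> y x = (\<Sum>m. gegenbauer_trig (real n / 2) m \<theta> * mode_weight n \<rho> r m) / r ^ n"
proof -
  have n1: "n \<ge> 1" using N3 by (simp add: n_def)
  have r0: "r > 0" and \<rho>: "0 < \<rho>" "\<rho> < 1" using r by auto
  define a where "a m = gegenbauer_trig (real n / 2) m \<theta> * mode_weight n \<rho> r m / r ^ n" for m
  have abs_a: "summable (\<lambda>m. \<bar>a m\<bar>)"
    using summable_divide[OF summable_gegenbauer_trig_mode_weight[OF r(1-3) n1, of \<theta>], of "r ^ n"] r0
    by (simp add: a_def abs_mult)
  then have sum_a: "summable a" by (rule summable_rabs_cancel)
  define A where "A = (\<Sum>m. \<bar>a m\<bar>)"
  have pw: "\<rho> ^ (2 * m + n) < 1" "0 < \<rho> ^ (2 * m + n)" "\<rho> ^ (2 * m + n) \<le> \<rho>" for m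
    using one_minus_power_ge[of \<rho> n m] \<rho> n1 by auto
  have sm: "summable (\<lambda>m. a m * (\<rho> ^ (2 * m + n)) ^ L)" for L
    using abs_a
  proof (rule summable_comparison_test'[where N=0])
    show "norm (a m * (\<rho> ^ (2 * m + n)) ^ L) \<le> \<bar>a m\<bar>" for m
      using pw[of m] \<rho> by (auto simp: abs_mult intro!: mult_left_le power_le_one)
  qed
  have partial: "(\<Sum>l<L. image_term \<rho> y l x) = (\<Sum>m. a m) - (\<Sum>m. a m * (\<rho> ^ (2 * m + n)) ^ L)" for L
  proof -
    have "(\<lambda>m. \<Sum>l<L. gegenbauer_trig (real n / 2) m \<theta> * ((\<rho> ^ (2 * m + n)) ^ l * mode_gap n \<rho> r m / r ^ n))
        sums (\<Sum>l<L. image_term \<rho> y l x)"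
      unfolding n_def by (intro sums_sum image_term_sums N3 r)
    moreover have "(\<Sum>l<L. gegenbauer_trig (real n / 2) m \<theta> * ((\<rho> ^ (2 * m + n)) ^ l * mode_gap n \<rho> r m / r ^ n))
        = a m - a m * (\<rho> ^ (2 * m + n)) ^ L" for m
    proof -
      have "(\<Sum>l<L. gegenbauer_trig (real n / 2) m \<theta> * ((\<rho> ^ (2 * m + n)) ^ l * mode_gap n \<rho> r m / r ^ n))
        = gegenbauer_trig (real n / 2) m \<theta> * (mode_gap n \<rho> r m / r ^ n) * (\<Sum>l<L. (\<rho> ^ (2 * m + n)) ^ l)"
        unfolding sum_distrib_left by (intro sum.cong refl) simp
      also have "(\<Sum>l<L. (\<rho> ^ (2 * m + n)) ^ l) = (1 - (\<rho> ^ (2 * m + n)) ^ L) / (1 - \<rho> ^ (2 * m + n))"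
        using pw(1)[of m] by (simp add: sum_gp_strict)
      finally show ?thesis
        by (simp add: a_def mode_weight_def right_diff_distrib diff_divide_distrib mult_ac)
    qed
    ultimately have "(\<lambda>m. a m - a m * (\<rho> ^ (2 * m + n)) ^ L) sums (\<Sum>l<L. image_term \<rho> y l x)"
      by simp
    then show ?thesis
      using suminf_diff[OF sum_a sm[of L]] by (simp add: sums_iff)
  qed
  have "(\<lambda>L. \<Sum>m. a m * (\<rho> ^ (2 * m + n)) ^ L) \<longlonglongrightarrow> 0"
  proof (rule Lim_null_comparison)
    show "\<forall>\<^sub>F L in sequentially. norm (\<Sum>m. a m * (\<rho> ^ (2 * m + n)) ^ L) \<le> A * \<rho> ^ L"
    proof (intro always_eventually allI)
      fix L
      have le: "\<bar>a m * (\<rho> ^ (2 * m + n)) ^ L\<bar> \<le> \<bar>a m\<bar> * \<rho> ^ L" for m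
        using power_mono[OF pw(3)[of m], of L] pw(2)[of m] by (simp add: abs_mult mult_left_mono)
      have s1: "summable (\<lambda>m. \<bar>a m\<bar> * \<rho> ^ L)" using abs_a by (rule summable_mult2)
      have s2: "summable (\<lambda>m. \<bar>a m * (\<rho> ^ (2 * m + n)) ^ L\<bar>)"
        by (rule summable_comparison_test'[OF s1, of 0]) (use le in simp)
      have "norm (\<Sum>m. a m * (\<rho> ^ (2 * m + n)) ^ L) \<le> (\<Sum>m. \<bar>a m * (\<rho> ^ (2 * m + n)) ^ L\<bar>)"
        using summable_rabs[OF s2] by simp
      also have "\<dots> \<le> (\<Sum>m. \<bar>a m\<bar> * \<rho> ^ L)" by (rule suminf_le[OF le s2 s1])
      also have "\<dots> = A * \<rho> ^ L" unfolding A_def by (rule suminf_mult2[OF abs_a, symmetric])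
      finally show "norm (\<Sum>m. a m * (\<rho> ^ (2 * m + n)) ^ L) \<le> A * \<rho> ^ L" .
    qed
    have "(\<lambda>L. A * \<rho> ^ L) \<longlonglongrightarrow> A * 0"
      using \<rho> by (intro tendsto_intros LIMSEQ_power_zero) auto
    then show "(\<lambda>L. A * \<rho> ^ L) \<longlonglongrightarrow> 0" by simp
  qed
  then have "(\<lambda>L. \<Sum>l<L. image_term \<rho> y l x) \<longlonglongrightarrow> (\<Sum>m. a m) - 0"
    unfolding partial by (intro tendsto_intros)
  then have "image_sum \<rho> y x = (\<Sum>m. a m)"
    unfolding image_sum_def by (simp add: sums_def[symmetric] sums_iff)
  also have "\<dots> = (\<Sum>m. gegenbauer_trig (real n / 2) m \<theta> * mode_weight n \<rho> r m) / r ^ n"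
    unfolding a_def by (rule suminf_divide) (rule summable_rabs_cancel[OF summable_gegenbauer_trig_mode_weight[OF r(1-3) n1]])
  finally show ?thesis .
qed

lemma xi_1: "xi p q k r 1 = r *\<^sub>R axis p 1"
  by (simp add: xi_def vec_eq_iff axis_def)

lemma xi_1_inner: "xi p q k r 1 \<bullet> xi p q k r (j + 1) = r\<^sup>2 * cos (2 * pi * real j / real k)"
  unfolding xi_1 by (simp add: inner_axis' xi_def power2_eq_square)

lemma norm_xi:
  assumes "p \<noteq> q" "r \<ge> 0"
  shows "norm (xi p q k r j) = r"
proof (rule power2_eq_imp_eq)
  let ?t = "2 * pi * (real j - 1) / real k"
  have "(norm (xi p q k r j))\<^sup>2 = (\<Sum>i\<in>UNIV. (if i = p then (r * cos ?t)\<^sup>2 else 0) + (if i = q then (r * sin ?t)\<^sup>2 else 0))"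
    unfolding power2_norm_eq_inner inner_vec_def
    by (intro sum.cong) (use assms(1) in \<open>auto simp: xi_def power2_eq_square\<close>)
  also have "\<dots> = r\<^sup>2 * ((sin ?t)\<^sup>2 + (cos ?t)\<^sup>2)"
    unfolding sum.distrib by (simp add: power_mult_distrib distrib_left del: sin_cos_squared_add)
  finally show "(norm (xi p q k r j))\<^sup>2 = r\<^sup>2" by simp
qed (use assms in auto)

text \<open>
  The regular part of the interaction, multiplied by the factor \<open>r\<^sup>n\<close> and freed of the constant of \<open>fund_sol\<close>.
\<close>
definition polygon_sum :: "nat \<Rightarrow> nat \<Rightarrow> real \<Rightarrow> real \<Rightarrow> real" where
  "polygon_sum n k \<rho> r = (\<Sum>m. polygon_coeff n k m * mode_weight n \<rho> r m)"

text \<open>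
  The singular parts of the Green functions at the distances \<open>2 r sin (\<pi> j / k)\<close> add up to \<open>C_const\<close>
  divided by \<open>r\<^sup>n\<close>, in units of the constant of \<open>fund_sol\<close>; the
  regular parts, together with the Robin function as the term \<open>j = 0\<close>, form a sum over the whole polygon.
\<close>
lemma Lambda1_eq:
  fixes p q :: "'n::finite"
  assumes N3: "CARD('n) \<ge> 3" and pq: "p \<noteq> q" and k: "k \<ge> 2" and r: "0 < \<rho>" "\<rho> < r" "r < 1"
  defines "n \<equiv> CARD('n) - 2"
  shows "Lambda1 p q k \<rho> r
    = 1 / (sphere_area TYPE('n) * (real CARD('n) - 2)) / r ^ n * (polygon_sum n k \<rho> r - C_const k CARD('n))"
proof -
  have n1: "n \<ge> 1" using N3 by (simp add: n_def)
  define c0 where "c0 = 1 / (sphere_area TYPE('n) * (real CARD('n) - 2))"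
  define x where "x j = xi p q k r (j + 1)" for j
  define th where "th j = 2 * pi * real j / real k" for j
  have nx: "norm (x j) = r" for j unfolding x_def by (rule norm_xi[OF pq]) (use r in simp)
  have mem: "x j \<in> annulus \<rho>" for j using nx r by (simp add: annulus_def)
  have ip: "x 0 \<bullet> x j = r\<^sup>2 * cos (th j)" for j
    unfolding x_def th_def using xi_1_inner[of p q k r j] by simp
  have I: "image_sum \<rho> (x j) (x 0) = (\<Sum>m. gegenbauer_trig (real n / 2) m (th j) * mode_weight n \<rho> r m) / r ^ n" for j
    unfolding n_def by (rule image_sum_eq[OF N3 r nx nx ip])
  have dist: "norm (x 0 - x j) = 2 * r * sin (pi * real j / real k)" if "j \<le> k" for j
  proof (rule power2_eq_imp_eq)
    have "(norm (x 0 - x j))\<^sup>2 = 2 * r\<^sup>2 * (1 - cos (th j))"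
      unfolding power2_norm_eq_inner using inner_combination[of 1 "x 0" 1 "x j"] nx ip
      by (simp add: algebra_simps)
    also have "cos (th j) = 1 - 2 * (sin (pi * real j / real k))\<^sup>2"
      unfolding th_def using cos_double_sin[of "pi * real j / real k"] by (simp add: mult_ac)
    finally show "(norm (x 0 - x j))\<^sup>2 = (2 * r * sin (pi * real j / real k))\<^sup>2"
      by (simp add: power_mult_distrib)
    have "pi * real j / real k \<le> pi * 1"
      using that k by (simp add: divide_le_eq)
    then show "0 \<le> 2 * r * sin (pi * real j / real k)"
      using r by (intro mult_nonneg_nonneg sin_ge_zero) auto
  qed simp
  have pos: "norm (x 0 - x j) > 0" if "1 \<le> j" "j \<le> k - 1" for j
  proof -
    have "0 < sin (pi * real j / real k)"
      using that k by (intro sin_gt_zero) (auto simp: divide_less_eq)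
    then show ?thesis using dist[of j] that r by simp
  qed
  have g: "green (annulus \<rho>) (x 0) (x j) = c0 * (1 / (2 * r * sin (pi * real j / real k)) ^ n) - c0 * image_sum \<rho> (x j) (x 0)"
    if "1 \<le> j" "j \<le> k - 1" for j
  proof -
    have "x 0 \<noteq> x j" using pos[OF that] by auto
    then have "green (annulus \<rho>) (x 0) (x j) = annulus_green \<rho> (x j) (x 0)"
      by (intro green_annulus N3 mem) (use r in auto)
    then show ?thesis
      using dist[of j] that by (simp add: annulus_green_def fund_sol_def c0_def n_def)
  qed
  have rob: "robin (annulus \<rho>) (x 0) = c0 * image_sum \<rho> (x 0) (x 0)"
    unfolding c0_def by (rule robin_annulus[OF N3 _ _ mem]) (use r in auto)
  have "Lambda1 p q k \<rho> r = robin (annulus \<rho>) (x 0) - (\<Sum>j=1..k-1. green (annulus \<rho>) (x 0) (x j))"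
    by (simp add: Lambda1_def x_def)
  also have "(\<Sum>j=1..k-1. green (annulus \<rho>) (x 0) (x j))
      = (\<Sum>j=1..k-1. c0 * (1 / (2 * r * sin (pi * real j / real k)) ^ n) - c0 * image_sum \<rho> (x j) (x 0))"
    by (intro sum.cong g) auto
  also have "\<dots> = c0 * (C_const k CARD('n) / r ^ n) - c0 * (\<Sum>j=1..k-1. image_sum \<rho> (x j) (x 0))"
  proof -
    have "(\<Sum>j=1..k-1. 1 / (2 * r * sin (pi * real j / real k)) ^ n) = C_const k CARD('n) / r ^ n"
      by (simp add: C_const_def n_def[symmetric] sum_divide_distrib power_mult_distrib mult_ac)
    then show ?thesis by (simp only: sum_subtractf sum_distrib_left[symmetric])
  qed
  finally have 1: "Lambda1 p q k \<rho> r = c0 * (image_sum \<rho> (x 0) (x 0) + (\<Sum>j=1..k-1. image_sum \<rho> (x j) (x 0)) - C_const k CARD('n) / r ^ n)"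
    unfolding rob by (simp add: algebra_simps)
  have split: "{..<k} = insert 0 {1..k-1}" using k by auto
  have "image_sum \<rho> (x 0) (x 0) + (\<Sum>j=1..k-1. image_sum \<rho> (x j) (x 0)) = (\<Sum>j<k. image_sum \<rho> (x j) (x 0))"
    unfolding split by simp
  also have "\<dots> = (\<Sum>j<k. (\<Sum>m. gegenbauer_trig (real n / 2) m (th j) * mode_weight n \<rho> r m)) / r ^ n"
    unfolding I by (simp add: sum_divide_distrib)
  also have "(\<Sum>j<k. (\<Sum>m. gegenbauer_trig (real n / 2) m (th j) * mode_weight n \<rho> r m)) = polygon_sum n k \<rho> r"
    unfolding polygon_sum_def polygon_coeff_def sum_distrib_right th_def
    by (rule suminf_sum[symmetric]) (rule summable_rabs_cancel[OF summable_gegenbauer_trig_mode_weight[OF r n1]])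
  finally show ?thesis
    unfolding 1 c0_def[symmetric] by (simp add: diff_divide_distrib right_diff_distrib)
qed


section \<open>Minimisation over the radius\<close>

text \<open>
  The function \<open>g\<close> whose comparison with \<open>C_const\<close> decides the sign of the minimum; its argument is
  \<open>\<surd>\<rho>\<close>, which makes all exponents natural numbers.
\<close>
definition polygon_min :: "nat \<Rightarrow> nat \<Rightarrow> real \<Rightarrow> real" where
  "polygon_min n k t = (\<Sum>m. polygon_coeff n k m * (2 * t ^ (2 * m + n) / (1 + t ^ (2 * m + n))))"

lemma polygon_power_summable:
  assumes "n \<ge> 1" "k \<ge> 1" "0 \<le> t" "t < 1"
  shows "summable (\<lambda>m. polygon_coeff n k m * t ^ (2 * m + n))"
    and "(t / (1 - t\<^sup>2)) ^ n \<le> (\<Sum>m. polygon_coeff n k m * t ^ (2 * m + n))"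
    and "(\<Sum>m. polygon_coeff n k m * t ^ (2 * m + n)) \<le> real k * (t / (1 - t\<^sup>2)) ^ n"
proof -
  have t2: "0 \<le> t\<^sup>2" "t\<^sup>2 < 1" using assms by (auto simp: power_less_one_iff)
  note S = polygon_coeff_summable[OF assms(1,2)]
  show "summable (\<lambda>m. polygon_coeff n k m * t ^ (2 * m + n))"
    by (rule summable_power_shift(1)[OF S(1) assms(3,4)])
  have e: "(\<Sum>m. polygon_coeff n k m * t ^ (2 * m + n)) = t ^ n * (\<Sum>m. polygon_coeff n k m * (t\<^sup>2) ^ m)"
    by (rule summable_power_shift(2)[OF S(1) assms(3,4)])
  show "(t / (1 - t\<^sup>2)) ^ n \<le> (\<Sum>m. polygon_coeff n k m * t ^ (2 * m + n))"
    unfolding e using mult_left_mono[OF S(3)[OF t2], of "t ^ n"] assms(3) by (simp add: power_divide)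
  show "(\<Sum>m. polygon_coeff n k m * t ^ (2 * m + n)) \<le> real k * (t / (1 - t\<^sup>2)) ^ n"
    unfolding e using mult_left_mono[OF S(2)[OF t2], of "t ^ n"] assms(3) by (simp add: power_divide mult_ac)
qed

text \<open>
  The radius \<open>1 - 1 / (4 M)\<close> is an explicit witness that \<open>t / (1 - t\<^sup>2)\<close> tends to infinity at \<open>1\<close>; explicit
  witnesses replace limits in the existence proofs below.
\<close>
lemma ratio_power_large:
  fixes t M :: real
  assumes M: "M \<ge> 1" and t: "1 - 1 / (4 * M) \<le> t" "t < 1" and n: "n \<ge> 1"
  shows "M \<le> (t / (1 - t\<^sup>2)) ^ n"
proof -
  have M4: "1 / (4 * M) \<le> 1 / 4" using M by (simp add: field_simps)
  then have t34: "t \<ge> 3 / 4" using t by linarith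
  have pos: "1 - t\<^sup>2 > 0" using t t34 by (simp add: power_less_one_iff)
  have "1 - t\<^sup>2 = (1 - t) * (1 + t)" by (simp add: power2_eq_square algebra_simps)
  also have "\<dots> \<le> (1 / (4 * M)) * 2" using t t34 M by (intro mult_mono) auto
  finally have "M * (1 - t\<^sup>2) \<le> M * ((1 / (4 * M)) * 2)" using M by (intro mult_left_mono) auto
  also have "\<dots> \<le> t" using M t34 by simp
  finally have "M \<le> t / (1 - t\<^sup>2)" using pos by (simp add: pos_le_divide_eq)
  also have "\<dots> = (t / (1 - t\<^sup>2)) ^ 1" by simp
  also have "\<dots> \<le> (t / (1 - t\<^sup>2)) ^ n" using calculation M n by (intro power_increasing) auto
  finally show ?thesis .
qed

lemma fraction_mono:
  fixes u v :: real
  assumes "0 \<le> u" "u \<le> v"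
  shows "2 * u / (1 + u) \<le> 2 * v / (1 + v)"
  using assms by (simp add: field_simps)

lemma fraction_strict_mono:
  fixes u v :: real
  assumes "0 \<le> u" "u < v"
  shows "2 * u / (1 + u) < 2 * v / (1 + v)"
  using assms by (simp add: field_simps)

lemma fraction_bounds:
  fixes u :: real
  assumes "0 \<le> u" "u \<le> 1"
  shows "u \<le> 2 * u / (1 + u)" "2 * u / (1 + u) \<le> 2 * u" "u > 0 \<Longrightarrow> 2 * u / (1 + u) < 2 * u"
  using assms mult_left_mono[OF assms(2,1)] by (auto simp: field_simps)

lemma sqrt_between:
  assumes \<rho>: "0 < (\<rho>::real)" "\<rho> < 1"
  shows "\<rho> < sqrt \<rho>" "sqrt \<rho> < 1" "0 < sqrt \<rho>"
proof -
  show s: "sqrt \<rho> < 1" "0 < sqrt \<rho>" using \<rho> by auto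
  have "sqrt \<rho> * sqrt \<rho> < sqrt \<rho> * 1" using s by (intro mult_strict_left_mono) auto
  then show "\<rho> < sqrt \<rho>" using \<rho> by simp
qed

context
  fixes n k :: nat
  assumes n: "n \<ge> 1" and k: "k \<ge> 1"
begin

lemma polygon_min_summable:
  assumes t: "0 \<le> t" "t < 1"
  shows "summable (\<lambda>m. polygon_coeff n k m * (2 * t ^ (2 * m + n) / (1 + t ^ (2 * m + n))))"
proof (rule summable_comparison_test'[where N=0])
  show "summable (\<lambda>m. 2 * (polygon_coeff n k m * t ^ (2 * m + n)))"
    by (intro summable_mult polygon_power_summable(1) n k t)
  fix m
  have "polygon_coeff n k m * (2 * t ^ (2 * m + n) / (1 + t ^ (2 * m + n))) \<le> polygon_coeff n k m * (2 * t ^ (2 * m + n))"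
    using t by (intro mult_left_mono fraction_bounds(2) polygon_coeff_nonneg n k) (auto simp: power_le_one)
  then show "norm (polygon_coeff n k m * (2 * t ^ (2 * m + n) / (1 + t ^ (2 * m + n)))) \<le> 2 * (polygon_coeff n k m * t ^ (2 * m + n))"
    using t polygon_coeff_nonneg[OF n k, of m] by simp
qed

lemma polygon_min_strict_mono:
  assumes "0 \<le> a" "a < b" "b < 1"
  shows "polygon_min n k a < polygon_min n k b"
proof -
  let ?f = "\<lambda>t m. polygon_coeff n k m * (2 * t ^ (2 * m + n) / (1 + t ^ (2 * m + n)))"
  have s: "summable (?f a)" "summable (?f b)" using polygon_min_summable assms by auto
  have "0 < (\<Sum>m. ?f b m - ?f a m)"
  proof (rule suminf_pos2[where i=0])
    show "summable (\<lambda>m. ?f b m - ?f a m)" by (rule summable_diff[OF s(2,1)])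
    show "0 \<le> ?f b m - ?f a m" for m
      unfolding diff_ge_0_iff_ge using assms
      by (intro mult_left_mono fraction_mono power_mono polygon_coeff_nonneg n k) auto
    have "a ^ n < b ^ n" using assms n by (intro power_strict_mono) auto
    then have "2 * a ^ n / (1 + a ^ n) < 2 * b ^ n / (1 + b ^ n)" using assms by (intro fraction_strict_mono) auto
    then have "real k * (2 * a ^ n / (1 + a ^ n)) < real k * (2 * b ^ n / (1 + b ^ n))"
      using k by (intro mult_strict_left_mono) auto
    then show "0 < ?f b 0 - ?f a 0" by (simp add: polygon_coeff_0)
  qed
  then show ?thesis using suminf_diff[OF s(2,1)] by (simp add: polygon_min_def)
qed

lemma polygon_min_less_iff:
  assumes "0 \<le> a" "a < 1" "0 \<le> b" "b < 1"
  shows "polygon_min n k a < polygon_min n k b \<longleftrightarrow> a < b"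
  using polygon_min_strict_mono[of a b] polygon_min_strict_mono[of b a] assms by (cases a b rule: linorder_cases) auto

lemma polygon_min_lower:
  assumes t: "0 \<le> t" "t < 1"
  shows "(t / (1 - t\<^sup>2)) ^ n \<le> polygon_min n k t"
proof -
  have "(\<Sum>m. polygon_coeff n k m * t ^ (2 * m + n)) \<le> polygon_min n k t"
    unfolding polygon_min_def
    by (intro suminf_le polygon_power_summable(1) polygon_min_summable n k t mult_left_mono fraction_bounds polygon_coeff_nonneg)
      (use t in \<open>auto simp: power_le_one\<close>)
  then show ?thesis using polygon_power_summable(2)[OF n k t] by linarith
qed

lemma polygon_min_upper:
  assumes t: "0 < t" "t < 1"
  shows "polygon_min n k t < 2 * real k * (t / (1 - t\<^sup>2)) ^ n"
proof -
  let ?f = "\<lambda>m. polygon_coeff n k m * (2 * t ^ (2 * m + n) / (1 + t ^ (2 * m + n)))"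
  let ?g = "\<lambda>m. 2 * (polygon_coeff n k m * t ^ (2 * m + n))"
  have t0: "0 \<le> t" using t by simp
  have s: "summable ?g" "summable ?f"
    using summable_mult[OF polygon_power_summable(1)[OF n k t0 t(2)]] polygon_min_summable[OF t0 t(2)] by auto
  have "0 < (\<Sum>m. ?g m - ?f m)"
  proof (rule suminf_pos2[where i=0])
    show "summable (\<lambda>m. ?g m - ?f m)" by (rule summable_diff[OF s])
    fix m
    have "polygon_coeff n k m * (2 * t ^ (2 * m + n) / (1 + t ^ (2 * m + n))) \<le> polygon_coeff n k m * (2 * t ^ (2 * m + n))"
      using t by (intro mult_left_mono fraction_bounds(2) polygon_coeff_nonneg n k) (auto simp: power_le_one)
    then show "0 \<le> ?g m - ?f m" by simp
  next
    have "2 * t ^ n / (1 + t ^ n) < 2 * t ^ n"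
      using t by (intro fraction_bounds(3)) (auto simp: power_le_one)
    then have "real k * (2 * t ^ n / (1 + t ^ n)) < real k * (2 * t ^ n)"
      using k by (intro mult_strict_left_mono) auto
    then show "0 < ?g 0 - ?f 0" by (simp add: polygon_coeff_0)
  qed
  then have "polygon_min n k t < (\<Sum>m. ?g m)"
    using suminf_diff[OF s] by (simp add: polygon_min_def)
  also have "\<dots> = 2 * (\<Sum>m. polygon_coeff n k m * t ^ (2 * m + n))"
    by (rule suminf_mult[OF polygon_power_summable(1)[OF n k t0 t(2)]])
  also have "\<dots> \<le> 2 * (real k * (t / (1 - t\<^sup>2)) ^ n)"
    using polygon_power_summable(3)[OF n k t0 t(2)] by simp
  finally show ?thesis by simp
qed

lemma polygon_min_continuous:
  assumes b: "0 \<le> b" "b < 1"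
  shows "continuous_on {0..b} (polygon_min n k)"
proof (rule uniform_limit_theorem)
  let ?f = "\<lambda>t m. polygon_coeff n k m * (2 * t ^ (2 * m + n) / (1 + t ^ (2 * m + n)))"
  show "uniform_limit {0..b} (\<lambda>M t. \<Sum>m<M. ?f t m) (polygon_min n k) sequentially"
    unfolding polygon_min_def[abs_def]
  proof (rule Weierstrass_m_test)
    show "summable (\<lambda>m. 2 * (polygon_coeff n k m * b ^ (2 * m + n)))"
      by (intro summable_mult polygon_power_summable(1) n k b)
    fix m t assume t: "t \<in> {0..b}"
    have "2 * t ^ (2 * m + n) / (1 + t ^ (2 * m + n)) \<le> 2 * t ^ (2 * m + n)"
      using t b by (intro fraction_bounds(2)) (auto simp: power_le_one)
    also have "\<dots> \<le> 2 * b ^ (2 * m + n)" using t by (simp add: power_mono)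
    finally have "?f t m \<le> polygon_coeff n k m * (2 * b ^ (2 * m + n))"
      by (intro mult_left_mono polygon_coeff_nonneg n k)
    then show "norm (?f t m) \<le> 2 * (polygon_coeff n k m * b ^ (2 * m + n))"
      using t polygon_coeff_nonneg[OF n k, of m] by simp
  qed
  show "\<forall>\<^sub>F M in sequentially. continuous_on {0..b} (\<lambda>t. \<Sum>m<M. ?f t m)"
  proof (intro always_eventually allI continuous_intros ballI)
    fix m :: nat and t assume "t \<in> {0..b}"
    then have "t ^ (2 * m + n) \<ge> 0" by simp
    then show "1 + t ^ (2 * m + n) \<noteq> 0" by linarith
  qed
qed simp

lemma polygon_min_root:
  assumes C: "C > 0"
  obtains t where "0 < t" "t < 1" "polygon_min n k t = C"
proof -
  define a where "a = min (1 / 2) (C / (8 * real k))"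
  have a: "0 < a" "a \<le> 1 / 2" "a \<le> C / (8 * real k)" using C k by (auto simp: a_def)
  have a2: "a\<^sup>2 \<le> 1 / 4" using power_mono[of a "1/2" 2] a by (simp add: power2_eq_square)
  have x: "a / (1 - a\<^sup>2) \<le> 2 * a"
    using a a2 mult_left_mono[of "1/2" "1 - a\<^sup>2" "2 * a"] by (simp add: pos_divide_le_eq)
  have x0: "0 \<le> a / (1 - a\<^sup>2)" using a a2 by simp
  have "(a / (1 - a\<^sup>2)) ^ n \<le> (a / (1 - a\<^sup>2)) ^ 1"
    using x x0 a n by (intro power_decreasing) auto
  then have "(a / (1 - a\<^sup>2)) ^ n \<le> 2 * a" using x by simp
  then have "2 * real k * (a / (1 - a\<^sup>2)) ^ n \<le> 2 * real k * (2 * a)" by (intro mult_left_mono) auto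
  also have "\<dots> \<le> C" using a(3) C k by (simp add: field_simps)
  finally have low: "polygon_min n k a \<le> C" using polygon_min_upper[of a] a by simp
  define M where "M = max 1 C"
  define b where "b = 1 - 1 / (4 * M)"
  have M: "M \<ge> 1" "M \<ge> C" by (auto simp: M_def)
  have M4: "1 / (4 * M) \<le> 1 / 4" "1 / (4 * M) > 0" using M by (simp_all add: field_simps)
  then have b: "b < 1" "b \<ge> 3 / 4" by (auto simp: b_def)
  have high: "C \<le> polygon_min n k b"
    using ratio_power_large[OF M(1) _ b(1) n] polygon_min_lower[of b] b M by (simp add: b_def)
  have "continuous_on {a..b} (polygon_min n k)"
    by (rule continuous_on_subset[OF polygon_min_continuous[of b]]) (use a b in auto)
  then obtain t where t: "a \<le> t" "t \<le> b" "polygon_min n k t = C"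
    using IVT'[of "polygon_min n k" a C b] low high a b by auto
  show thesis by (rule that[OF _ _ t(3)]) (use t a b in linarith)+
qed

lemma polygon_sum_at_sqrt:
  assumes \<rho>: "0 < \<rho>" "\<rho> < 1"
  shows "polygon_sum n k \<rho> (sqrt \<rho>) = polygon_min n k (sqrt \<rho>)"
proof -
  have "mode_weight n \<rho> (sqrt \<rho>) m = 2 * sqrt \<rho> ^ (2 * m + n) / (1 + sqrt \<rho> ^ (2 * m + n))" for m
  proof -
    \<comment> \<open>at this radius \<open>r\<^sup>\<sigma>\<close> and \<open>(\<rho> / r)\<^sup>\<sigma>\<close> are both \<open>u\<close>, and \<open>\<rho>\<^sup>\<sigma> = u\<^sup>2\<close>\<close>
    define u where "u = sqrt \<rho> ^ (2 * m + n)"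
    have u: "0 < u" "u < 1" using \<rho> n by (auto simp: u_def power_less_one_iff)
    have "\<rho> ^ (2 * m + n) = u\<^sup>2"
      using \<rho> by (simp add: u_def power2_eq_square flip: power_mult_distrib)
    moreover have "\<rho> / sqrt \<rho> = sqrt \<rho>" using \<rho> by (simp add: real_div_sqrt)
    ultimately have "mode_weight n \<rho> (sqrt \<rho>) m = (u - 2 * u\<^sup>2 + u) / (1 - u\<^sup>2)"
      by (simp add: mode_weight_def mode_gap_def u_def)
    also have "\<dots> = 2 * u * (1 - u) / ((1 + u) * (1 - u))"
      by (simp add: power2_eq_square algebra_simps)
    also have "\<dots> = 2 * u / (1 + u)" using u by simp
    finally show ?thesis by (simp add: u_def)
  qed
  then show ?thesis by (simp add: polygon_sum_def polygon_min_def)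
qed

text \<open>
  The numbers \<open>r\<^sup>\<sigma>\<close> and \<open>(\<rho> / r)\<^sup>\<sigma>\<close> have the product \<open>\<rho>\<^sup>\<sigma>\<close>, which does not depend on \<open>r\<close>, so their sum is
  least when they are equal.
\<close>
lemma mode_weight_min:
  assumes r: "0 < \<rho>" "\<rho> < r" "r < 1"
  shows "mode_weight n \<rho> (sqrt \<rho>) m \<le> mode_weight n \<rho> r m"
proof -
  let ?s = "2 * m + n"
  have "sqrt (r ^ ?s * (\<rho> / r) ^ ?s) \<le> (r ^ ?s + (\<rho> / r) ^ ?s) / 2"
    using r by (intro arith_geo_mean_sqrt) auto
  moreover have "r ^ ?s * (\<rho> / r) ^ ?s = \<rho> ^ ?s"
    using r by (simp flip: power_mult_distrib)
  moreover have "\<rho> / sqrt \<rho> = sqrt \<rho>" using r by (simp add: real_div_sqrt)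
  ultimately have "mode_gap n \<rho> (sqrt \<rho>) m \<le> mode_gap n \<rho> r m"
    by (simp add: mode_gap_def real_sqrt_power)
  moreover have "1 - \<rho> ^ ?s > 0" using one_minus_power_ge[of \<rho> n m] r n by auto
  ultimately show ?thesis by (simp add: mode_weight_def divide_right_mono)
qed

lemma summable_polygon_sum:
  assumes r: "0 < \<rho>" "\<rho> < r" "r < 1"
  shows "summable (\<lambda>m. polygon_coeff n k m * mode_weight n \<rho> r m)"
  by (rule summable_mode_weight[OF polygon_coeff_nonneg[OF n k] polygon_coeff_summable(1)[OF n k] r n])

lemma polygon_sum_ge_polygon_min:
  assumes r: "0 < \<rho>" "\<rho> < r" "r < 1"
  shows "polygon_min n k (sqrt \<rho>) \<le> polygon_sum n k \<rho> r"
proof -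
  have \<rho>: "0 < \<rho>" "\<rho> < 1" using r by auto
  show ?thesis
    unfolding polygon_sum_at_sqrt[OF \<rho>, symmetric] polygon_sum_def
    by (intro suminf_le summable_polygon_sum mult_left_mono mode_weight_min polygon_coeff_nonneg n k)
      (use r sqrt_between[OF \<rho>] in auto)
qed

text \<open>
  All modes are nonnegative, so the series may be bounded below by dropping either power of \<open>r\<close>; the
  remaining one blows up at one end of \<open>(\<rho>,1)\<close>.
\<close>
lemma polygon_sum_lower:
  assumes r: "0 < \<rho>" "\<rho> < r" "r < 1"
  defines "A \<equiv> (\<Sum>m. polygon_coeff n k m * \<rho> ^ (2 * m + n))"
  shows "(r / (1 - r\<^sup>2)) ^ n - 2 * A \<le> polygon_sum n k \<rho> r"
    and "((\<rho> / r) / (1 - (\<rho> / r)\<^sup>2)) ^ n - 2 * A \<le> polygon_sum n k \<rho> r"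
proof -
  have sA: "summable (\<lambda>m. polygon_coeff n k m * \<rho> ^ (2 * m + n))"
    by (rule polygon_power_summable(1)[OF n k]) (use r in auto)
  have gen: "(u / (1 - u\<^sup>2)) ^ n - 2 * A \<le> polygon_sum n k \<rho> r"
    if u: "0 \<le> u" "u < 1" and le: "\<And>m. u ^ (2 * m + n) - 2 * \<rho> ^ (2 * m + n) \<le> mode_gap n \<rho> r m" for u
  proof -
    have sU: "summable (\<lambda>m. polygon_coeff n k m * u ^ (2 * m + n))"
      by (rule polygon_power_summable(1)[OF n k u])
    have "(\<Sum>m. polygon_coeff n k m * u ^ (2 * m + n)) - 2 * A
      = (\<Sum>m. polygon_coeff n k m * u ^ (2 * m + n) - 2 * (polygon_coeff n k m * \<rho> ^ (2 * m + n)))"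
      unfolding A_def suminf_mult[OF sA, symmetric] by (rule suminf_diff[OF sU summable_mult[OF sA]])
    also have "\<dots> \<le> polygon_sum n k \<rho> r"
      unfolding polygon_sum_def
    proof (rule suminf_le)
      fix m
      have d: "0 < 1 - \<rho> ^ (2 * m + n)" "1 - \<rho> ^ (2 * m + n) \<le> 1"
        using one_minus_power_ge[of \<rho> n m] r n by auto
      have "mode_gap n \<rho> r m \<le> mode_weight n \<rho> r m"
        unfolding mode_weight_def using d mode_gap_bounds(1)[OF r, of n m]
        by (simp add: pos_le_divide_eq mult_left_le)
      then have "u ^ (2 * m + n) - 2 * \<rho> ^ (2 * m + n) \<le> mode_weight n \<rho> r m" using le[of m] by linarith
      from mult_left_mono[OF this polygon_coeff_nonneg[OF n k, of m]]
      show "polygon_coeff n k m * u ^ (2 * m + n) - 2 * (polygon_coeff n k m * \<rho> ^ (2 * m + n)) \<le> polygon_coeff n k m * mode_weight n \<rho> r m"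
        by (simp add: algebra_simps)
    next
      show "summable (\<lambda>m. polygon_coeff n k m * u ^ (2 * m + n) - 2 * (polygon_coeff n k m * \<rho> ^ (2 * m + n)))"
        by (rule summable_diff[OF sU summable_mult[OF sA]])
    qed (rule summable_polygon_sum[OF r])
    finally show ?thesis using polygon_power_summable(2)[OF n k u] by linarith
  qed
  show "(r / (1 - r\<^sup>2)) ^ n - 2 * A \<le> polygon_sum n k \<rho> r"
    by (rule gen) (use r in \<open>auto simp: mode_gap_def\<close>)
  show "((\<rho> / r) / (1 - (\<rho> / r)\<^sup>2)) ^ n - 2 * A \<le> polygon_sum n k \<rho> r"
    by (rule gen) (use r in \<open>auto simp: mode_gap_def\<close>)
qed

lemma polygon_sum_continuous:
  assumes ab: "0 < \<rho>" "\<rho> < a" "b < 1"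
  shows "continuous_on {a..b} (polygon_sum n k \<rho>)"
proof (rule uniform_limit_theorem)
  let ?f = "\<lambda>r m. polygon_coeff n k m * mode_weight n \<rho> r m"
  show "uniform_limit {a..b} (\<lambda>M r. \<Sum>m<M. ?f r m) (polygon_sum n k \<rho>) sequentially"
    unfolding polygon_sum_def[abs_def]
  proof (cases "a \<le> b")
    case True
    show "uniform_limit {a..b} (\<lambda>M r. \<Sum>m<M. ?f r m) (\<lambda>r. \<Sum>m. ?f r m) sequentially"
    proof (rule Weierstrass_m_test)
      show "summable (\<lambda>m. (polygon_coeff n k m * b ^ (2 * m + n) + polygon_coeff n k m * (\<rho> / a) ^ (2 * m + n)) / (1 - \<rho>))"
        by (intro summable_divide summable_add polygon_power_summable(1) n k) (use ab True in auto)
      fix m r assume r: "r \<in> {a..b}"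
      have r': "0 < \<rho>" "\<rho> < r" "r < 1" using r ab by auto
      have le: "r ^ (2 * m + n) \<le> b ^ (2 * m + n)" "(\<rho> / r) ^ (2 * m + n) \<le> (\<rho> / a) ^ (2 * m + n)"
        using r ab by (auto intro!: power_mono divide_left_mono)
      have "mode_weight n \<rho> r m \<le> (r ^ (2 * m + n) + (\<rho> / r) ^ (2 * m + n)) / (1 - \<rho>)"
        by (rule mode_weight_bounds(2)[OF r' n])
      also have "\<dots> \<le> (b ^ (2 * m + n) + (\<rho> / a) ^ (2 * m + n)) / (1 - \<rho>)"
        using le r' by (intro divide_right_mono) auto
      finally have "?f r m \<le> polygon_coeff n k m * ((b ^ (2 * m + n) + (\<rho> / a) ^ (2 * m + n)) / (1 - \<rho>))"
        by (intro mult_left_mono polygon_coeff_nonneg n k)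
      then show "norm (?f r m) \<le> (polygon_coeff n k m * b ^ (2 * m + n) + polygon_coeff n k m * (\<rho> / a) ^ (2 * m + n)) / (1 - \<rho>)"
        using mode_weight_bounds(1)[OF r' n, of m] polygon_coeff_nonneg[OF n k, of m] by (simp add: distrib_left)
    qed
  qed simp
  show "\<forall>\<^sub>F M in sequentially. continuous_on {a..b} (\<lambda>r. \<Sum>m<M. ?f r m)"
    unfolding mode_weight_def mode_gap_def divide_inverse[of _ "1 - _"]
    by (intro always_eventually allI continuous_intros) (use ab in auto)
qed simp

text \<open>
  The interval is open, so a minimum exists only because the function blows up at both ends.
\<close>
lemma polygon_function_attains_min:
  fixes C c :: real
  assumes \<rho>: "0 < \<rho>" "\<rho> < 1" and C: "C > 0"
  defines "f \<equiv> \<lambda>r. (polygon_sum n k \<rho> r - C) / r ^ n"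
  obtains x where "\<rho> < x" "x < 1" "\<And>r. \<rho> < r \<Longrightarrow> r < 1 \<Longrightarrow> f x \<le> f r"
proof -
  define t where "t = sqrt \<rho>"
  have t: "\<rho> < t" "t < 1" "0 < t" using sqrt_between[OF \<rho>] by (auto simp: t_def)
  define A where "A = (\<Sum>m. polygon_coeff n k m * \<rho> ^ (2 * m + n))"
  have A: "A \<ge> 0" unfolding A_def
    using \<rho> by (intro suminf_nonneg polygon_power_summable(1) n k mult_nonneg_nonneg polygon_coeff_nonneg) auto
  define M where "M = max 0 (f t) + C + 2 * A + 1"
  have M: "M \<ge> 1" using A C by (simp add: M_def)
  have M4: "1 / (4 * M) \<le> 1 / 4" "1 / (4 * M) > 0" using M by (simp_all add: field_simps)
  \<comment> \<open>once \<open>r\<close> or \<open>\<rho> / r\<close> reaches this value, \<open>polygon_sum_lower\<close> forces the quotient above \<open>f t\<close>\<close>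
  define e where "e = 1 - 1 / (4 * M)"
  have e: "0 < e" "e < 1" using M4 by (auto simp: e_def)
  have big: "f t \<le> f r" if r: "\<rho> < r" "r < 1" and c: "e \<le> r \<or> e \<le> \<rho> / r" for r
  proof -
    have "M - 2 * A \<le> polygon_sum n k \<rho> r"
      using c
    proof
      assume "e \<le> r"
      then have "M \<le> (r / (1 - r\<^sup>2)) ^ n" using r n M by (intro ratio_power_large) (auto simp: e_def)
      then show ?thesis using polygon_sum_lower(1)[OF \<rho>(1) r] by (simp add: A_def)
    next
      assume "e \<le> \<rho> / r"
      then have "M \<le> ((\<rho> / r) / (1 - (\<rho> / r)\<^sup>2)) ^ n"
        using r \<rho> n M by (intro ratio_power_large) (auto simp: e_def)
      then show ?thesis using polygon_sum_lower(2)[OF \<rho>(1) r] by (simp add: A_def)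
    qed
    then have "max 0 (f t) \<le> polygon_sum n k \<rho> r - C" unfolding M_def by linarith
    moreover have "polygon_sum n k \<rho> r - C \<le> f r" if "0 \<le> polygon_sum n k \<rho> r - C"
    proof -
      have "r > 0" using r \<rho> by linarith
      then have "0 < r ^ n" "r ^ n \<le> 1" using r by (auto simp: power_le_one)
      then show ?thesis unfolding f_def using that by (simp add: pos_le_divide_eq mult_left_le)
    qed
    ultimately show ?thesis by linarith
  qed
  define a where "a = min t (\<rho> / e)"
  define b where "b = max t e"
  have ab: "\<rho> < a" "a \<le> t" "t \<le> b" "b < 1"
    using t e \<rho> by (auto simp: a_def b_def pos_less_divide_eq)
  have "continuous_on {a..b} f"
    unfolding f_def
    by (intro continuous_intros polygon_sum_continuous) (use ab \<rho> in auto)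
  then obtain x where x: "x \<in> {a..b}" "\<And>r. r \<in> {a..b} \<Longrightarrow> f x \<le> f r"
    using continuous_attains_inf[of "{a..b}" f] ab by auto
  show thesis
  proof (rule that[of x])
    show "\<rho> < x" "x < 1" using x ab by auto
    fix r assume r: "\<rho> < r" "r < 1"
    show "f x \<le> f r"
    proof (cases "r \<in> {a..b}")
      case True
      then show ?thesis by (rule x)
    next
      case False
      then have "r < a \<or> b < r" by auto
      then have "e \<le> r \<or> e \<le> \<rho> / r"
      proof
        assume "r < a"
        then have "r < \<rho> / e" by (simp add: a_def)
        then have "e \<le> \<rho> / r" using e r \<rho> by (simp add: field_simps)
        then show ?thesis ..
      qed (simp add: b_def)
      from big[OF r this] x(2)[of t] ab show ?thesis by auto
    qed
  qed
qed

end


section \<open>The threshold\<close>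

lemma C_const_pos:
  assumes "k \<ge> 2"
  shows "C_const k N > 0"
  unfolding C_const_def
proof (rule sum_pos)
  show "{1..k-1} \<noteq> {}" using assms by auto
  fix j assume j: "j \<in> {1..k-1}"
  then have "0 < pi * real j / real k" "pi * real j / real k < pi"
    using assms by (auto simp: field_simps)
  then have "0 < sin (pi * real j / real k)" by (rule sin_gt_zero)
  then show "0 < 1 / (2 * sin (pi * real j / real k)) ^ (N - 2)" by simp
qed simp

text \<open>
  For \<open>7 j \<le> k\<close> the number \<open>2 sin (\<pi> j / k)\<close> is at most \<open>7 j / k \<le> 1\<close>, since \<open>2 \<pi> < 7\<close>; being at
  most \<open>1\<close>, its \<open>n\<close>-th power is no larger than itself, and the harmonic numbers appear.
\<close>
lemma C_const_lower:
  assumes n: "n \<ge> 1" and m: "7 * m \<le> k" "k \<ge> 2"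
  shows "real k * (harm m / 7) \<le> C_const k (n + 2)"
proof -
  have pos: "0 < sin (pi * real j / real k)" if "1 \<le> j" "j \<le> k - 1" for j
    using that m by (intro sin_gt_zero) (auto simp: field_simps)
  have "real k * (harm m / 7) = (\<Sum>j=1..m. real k / (7 * real j))"
    by (simp add: harm_def sum_distrib_left sum_divide_distrib field_simps)
  also have "\<dots> \<le> (\<Sum>j=1..m. 1 / (2 * sin (pi * real j / real k)) ^ n)"
  proof (rule sum_mono)
    fix j assume j: "j \<in> {1..m}"
    let ?s = "2 * sin (pi * real j / real k)"
    have s0: "?s > 0" using pos[of j] j m by auto
    have "sin (pi * real j / real k) \<le> pi * real j / real k" by (rule sin_x_le_x) simp
    then have "?s \<le> 2 * pi * real j / real k" by simp
    also have "\<dots> \<le> 7 * real j / real k"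
      using pi_less_4 pi_approx by (intro divide_right_mono mult_right_mono) auto
    finally have s7: "?s \<le> 7 * real j / real k" .
    also have "\<dots> \<le> 1" using j m by (simp add: divide_le_eq)
    finally have "?s ^ n \<le> ?s ^ 1" using s0 n by (intro power_decreasing) auto
    then have "?s ^ n \<le> 7 * real j / real k" using s7 by simp
    then have "1 / (7 * real j / real k) \<le> 1 / ?s ^ n" using s0 by (intro divide_left_mono) (use j m in auto)
    then show "real k / (7 * real j) \<le> 1 / ?s ^ n" by simp
  qed
  also have "\<dots> \<le> (\<Sum>j=1..k-1. 1 / (2 * sin (pi * real j / real k)) ^ n)"
    by (intro sum_mono2) (use m pos in \<open>auto intro!: less_imp_le\<close>)
  finally show ?thesis by (simp add: C_const_def)
qed

lemma eventually_C_const_large: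
  assumes n: "n \<ge> 1"
  shows "eventually (\<lambda>k. real k * K < C_const k (n + 2)) sequentially"
proof -
  obtain m where m: "harm m > 7 * \<bar>K\<bar>"
    using filterlim_at_top_dense[THEN iffD1, OF harm_at_top, rule_format, of "7 * \<bar>K\<bar>"]
    by (auto simp: eventually_sequentially)
  have "eventually (\<lambda>k. k \<ge> max 2 (7 * m)) sequentially" by (rule eventually_ge_at_top)
  then show ?thesis
  proof eventually_elim
    case (elim k)
    have "real k * K < real k * (harm m / 7)" using m elim by (intro mult_strict_left_mono) auto
    also have "\<dots> \<le> C_const k (n + 2)" using elim by (intro C_const_lower n) auto
    finally show ?case .
  qed
qed

text \<open>
  Between two thresholds the same function would have both a positive and a negative minimum.
\<close>
lemma threshold_unique:
  assumes "is_threshold p q k a" "is_threshold p q k b"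
  shows "a = b"
proof -
  have "\<not> a < b" if "is_threshold p q k a" "is_threshold p q k b" for a b
  proof
    assume "a < b"
    then obtain c where c: "a < c" "c < b" using dense by blast
    have "0 < a" "b < 1" using that by (auto simp: is_threshold_def)
    then have "c \<in> {a<..<1}" "c \<in> {0<..<b}" using c by auto
    then have "\<exists>m>0. is_min_on {c<..<1} (Lambda1 p q k c) m" "\<exists>m<0. is_min_on {c<..<1} (Lambda1 p q k c) m"
      using that unfolding is_threshold_def by blast+
    then obtain m m' where m: "m > 0" "is_min_on {c<..<1} (Lambda1 p q k c) m"
      and m': "m' < 0" "is_min_on {c<..<1} (Lambda1 p q k c) m'" by blast
    from m'(2) obtain x where "x \<in> {c<..<1}" "Lambda1 p q k c x = m'" by (auto simp: is_min_on_def)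
    then have "m \<le> m'" using m(2) by (auto simp: is_min_on_def)
    with m(1) m'(1) show False by simp
  qed
  from this[OF assms] this[OF assms(2,1)] show ?thesis by simp
qed

text \<open>
  The factor \<open>2 m + N - 2\<close> in the normalisation of the zonal harmonics cancels the one in the relation,
  and \<open>d_coeff\<close> is the value of the zonal harmonic at the pole, that is the term \<open>j = 0\<close>.
\<close>
lemma relation_term_eq:
  fixes p q :: "'n::finite"
  assumes N3: "CARD('n) \<ge> 3" and pq: "p \<noteq> q" and k: "k \<ge> 2" and s: "0 < s" "s < 1"
  defines "n \<equiv> CARD('n) - 2"
  shows "relation_term p q k s m
    = polygon_coeff n k m * (2 * sqrt s ^ (2 * m + n) / (1 + sqrt s ^ (2 * m + n))) / real n"
proof -
  have n: "n \<ge> 1" "CARD('n) = n + 2" using N3 by (auto simp: n_def)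
  have rN: "real CARD('n) = real n + 2" using n by simp
  have lam: "(real CARD('n) - 2) / 2 = real n / 2" by (simp add: rN)
  let ?w = "(2 * real m + real n) / real n"
  have "s powr ((2 * real m + real CARD('n) - 2) / 2) = sqrt s powr (2 * real m + real n)"
    using s by (simp add: powr_half_sqrt[symmetric] powr_powr rN)
  also have "\<dots> = sqrt s powr real (2 * m + n)" by simp
  also have "\<dots> = sqrt s ^ (2 * m + n)" using s by (intro powr_realpow) auto
  finally have pw: "s powr ((2 * real m + real CARD('n) - 2) / 2) = sqrt s ^ (2 * m + n)" .
  have xd: "xi_dir p q k j = xi p q k 1 j" for j
    unfolding xi_dir_def using norm_xi[OF pq, of 1 k j] by simp
  have "xi_dir p q k 1 \<bullet> xi_dir p q k (j + 1) = cos (2 * pi * real j / real k)" for j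
    unfolding xd xi_1_inner by simp
  then have z: "zonal m (xi_dir p q k 1) (xi_dir p q k (j + 1)) = ?w * gegenbauer_trig (real n / 2) m (2 * pi * real j / real k)" for j
    unfolding zonal_def lam using gegenbauer_cos[of "real n / 2"] n(1) by (simp add: rN add_ac)
  have d: "d_coeff CARD('n) m = ?w * gegenbauer_trig (real n / 2) m 0"
  proof -
    have "gegenbauer_trig (real n / 2) m 0 = real ((n + m - 1) choose (n - 1))" by (rule gegenbauer_trig_at_0[OF n(1)])
    moreover have "CARD('n) + m - 3 = n + m - 1" "CARD('n) - 3 = n - 1" using n by auto
    ultimately show ?thesis by (simp add: d_coeff_def rN add_ac)
  qed
  have split: "{..<k} = insert 0 {1..k-1}" using k by auto
  have "d_coeff CARD('n) m + (\<Sum>j=1..k-1. zonal m (xi_dir p q k 1) (xi_dir p q k (j + 1)))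
      = ?w * polygon_coeff n k m"
    unfolding d z polygon_coeff_def split by (simp add: distrib_left sum_distrib_left)
  then have "relation_term p q k s m = 1 / (2 * real m + real n)
     * (2 * sqrt s ^ (2 * m + n) / (1 + sqrt s ^ (2 * m + n))) * (?w * polygon_coeff n k m)"
    unfolding relation_term_def pw by (simp add: rN)
  also have "\<dots> = ((2 * real m + real n) / (2 * real m + real n)) * (polygon_coeff n k m * (2 * sqrt s ^ (2 * m + n) / (1 + sqrt s ^ (2 * m + n))) / real n)"
    by simp
  also have "(2 * real m + real n) / (2 * real m + real n) = 1" using n by simp
  finally show ?thesis by simp
qed

lemma threshold_relation_iff:
  fixes p q :: "'n::finite"
  assumes N3: "CARD('n) \<ge> 3" and pq: "p \<noteq> q" and k: "k \<ge> 2" and s: "0 < s" "s < 1"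
  shows "threshold_relation p q k s \<longleftrightarrow> polygon_min (CARD('n) - 2) k (sqrt s) = C_const k CARD('n)"
proof -
  let ?n = "CARD('n) - 2"
  have n: "?n \<ge> 1" "k \<ge> 1" "real CARD('n) - 2 = real ?n" using N3 k by auto
  have t: "0 \<le> sqrt s" "sqrt s < 1" using s by auto
  note S = polygon_min_summable[OF n(1,2) t]
  have eq: "relation_term p q k s = (\<lambda>m. polygon_coeff ?n k m * (2 * sqrt s ^ (2 * m + ?n) / (1 + sqrt s ^ (2 * m + ?n))) / real ?n)"
    by (rule ext) (rule relation_term_eq[OF N3 pq k s])
  have 1: "summable (relation_term p q k s)" unfolding eq by (rule summable_divide[OF S])
  have 2: "(\<Sum>m. relation_term p q k s m) = polygon_min ?n k (sqrt s) / real ?n"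
    unfolding eq polygon_min_def by (rule suminf_divide[OF S])
  have "- c / M + r / M = 0 \<longleftrightarrow> r = c" if "M > 0" for c r M :: real using that by (auto simp: field_simps)
  moreover have "real ?n > 0" using n by simp
  ultimately have "- c / real ?n + r / real ?n = 0 \<longleftrightarrow> r = c" for c r :: real by blast
  then show ?thesis unfolding threshold_relation_def 2 n(3) using 1 by auto
qed

lemma threshold_at_root:
  fixes p q :: "'n::finite"
  assumes N3: "CARD('n) \<ge> 3" and pq: "p \<noteq> q" and k: "k \<ge> 2" and t: "0 < t" "t < 1"
    and root: "polygon_min (CARD('n) - 2) k t = C_const k CARD('n)"
  shows "is_threshold p q k (t\<^sup>2)"
proof -
  define n where "n = CARD('n) - 2"
  have n: "n \<ge> 1" "k \<ge> 1" using N3 k by (auto simp: n_def)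
  let ?C = "C_const k CARD('n)"
  define c where "c = 1 / (sphere_area TYPE('n) * (real CARD('n) - 2))"
  have c: "c > 0"
    using N3 unit_ball_vol_pos[of "real CARD('n)"] by (simp add: c_def sphere_area_eq)
  have L: "Lambda1 p q k \<rho> r = c * ((polygon_sum n k \<rho> r - ?C) / r ^ n)" if "0 < \<rho>" "\<rho> < r" "r < 1" for \<rho> r
    unfolding c_def n_def by (simp add: Lambda1_eq[OF N3 pq k that])
  have "\<exists>x. \<rho> < x \<and> x < 1 \<and> is_min_on {\<rho><..<1} (Lambda1 p q k \<rho>) (Lambda1 p q k \<rho> x)"
    if \<rho>: "0 < \<rho>" "\<rho> < 1" for \<rho>
  proof -
    obtain x where x: "\<rho> < x" "x < 1"
      "\<And>r. \<rho> < r \<Longrightarrow> r < 1 \<Longrightarrow> (polygon_sum n k \<rho> x - ?C) / x ^ n \<le> (polygon_sum n k \<rho> r - ?C) / r ^ n"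
      using polygon_function_attains_min[OF n \<rho> C_const_pos[OF k, of "CARD('n)"]] by blast
    have "Lambda1 p q k \<rho> x \<le> Lambda1 p q k \<rho> r" if "\<rho> < r" "r < 1" for r
      unfolding L[OF \<rho>(1) x(1,2)] L[OF \<rho>(1) that] using x(3)[OF that] c by (intro mult_left_mono) auto
    then show ?thesis using x by (auto simp: is_min_on_def intro!: exI[of _ x])
  qed
  then obtain x where x: "\<And>\<rho>. 0 < \<rho> \<Longrightarrow> \<rho> < 1 \<Longrightarrow>
      \<rho> < x \<rho> \<and> x \<rho> < 1 \<and> is_min_on {\<rho><..<1} (Lambda1 p q k \<rho>) (Lambda1 p q k \<rho> (x \<rho>))"
    by metis
  have t2: "0 < t\<^sup>2" "t\<^sup>2 < 1" using t by (auto simp: power_less_one_iff)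
  show ?thesis
    unfolding is_threshold_def
  proof (intro conjI ballI)
    show "t\<^sup>2 \<in> {0<..<1}" using t2 by simp
    fix \<rho> assume "\<rho> \<in> {t\<^sup>2<..<1}"
    then have \<rho>: "0 < \<rho>" "\<rho> < 1" "t < sqrt \<rho>"
      using less_trans[OF t2(1), of \<rho>] by (auto intro: real_less_rsqrt)
    have r: "\<rho> < x \<rho>" "x \<rho> < 1" using x[OF \<rho>(1,2)] by auto
    have "?C < polygon_min n k (sqrt \<rho>)"
      using polygon_min_strict_mono[OF n, of t "sqrt \<rho>"] t \<rho> root by (simp add: n_def)
    also have "\<dots> \<le> polygon_sum n k \<rho> (x \<rho>)" by (rule polygon_sum_ge_polygon_min[OF n \<rho>(1) r])
    finally have "Lambda1 p q k \<rho> (x \<rho>) > 0"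
      unfolding L[OF \<rho>(1) r] using c r \<rho> by (intro mult_pos_pos divide_pos_pos) auto
    then show "\<exists>m>0. is_min_on {\<rho><..<1} (Lambda1 p q k \<rho>) m" using x[OF \<rho>(1,2)] by blast
  next
    fix \<rho> assume "\<rho> \<in> {0<..<t\<^sup>2}"
    then have \<rho>: "0 < \<rho>" "\<rho> < 1" "sqrt \<rho> < t" using t2 t by (auto intro: real_less_lsqrt)
    note s = sqrt_between[OF \<rho>(1,2)]
    have "polygon_sum n k \<rho> (sqrt \<rho>) < ?C"
      unfolding polygon_sum_at_sqrt[OF n \<rho>(1,2)]
      using polygon_min_strict_mono[OF n, of "sqrt \<rho>" t] t s \<rho> root by (simp add: n_def)
    then have "Lambda1 p q k \<rho> (sqrt \<rho>) < 0"
      unfolding L[OF \<rho>(1) s(1,2)] using c s by (intro mult_pos_neg divide_neg_pos) auto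
    moreover have "Lambda1 p q k \<rho> (x \<rho>) \<le> Lambda1 p q k \<rho> (sqrt \<rho>)"
      using x[OF \<rho>(1,2)] s by (auto simp: is_min_on_def)
    ultimately have "Lambda1 p q k \<rho> (x \<rho>) < 0" by linarith
    then show "\<exists>m<0. is_min_on {\<rho><..<1} (Lambda1 p q k \<rho>) m" using x[OF \<rho>(1,2)] by blast
  qed
qed

lemma quadratic_lower_bound:
  fixes a \<rho> :: real
  assumes a: "a > 0" and \<rho>: "\<rho> < 1" and q: "a * (1 - \<rho>)\<^sup>2 < \<rho>"
  shows "(2 * a + 1 - sqrt (4 * a + 1)) / (2 * a) < \<rho>"
proof (rule ccontr)
  assume "\<not> ?thesis"
  then have "\<rho> * (2 * a) \<le> 2 * a + 1 - sqrt (4 * a + 1)"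
    using a by (simp add: not_less pos_le_divide_eq)
  then have "sqrt (4 * a + 1) \<le> 2 * a * (1 - \<rho>) + 1" by (simp add: algebra_simps)
  then have "(sqrt (4 * a + 1))\<^sup>2 \<le> (2 * a * (1 - \<rho>) + 1)\<^sup>2" using a by (intro power_mono) auto
  then have "4 * a + 1 \<le> (2 * a * (1 - \<rho>) + 1)\<^sup>2" using a by simp
  also have "\<dots> = 4 * a * (a * (1 - \<rho>)\<^sup>2) + 4 * a * (1 - \<rho>) + 1"
    by (simp add: power2_eq_square algebra_simps)
  also have "\<dots> < 4 * a * \<rho> + 4 * a * (1 - \<rho>) + 1" using a q by simp
  also have "\<dots> = 4 * a + 1" by (simp add: algebra_simps)
  finally show False by simp
qed

text \<open>
  The upper bound for \<open>polygon_min\<close>, solved for \<open>t\<close>.  It yields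
  \<open>(C / (2 k)) powr (2 / n) < (t / (1 - t\<^sup>2))\<^sup>2\<close>, and \<open>a_const\<close> is at most the left-hand side because
  \<open>n\<^sup>n\<^sup>-\<^sup>1 \<ge> 1\<close>.
\<close>
lemma root_lower_bound:
  assumes n: "n \<ge> 1" and k: "k \<ge> 2" and t: "0 < t" "t < 1"
    and root: "polygon_min n k t = C_const k (n + 2)"
  shows "0 < a_const k (n + 2)" "a_const k (n + 2) * (1 - t\<^sup>2)\<^sup>2 < t\<^sup>2"
proof -
  let ?C = "C_const k (n + 2)"
  have C: "?C > 0" by (rule C_const_pos[OF k])
  define X where "X = t / (1 - t\<^sup>2)"
  have d: "1 - t\<^sup>2 > 0" using t by (simp add: power_less_one_iff)
  have X: "X > 0" using t d by (simp add: X_def)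
  define Y where "Y = ?C / (2 * real k * real n ^ (n - 1))"
  have nn: "real n ^ (n - 1) \<ge> 1" using n by (simp add: one_le_power)
  have Y: "Y > 0" using C k n by (simp add: Y_def)
  have "Y \<le> ?C / (2 * real k)"
    unfolding Y_def using C k nn n by (intro divide_left_mono mult_pos_pos) auto
  also have "\<dots> < X ^ n"
  proof -
    have "?C < 2 * real k * X ^ n"
      using polygon_min_upper[OF n _ t, of k] k root by (simp add: X_def)
    then show ?thesis using k by (simp add: pos_divide_less_eq mult_ac)
  qed
  finally have YX: "Y < X ^ n" .
  have a: "a_const k (n + 2) = Y powr (2 / real n)"
    by (simp add: a_const_def Y_def)
  show "0 < a_const k (n + 2)" unfolding a using Y by simp
  have "a_const k (n + 2) < (X ^ n) powr (2 / real n)"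
    unfolding a using Y YX n by (intro powr_less_mono2) auto
  also have "\<dots> = X\<^sup>2"
  proof -
    have "(X ^ n) powr (2 / real n) = (X powr real n) powr (2 / real n)"
      using X by (simp only: powr_realpow)
    also have "\<dots> = X powr 2" unfolding powr_powr using n by simp
    also have "\<dots> = X\<^sup>2" using X by simp
    finally show ?thesis .
  qed
  finally have "a_const k (n + 2) * (1 - t\<^sup>2)\<^sup>2 < X\<^sup>2 * (1 - t\<^sup>2)\<^sup>2"
    using d by (intro mult_strict_right_mono) auto
  also have "\<dots> = t\<^sup>2" using d by (simp add: X_def power_divide)
  finally show "a_const k (n + 2) * (1 - t\<^sup>2)\<^sup>2 < t\<^sup>2" .
qed

theorem mainTheorem3:
  fixes p q :: "'n::finite"
  assumes "CARD('n) \<ge> 3" and "p \<noteq> q"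
  shows "(\<forall>k\<ge>2. \<exists>!\<rho>k. is_threshold p q k \<rho>k) \<and>
    (\<forall>\<rho> :: nat \<Rightarrow> real. (\<forall>k\<ge>2. is_threshold p q k (\<rho> k)) \<longrightarrow>
      (\<forall>k\<ge>2.
         (\<forall>s\<in>{0<..<1}. threshold_relation p q k s \<longleftrightarrow> s = \<rho> k) \<and>
         \<rho> k > (2 * a_const k CARD('n) + 1 - sqrt (4 * a_const k CARD('n) + 1))
                 / (2 * a_const k CARD('n))) \<and>
      \<rho> \<longlonglongrightarrow> 1)"
proof -
  define n where "n = CARD('n) - 2"
  have n: "n \<ge> 1" and N: "CARD('n) = n + 2" using assms(1) by (auto simp: n_def)
  have "\<exists>t. 0 < t \<and> t < 1 \<and> polygon_min n k t = C_const k CARD('n)" if k: "k \<ge> 2" for k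
    using polygon_min_root[OF n _ C_const_pos[OF k, of "CARD('n)"], of k] k by force
  then obtain t where t: "\<And>k. k \<ge> 2 \<Longrightarrow> 0 < t k \<and> t k < 1 \<and> polygon_min n k (t k) = C_const k CARD('n)"
    by metis
  have thr: "is_threshold p q k ((t k)\<^sup>2)" if "k \<ge> 2" for k
    using threshold_at_root[OF assms that] t[OF that] by (simp add: n_def)
  have "\<exists>!\<rho>k. is_threshold p q k \<rho>k" if "k \<ge> 2" for k
    using thr[OF that] threshold_unique by blast
  moreover have "(\<forall>k\<ge>2.
         (\<forall>s\<in>{0<..<1}. threshold_relation p q k s \<longleftrightarrow> s = \<rho> k) \<and>
         \<rho> k > (2 * a_const k CARD('n) + 1 - sqrt (4 * a_const k CARD('n) + 1))
                 / (2 * a_const k CARD('n))) \<and> \<rho> \<longlonglongrightarrow> 1"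
    if \<rho>: "\<forall>k\<ge>2. is_threshold p q k (\<rho> k)" for \<rho> :: "nat \<Rightarrow> real"
  proof (intro conjI allI impI ballI)
    have \<rho>t: "\<rho> k = (t k)\<^sup>2" if "k \<ge> 2" for k
      using threshold_unique \<rho> thr that by blast
    have bounds: "0 < \<rho> k" "\<rho> k < 1" if "k \<ge> 2" for k
      using \<rho> that by (auto simp: is_threshold_def)
    fix k :: nat assume k: "k \<ge> 2"
    then have k1: "k \<ge> 1" by simp
    note tk = t[OF k]
    show "threshold_relation p q k s \<longleftrightarrow> s = \<rho> k" if s: "s \<in> {0<..<1}" for s
    proof -
      have s': "0 < s" "s < 1" "0 \<le> sqrt s" "sqrt s < 1" using s by auto
      have "threshold_relation p q k s \<longleftrightarrow> polygon_min n k (sqrt s) = polygon_min n k (t k)"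
        using threshold_relation_iff[OF assms k s'(1,2)] tk by (simp add: n_def)
      also have "\<dots> \<longleftrightarrow> sqrt s = t k"
        using polygon_min_less_iff[OF n k1, of "sqrt s" "t k"] polygon_min_less_iff[OF n k1, of "t k" "sqrt s"] s' tk
        by (metis less_imp_le less_irrefl linorder_neqE_linordered_idom)
      also have "\<dots> \<longleftrightarrow> s = \<rho> k"
      proof
        assume e: "sqrt s = t k"
        have "(sqrt s)\<^sup>2 = s" using s' by simp
        then show "s = \<rho> k" unfolding e \<rho>t[OF k] by simp
      next
        assume "s = \<rho> k"
        then show "sqrt s = t k" using \<rho>t[OF k] tk real_sqrt_unique[of "t k" s] by simp
      qed
      finally show ?thesis .
    qed
    have root: "polygon_min n k (t k) = C_const k (n + 2)" using tk by (simp add: N)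
    have "0 < t k" "t k < 1" using tk by auto
    note lb = root_lower_bound[OF n k this root]
    show "\<rho> k > (2 * a_const k CARD('n) + 1 - sqrt (4 * a_const k CARD('n) + 1)) / (2 * a_const k CARD('n))"
      unfolding N by (rule quadratic_lower_bound) (use lb bounds[OF k] \<rho>t[OF k] in auto)
  next
    have \<rho>t: "\<rho> k = (t k)\<^sup>2" if "k \<ge> 2" for k
      using threshold_unique \<rho> thr that by blast
    have bounds: "0 < \<rho> k" "\<rho> k < 1" if "k \<ge> 2" for k
      using \<rho> that by (auto simp: is_threshold_def)
    show "\<rho> \<longlonglongrightarrow> 1"
    proof (rule order_tendstoI)
      fix a :: real assume "a < 1"
      define s where "s = max a (1 / 2)"
      have s: "a \<le> s" "0 < s" "s < 1" using \<open>a < 1\<close> by (auto simp: s_def)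
      have ss: "0 < sqrt s" "sqrt s < 1" using s by auto
      show "\<forall>\<^sub>F k in sequentially. a < \<rho> k"
        using eventually_C_const_large[OF n, of "2 * (sqrt s / (1 - (sqrt s)\<^sup>2)) ^ n"] eventually_ge_at_top[of 2]
      proof eventually_elim
        case (elim k)
        have k1: "k \<ge> 1" using elim by simp
        have "polygon_min n k (sqrt s) < 2 * real k * (sqrt s / (1 - (sqrt s)\<^sup>2)) ^ n"
          by (rule polygon_min_upper[OF n k1 ss])
        also have "\<dots> = real k * (2 * (sqrt s / (1 - (sqrt s)\<^sup>2)) ^ n)" by simp
        also have "\<dots> < polygon_min n k (t k)" using elim t[of k] by (simp add: N)
        finally have "sqrt s < t k"
          using polygon_min_less_iff[OF n k1, of "sqrt s" "t k"] ss t[of k] elim by simp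
        then have "(sqrt s)\<^sup>2 < (t k)\<^sup>2" using ss by (intro power_strict_mono) auto
        then show ?case using s \<rho>t[of k] elim by simp
      qed
    next
      fix a :: real assume "1 < a"
      show "\<forall>\<^sub>F k in sequentially. \<rho> k < a"
        using eventually_ge_at_top[of 2]
        by eventually_elim (use bounds(2) \<open>1 < a\<close> in force)
    qed
  qed
  ultimately show ?thesis by blast
qed

end
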